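(* Let $T\in\mathbb{N}$, $p\in(1,\infty)$, $q=p/(p-1)$ and $P\in\mathcal{P}_p(\mathbb{R}^T)$. Let $f\colon\mathbb{R}^T\times\{1,\dots,T\}\to\mathbb{R}$ be such that $f(X,t)$ is $\mathcal{F}_t^X$-measurable for $t=1,\dots,T$. Assume that $f(\cdot,t)$ is continuously differentiable for every $t=1,\dots,T$ and that there is a constant $c>0$ such that $$\sum_{s=1}^T|\partial_{x_s}f(x,t)|\le c\Big(1+\sum_{s=1}^T|x_s|^{p-1}\Big)\qquad\text{for every } x\in\mathbb{R}^T \text{ and } t=1,\dots,T.$$ Furthermore assume that there exists exactly one (up to $P$-almost sure equality) optimal stopping time $\tau^\ast$ for $s(P)$, i.e. exactly one $\tau^\ast\in\mathrm{ST}$ with $s(P)=E_P[f(X,\tau^\ast)]$. Then, as $r\downarrow 0$, $$\sup_{Q\in B_r(P)}s(Q)=s(P)+r\cdot\Big(\sum_{t=1}^T E_P\Big[\big|E_P[\partial_{x_t}f(X,\tau^\ast)\,|\,\mathcal{F}_t^X]\big|^q\Big]\Big)^{1/q}+o(r).$$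
   Context: $\mathcal{P}_p(\mathbb{R}^T)$ is the set of Borel probability measures on $\mathbb{R}^T$ with finite $p$-th moment. $X=(X_t)_{t=1}^T$ is the canonical process (identity map) on $\mathbb{R}^T$, and $\mathcal{F}^X_t=\sigma(X_s: s\le t)$, with $\mathcal{F}^X_0$ trivial. $\partial_{x_t}f(x,u)$ is the partial derivative in the $t$-th coordinate of $x$, with the second argument $u\in\{1,\dots,T\}$ held fixed; $\partial_{x_t}f(X,\tau^\ast)$ means this derivative evaluated at $u=\tau^\ast(X)$. $\mathrm{ST}$ is the set of stopping times $\tau\colon\mathbb{R}^T\to\{1,\dots,T\}$, i.e. $\{\tau\le t\}\in\mathcal{F}_t^X$ for every $t$. For $Q\in\mathcal{P}_p(\mathbb{R}^T)$, $s(Q)=\inf_{\tau\in\mathrm{ST}}E_Q[f(X,\tau)]$. On $\mathbb{R}^T\times\mathbb{R}^T$, let $X,Y$ denote the projections to the first and second coordinate. A coupling $\pi$ between $P,Q\in\mathcal{P}_p(\mathbb{R}^T)$ is a Borel probability measure on $\mathbb{R}^T\times\mathbb{R}^T$ with first marginal $P$ and second marginal $Q$. It is causal if, $\pi$-almost surely, $\pi((Y_1,\dots,Y_t)\in A\,|\,X_1,\dots,X_T)=\pi((Y_1,\dots,Y_t)\in A\,|\,X_1,\dots,X_t)$ for all Borel $A\subseteq\mathbb{R}^t$ and all $1\le t\le T$. It is bicausal if it is causal and the same condition holds with the roles of $X$ and $Y$ reversed. The adapted Wasserstein distance is $\mathcal{AW}_p(P,Q)=\inf_\pi\big(\sum_{t=1}^T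 E_\pi[|X_t-Y_t|^p]\big)^{1/p}$, where the infimum is over all bicausal couplings $\pi$ between $P$ and $Q$. For $r\ge 0$, $B_r(P)=\{Q\in\mathcal{P}_p(\mathbb{R}^T):\mathcal{AW}_p(P,Q)\le r\}$. *)

theory Defs
  imports "HOL-Probability.Probability" "HOL-Library.Landau_Symbols"
begin

text \<open>
  The time set \<open>{1, ..., T}\<close> is a finite, linearly ordered index type \<open>'n\<close> with
  \<open>T = CARD('n)\<close> (any such type is order isomorphic to \<open>{1, ..., T}\<close>), so that
  the path space is \<open>real ^ 'n\<close>.
\<close>

type_synonym 'n path = "(real, 'n) vec"

definition gen_by :: "('a \<Rightarrow> 'n::finite path) \<Rightarrow> 'n set \<Rightarrow> 'a measure" where
  "gen_by Z S = sigma UNIV {(\<lambda>\<omega>. Z \<omega> $ s) -` A | s A. s \<in> S \<and> A \<in> sets borel}"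

definition canon_filt :: "'n::{finite, linorder} \<Rightarrow> 'n path measure" where
  "canon_filt t = gen_by (\<lambda>x. x) {..t}"

definition ST :: "('n::{finite, linorder} path \<Rightarrow> 'n) set" where
  "ST = {\<tau>. stopping_time canon_filt \<tau>}"

definition wass_space :: "real \<Rightarrow> 'n::finite path measure set" where
  "wass_space p =
     {Q. prob_space Q \<and> sets Q = sets borel \<and> integrable Q (\<lambda>x. norm x powr p)}"

text \<open>
  A real infimum: it is the mathematical one if the expectations are bounded below over all
  stopping times, e.g. if \<open>\<bar>f x t\<bar> \<le> C * (1 + norm x powr p)\<close> and \<open>Q\<close> is in
  \<open>wass_space p\<close>. A bound on the gradient of \<open>f\<close> of order \<open>p - 1\<close> implies the former.
\<close>

definition stop_value ::
  "('n::{finite, linorder} path \<Rightarrow> 'n \<Rightarrow> real) \<Rightarrow> 'n path measure \<Rightarrow> real" where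
  "stop_value f Q = (INF \<tau>\<in>ST. LINT x|Q. f x (\<tau> x))"

definition couplings ::
  "'n::finite path measure \<Rightarrow> 'n path measure \<Rightarrow> ('n path \<times> 'n path) measure set" where
  "couplings P Q =
     {\<pi>. prob_space \<pi> \<and> sets \<pi> = sets borel \<and> distr \<pi> borel fst = P \<and> distr \<pi> borel snd = Q}"

text \<open>
  \<open>\<real>\<^sup>t\<close> is the product space over the indices \<open>\<le> t\<close>. Conditional probabilities are
  conditional expectations of indicators and thus determined up to null sets for each event
  separately, hence the almost-sure quantifier stands inside the quantifier over \<open>A\<close>.
\<close>

definition causal ::
  "'a measure \<Rightarrow> ('a \<Rightarrow> 'n::{finite, linorder} path) \<Rightarrow> ('a \<Rightarrow> 'n path) \<Rightarrow> bool" where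
  "causal \<pi> X Y \<longleftrightarrow>
     (\<forall>t. \<forall>A \<in> sets (PiM {..t} (\<lambda>_. borel :: real measure)).
        let E = {\<omega>. (\<lambda>s\<in>{..t}. Y \<omega> $ s) \<in> A} in
        AE \<omega> in \<pi>. real_cond_exp \<pi> (gen_by X UNIV) (indicator E) \<omega>
                  = real_cond_exp \<pi> (gen_by X {..t}) (indicator E) \<omega>)"

definition bicausal_couplings ::
  "'n::{finite, linorder} path measure \<Rightarrow> 'n path measure
    \<Rightarrow> ('n path \<times> 'n path) measure set" where
  "bicausal_couplings P Q = {\<pi> \<in> couplings P Q. causal \<pi> fst snd \<and> causal \<pi> snd fst}"

text \<open>
  For \<open>P\<close>, \<open>Q\<close> in \<open>wass_space p\<close> and \<open>1 \<le> p\<close>, the integrals below are finite for every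
  coupling, and the product measure is a bicausal coupling, so the real infimum is over a nonempty
  set that is bounded below.
\<close>

definition adapted_wass ::
  "real \<Rightarrow> 'n::{finite, linorder} path measure \<Rightarrow> 'n path measure \<Rightarrow> real" where
  "adapted_wass p P Q =
     (INF \<pi>\<in>bicausal_couplings P Q.
        (\<Sum>t\<in>UNIV. LINT \<omega>|\<pi>. \<bar>fst \<omega> $ t - snd \<omega> $ t\<bar> powr p) powr (1 / p))"

definition aw_ball ::
  "real \<Rightarrow> real \<Rightarrow> 'n::{finite, linorder} path measure \<Rightarrow> 'n path measure set" where
  "aw_ball p r P = {Q \<in> wass_space p. adapted_wass p P Q \<le> r}"

definition partial_deriv :: "'n::finite \<Rightarrow> ('n path \<Rightarrow> real) \<Rightarrow> 'n path \<Rightarrow> real" where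
  "partial_deriv t g x = deriv (\<lambda>y. g (\<chi> s. if s = t then y else x $ s)) (x $ t)"

definition C1_fun :: "('n::finite path \<Rightarrow> real) \<Rightarrow> bool" where
  "C1_fun g \<longleftrightarrow>
     (\<exists>g' :: 'n path \<Rightarrow> ('n path \<Rightarrow>\<^sub>L real).
        (\<forall>x. (g has_derivative blinfun_apply (g' x)) (at x)) \<and> continuous_on UNIV g')"

end

theory Submission
  imports Defs
begin

text \<open>
  Write \<open>X\<close> for the canonical process under \<open>P\<close>, \<open>\<tau>\<close> for the optimal stopping time,
  \<open>g\<^sub>t = \<partial>\<^sub>t f(X, \<tau>)\<close>, \<open>G\<^sub>t = E[g\<^sub>t | F\<^sub>t]\<close>, and \<open>L\<close> for the coefficient of \<open>r\<close>.

  Upper bound. Let \<open>\<pi>\<close> be a bicausal coupling of \<open>P\<close> and \<open>Q\<close> whose cost is close to \<open>r\<close>. By causality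
  from \<open>Y\<close> to \<open>X\<close>, stopping \<open>Y\<close> at the time \<open>\<tau>(X)\<close> is a randomised stopping time for \<open>Y\<close>, that is, a
  mixture of ordinary ones, so \<open>s(Q) \<le> E f(Y, \<tau>(X))\<close> (lemma \<open>randomized_stopping\<close>). Expand
  \<open>f\<close> to first order at \<open>X\<close>. In the linear term \<open>\<Sum>\<^sub>t E[g\<^sub>t (Y\<^sub>t - X\<^sub>t)]\<close>, causality from \<open>X\<close> to \<open>Y\<close>
  replaces \<open>g\<^sub>t\<close> by \<open>G\<^sub>t\<close> (lemma \<open>causal_integral\<close>), and Hoelder's inequality bounds it by \<open>L\<close> times
  the cost. The remainder is \<open>o(r)\<close> uniformly over all couplings (lemma \<open>rem_integral\<close>): for
  bounded \<open>X\<close> the gradient is uniformly continuous, and large \<open>X\<close> contribute little because \<open>P\<close> has a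
  finite \<open>p\<close>-th moment.

  Lower bound. There are bounded Lipschitz functions \<open>Z\<^sub>t\<close> of the coordinates up to \<open>t\<close> with
  \<open>\<Sum>\<^sub>t E|Z\<^sub>t|\<^sup>p \<le> 1\<close> and \<open>\<Sum>\<^sub>t E[G\<^sub>t Z\<^sub>t]\<close> as close to \<open>L\<close> as desired (lemma \<open>direction_lipschitz\<close>). For
  small \<open>r\<close> the map \<open>\<Phi> = id + r Z\<close> is a bijection with an adapted inverse, so \<open>(X, \<Phi>(X))\<close> is a bicausal
  coupling of cost at most \<open>r\<close> (lemma \<open>flow_bicausal\<close>), and every stopping time applied to \<open>\<Phi>(X)\<close> is a
  stopping time \<open>\<sigma>\<close> applied to \<open>X\<close>. With \<open>Q\<close> the law of \<open>\<Phi>(X)\<close>, the value \<open>s(Q)\<close> is therefore bounded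
  below by the infimum over \<open>\<sigma>\<close> of \<open>E f(X, \<sigma>) + r \<Sum>\<^sub>t E[\<partial>\<^sub>t f(X, \<sigma>) Z\<^sub>t] + o(r)\<close>. If \<open>\<sigma>\<close> is far from
  optimal, the first term alone is too large; if \<open>\<sigma>\<close> is nearly optimal, it agrees with \<open>\<tau>\<close> outside
  a small event (lemma \<open>near_optimal\<close>) and the second term is close to \<open>r \<Sum>\<^sub>t E[G\<^sub>t Z\<^sub>t]\<close>.

  Uniqueness of \<open>\<tau>\<close> enters only in \<open>near_optimal\<close>. The expected cost is a modular function on the
  lattice of stopping times, so the excess over the optimal value is subadditive under maximum and
  minimum. For a sequence with summable excess the superior and the inferior limit are then optimal,
  hence both equal to \<open>\<tau>\<close>, and the sequence is eventually equal to \<open>\<tau>\<close> almost surely.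
\<close>

section \<open>Generated algebras, causality and conditional expectation\<close>

text \<open>Projection onto the coordinates in \<open>S\<close>. The other coordinates are set to \<open>0\<close>, so that all
  projections act on one path space.\<close>
definition keep :: "'n set \<Rightarrow> 'n::finite path \<Rightarrow> 'n path" where
  "keep S x = (\<chi> s. if s \<in> S then x $ s else 0)"

lemma keep_nth [simp]: "keep S x $ s = (if s \<in> S then x $ s else 0)"
  by (simp add: keep_def)

lemma keep_UNIV [simp]: "keep UNIV x = x"
  by (simp add: vec_eq_iff)

lemma keep_norm_mono: "S \<subseteq> S' \<Longrightarrow> norm (keep S x - keep S y) \<le> norm (keep S' x - keep S' y)"
  by (rule norm_le_componentwise_cart) auto

lemma borel_measurable_vec_iff:
  fixes h :: "'a \<Rightarrow> 'n::finite path"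
  shows "h \<in> borel_measurable M \<longleftrightarrow> (\<forall>s. (\<lambda>x. h x $ s) \<in> borel_measurable M)"
  by (subst borel_measurable_euclidean_space) (auto simp: Basis_vec_def inner_axis)

lemma borel_measurable_nth [measurable]: "(\<lambda>x::'n::finite path. x $ s) \<in> borel_measurable borel"
  using borel_measurable_vec_iff[of "\<lambda>x. x" borel] by simp

lemma borel_measurable_nth' [measurable (raw)]:
  fixes h :: "'a \<Rightarrow> 'n::finite path"
  shows "h \<in> borel_measurable M \<Longrightarrow> (\<lambda>x. h x $ s) \<in> borel_measurable M"
  using borel_measurable_vec_iff[of h M] by simp

lemma borel_measurable_keep [measurable]: "keep S \<in> borel_measurable borel"
  by (subst borel_measurable_vec_iff) auto

lemma measurable_fst_snd:
  fixes \<pi> :: "('a::second_countable_topology \<times> 'b::second_countable_topology) measure"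
  assumes "sets \<pi> = sets borel"
  shows "fst \<in> borel_measurable \<pi>" "snd \<in> borel_measurable \<pi>"
  unfolding measurable_cong_sets[OF assms refl] by (auto intro!: borel_measurable_continuous_onI continuous_intros)

lemma space_gen_by [simp]: "space (gen_by Z S) = UNIV"
  by (simp add: gen_by_def)

text \<open>The universal property of the \<open>\<sigma>\<close>-algebra generated by coordinates of \<open>Z\<close>.\<close>
lemma measurable_into_gen_by:
  assumes "\<And>s. s \<in> S \<Longrightarrow> (\<lambda>x. Z (h x) $ s) \<in> borel_measurable N"
  shows "h \<in> N \<rightarrow>\<^sub>M gen_by Z S"
  unfolding gen_by_def
proof (rule measurable_measure_of)
  fix B assume "B \<in> {(\<lambda>\<omega>. Z \<omega> $ s) -` A |s A. s \<in> S \<and> A \<in> sets (borel :: real measure)}"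
  then obtain s A where "B = (\<lambda>\<omega>. Z \<omega> $ s) -` A" "s \<in> S" "A \<in> sets (borel :: real measure)" by auto
  then show "h -` B \<inter> space N \<in> sets N"
    using measurable_sets[OF assms[of s], of A] by (auto simp: vimage_def)
qed auto

lemma measurable_gen_by_nth: "s \<in> S \<Longrightarrow> (\<lambda>\<omega>. Z \<omega> $ s) \<in> borel_measurable (gen_by Z S)"
  unfolding measurable_def gen_by_def by (auto intro!: sigma_sets.Basic)

lemma measurable_gen_by_keep: "(\<lambda>\<omega>. keep S (Z \<omega>)) \<in> borel_measurable (gen_by Z S)"
proof -
  have "(\<lambda>\<omega>. keep S (Z \<omega>) $ s) \<in> borel_measurable (gen_by Z S)" for s
    by (cases "s \<in> S") (auto simp: measurable_gen_by_nth)
  then show ?thesis by (subst borel_measurable_vec_iff) auto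
qed

lemma measurable_gen_by_UNIV: "Z \<in> borel_measurable (gen_by Z UNIV)"
  by (subst borel_measurable_vec_iff) (auto simp: measurable_gen_by_nth)

text \<open>The algebra generated by the coordinates in \<open>S\<close> is the pullback of the Borel sets of the
  path space along the projection. Most facts below use this form.\<close>
lemma sets_gen_by_eq: "sets (gen_by Z S) = {(\<lambda>\<omega>. keep S (Z \<omega>)) -` B | B. B \<in> sets borel}"
proof -
  have "(\<lambda>\<omega>. \<omega>) \<in> vimage_algebra UNIV (\<lambda>\<omega>. keep S (Z \<omega>)) borel \<rightarrow>\<^sub>M gen_by Z S"
  proof (rule measurable_into_gen_by)
    fix s assume "s \<in> S"
    have "(\<lambda>\<omega>. keep S (Z \<omega>) $ s) \<in> borel_measurable (vimage_algebra UNIV (\<lambda>\<omega>. keep S (Z \<omega>)) borel)"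
      by (intro borel_measurable_nth' measurable_vimage_algebra1) auto
    then show "(\<lambda>x. Z x $ s) \<in> borel_measurable (vimage_algebra UNIV (\<lambda>\<omega>. keep S (Z \<omega>)) borel)"
      using \<open>s \<in> S\<close> by simp
  qed
  from measurable_sets[OF this] have 1: "sets (gen_by Z S) \<subseteq> sets (vimage_algebra UNIV (\<lambda>\<omega>. keep S (Z \<omega>)) borel)"
    by auto
  have "sets (vimage_algebra UNIV (\<lambda>\<omega>. keep S (Z \<omega>)) borel) \<subseteq> sets (gen_by Z S)"
    using measurable_sets[OF measurable_gen_by_keep[of S Z]] by (auto simp: sets_vimage_algebra2)
  with 1 show ?thesis by (auto simp: sets_vimage_algebra2)
qed

lemma integrable_select:
  fixes F :: "'a \<Rightarrow> 'n::finite \<Rightarrow> real"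
  assumes F: "\<And>t. integrable M (\<lambda>x. F x t)" and \<tau>: "\<tau> \<in> M \<rightarrow>\<^sub>M count_space UNIV"
  shows "integrable M (\<lambda>x. F x (\<tau> x))"
proof (rule Bochner_Integration.integrable_bound)
  show "integrable M (\<lambda>x. \<Sum>t\<in>UNIV. \<bar>F x t\<bar>)" using F by auto
  show "(\<lambda>x. F x (\<tau> x)) \<in> borel_measurable M"
    by (rule measurable_compose_countable'[OF _ \<tau>]) (use F in \<open>auto simp: countable_finite\<close>)
  show "AE x in M. norm (F x (\<tau> x)) \<le> norm (\<Sum>t\<in>UNIV. \<bar>F x t\<bar>)"
  proof (rule AE_I2)
    fix x
    have "\<bar>F x (\<tau> x)\<bar> \<le> (\<Sum>t\<in>UNIV. \<bar>F x t\<bar>)" by (rule member_le_sum) auto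
    then show "norm (F x (\<tau> x)) \<le> norm (\<Sum>t\<in>UNIV. \<bar>F x t\<bar>)" by simp
  qed
qed

lemma subalgebra_gen_by:
  assumes "Z \<in> borel_measurable M" "space M = UNIV"
  shows "subalgebra M (gen_by Z S)"
proof -
  have "(\<lambda>\<omega>. \<omega>) \<in> M \<rightarrow>\<^sub>M gen_by Z S" using assms by (intro measurable_into_gen_by) auto
  from measurable_sets[OF this] show ?thesis using assms by (auto simp: subalgebra_def)
qed

lemma gen_by_mono: "S \<subseteq> S' \<Longrightarrow> sets (gen_by Z S) \<subseteq> sets (gen_by Z S')"
  unfolding gen_by_def by (simp, rule sigma_sets_mono') auto

lemma measurable_gen_by_mono:
  "h \<in> gen_by Z S \<rightarrow>\<^sub>M N \<Longrightarrow> S \<subseteq> S' \<Longrightarrow> h \<in> gen_by Z S' \<rightarrow>\<^sub>M N"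
  using gen_by_mono[of S S' Z] unfolding measurable_def by auto

text \<open>Functions measurable for the generated algebra depend on the generating coordinates only.\<close>
lemma gen_by_determined:
  fixes h :: "'a \<Rightarrow> real"
  assumes h: "h \<in> borel_measurable (gen_by Z S)" and eq: "\<And>s. s \<in> S \<Longrightarrow> Z \<omega> $ s = Z \<omega>' $ s"
  shows "h \<omega> = h \<omega>'"
proof -
  have "h -` {h \<omega>} \<in> sets (gen_by Z S)" using measurable_sets[OF h, of "{h \<omega>}"] by simp
  then obtain B where "h -` {h \<omega>} = (\<lambda>\<omega>. keep S (Z \<omega>)) -` B" unfolding sets_gen_by_eq by auto
  moreover have "keep S (Z \<omega>) = keep S (Z \<omega>')" using eq by (auto simp: vec_eq_iff)
  ultimately show ?thesis by (metis (mono_tags) singletonD vimage_eq singletonI)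
qed

lemma measurable_gen_by_compose:
  assumes "h \<in> gen_by (\<lambda>x. x) S \<rightarrow>\<^sub>M N"
  shows "(\<lambda>\<omega>. h (Z \<omega>)) \<in> gen_by Z S \<rightarrow>\<^sub>M N"
  by (rule measurable_compose[OF measurable_into_gen_by assms]) (rule measurable_gen_by_nth)

text \<open>The events in the definition of causality are exactly the events of the algebra generated by
  the coordinates up to \<open>t\<close>.\<close>
lemma sets_gen_by_restrict:
  fixes Z :: "'a \<Rightarrow> 'n::{finite,linorder} path"
  shows "sets (gen_by Z {..t}) =
    {{\<omega>. (\<lambda>s\<in>{..t}. Z \<omega> $ s) \<in> A} | A. A \<in> sets (PiM {..t} (\<lambda>_. borel :: real measure))}"
proof safe
  fix E assume "E \<in> sets (gen_by Z {..t})"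
  then obtain B where E: "E = (\<lambda>\<omega>. keep {..t} (Z \<omega>)) -` B" and B [measurable]: "B \<in> sets borel"
    unfolding sets_gen_by_eq by auto
  let ?h = "\<lambda>z. (\<chi> s. if s \<in> {..t} then z s else 0) :: 'n path"
  have [measurable]: "?h \<in> borel_measurable (PiM {..t} (\<lambda>_. borel :: real measure))"
  proof -
    have "(\<lambda>z. ?h z $ s) \<in> borel_measurable (PiM {..t} (\<lambda>_. borel :: real measure))" for s
      by (cases "s \<in> {..t}") auto
    then show ?thesis by (subst borel_measurable_vec_iff) auto
  qed
  let ?A = "?h -` B \<inter> space (PiM {..t} (\<lambda>_. borel :: real measure))"
  have "?A \<in> sets (PiM {..t} (\<lambda>_. borel :: real measure))" by measurable
  moreover have "?h (\<lambda>s\<in>{..t}. x $ s) = keep {..t} x" for x :: "'n path"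
    by (auto simp: vec_eq_iff)
  then have "E = {\<omega>. (\<lambda>s\<in>{..t}. Z \<omega> $ s) \<in> ?A}"
    unfolding E by (auto simp: space_PiM)
  ultimately show "\<exists>A. E = {\<omega>. (\<lambda>s\<in>{..t}. Z \<omega> $ s) \<in> A} \<and> A \<in> sets (PiM {..t} (\<lambda>_. borel :: real measure))"
    by blast
next
  fix A assume A: "A \<in> sets (PiM {..t} (\<lambda>_. borel :: real measure))"
  have "(\<lambda>\<omega>. \<lambda>s\<in>{..t}. Z \<omega> $ s) \<in> gen_by Z {..t} \<rightarrow>\<^sub>M PiM {..t} (\<lambda>_. borel :: real measure)"
    by (intro measurable_restrict) (auto simp: measurable_gen_by_nth)
  from measurable_sets[OF this A] show "{\<omega>. (\<lambda>s\<in>{..t}. Z \<omega> $ s) \<in> A} \<in> sets (gen_by Z {..t})"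
    by (auto simp: vimage_def)
qed

lemma causal_iff:
  "causal \<pi> X Y \<longleftrightarrow> (\<forall>t. \<forall>E \<in> sets (gen_by Y {..t}).
      AE \<omega> in \<pi>. real_cond_exp \<pi> (gen_by X UNIV) (indicator E) \<omega>
                = real_cond_exp \<pi> (gen_by X {..t}) (indicator E) \<omega>)"
  unfolding causal_def sets_gen_by_restrict Let_def by blast

lemma space_canon_filt [simp]: "space (canon_filt t) = UNIV" by (simp add: canon_filt_def)

lemma canon_filt_mono: "s \<le> t \<Longrightarrow> sets (canon_filt s) \<subseteq> sets (canon_filt t)"
  unfolding canon_filt_def by (rule gen_by_mono) auto

lemma sigma_finite_gen_by:
  assumes "prob_space M" "Z \<in> borel_measurable M" "space M = UNIV"
  shows "sigma_finite_subalgebra M (gen_by Z S)"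
proof -
  interpret prob_space M by fact
  show ?thesis
    by (rule finite_measure_subalgebra_is_sigma_finite)
      (unfold_locales, rule subalgebra_gen_by, fact, fact)
qed

text \<open>
  For causality it suffices to find, for each event \<open>E\<close> of the past of \<open>Y\<close>, a function of the
  past of \<open>X\<close> that is a version of the conditional probability of \<open>E\<close> given all of \<open>X\<close>.
\<close>
lemma causalI:
  assumes M: "prob_space \<pi>" "space \<pi> = UNIV" and X: "X \<in> borel_measurable \<pi>" and Y: "Y \<in> borel_measurable \<pi>"
    and h: "\<And>t E. E \<in> sets (gen_by Y {..t}) \<Longrightarrow> \<exists>h \<in> borel_measurable (gen_by X {..t}). integrable \<pi> h \<and>
       (\<forall>B \<in> sets (gen_by X UNIV). (LINT \<omega>:B|\<pi>. indicator E \<omega>) = (LINT \<omega>:B|\<pi>. (h \<omega> :: real)))"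
  shows "causal \<pi> X Y"
  unfolding causal_iff
proof safe
  fix t E assume E: "E \<in> sets (gen_by Y {..t})"
  interpret prob_space \<pi> by fact
  interpret U: sigma_finite_subalgebra \<pi> "gen_by X UNIV" by (rule sigma_finite_gen_by; fact)
  interpret T: sigma_finite_subalgebra \<pi> "gen_by X {..t}" by (rule sigma_finite_gen_by; fact)
  have [measurable]: "E \<in> sets \<pi>" using E subalgebra_gen_by[OF Y M(2)] by (auto simp: subalgebra_def)
  from h[OF E] obtain h where h: "h \<in> borel_measurable (gen_by X {..t})" "integrable \<pi> h"
    "\<And>B. B \<in> sets (gen_by X UNIV) \<Longrightarrow> (LINT \<omega>:B|\<pi>. indicator E \<omega>) = (LINT \<omega>:B|\<pi>. (h \<omega> :: real))" by blast
  have ie: "integrable \<pi> (indicator E :: _ \<Rightarrow> real)" by (intro integrable_real_indicator) (auto simp: less_top[symmetric])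
  have "AE \<omega> in \<pi>. real_cond_exp \<pi> (gen_by X UNIV) (indicator E) \<omega> = h \<omega>"
    using h(3) ie h(2) measurable_gen_by_mono[OF h(1), of UNIV] by (intro U.real_cond_exp_charact) auto
  moreover have "AE \<omega> in \<pi>. real_cond_exp \<pi> (gen_by X {..t}) (indicator E) \<omega> = h \<omega>"
    using h(3) ie h(2) h(1) gen_by_mono[of "{..t}" UNIV X] by (intro T.real_cond_exp_charact) auto
  ultimately show "AE \<omega> in \<pi>. real_cond_exp \<pi> (gen_by X UNIV) (indicator E) \<omega>
                = real_cond_exp \<pi> (gen_by X {..t}) (indicator E) \<omega>" by eventually_elim simp
qed

text \<open>
  Causality in integrated form: for \<open>w\<close> depending on \<open>Y\<close> up to time \<open>t\<close>, a function \<open>u\<close> of \<open>X\<close> can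
  be replaced by its conditional expectation given \<open>X\<close> up to time \<open>t\<close>. The proof moves the
  conditional expectation back and forth for indicators \<open>w\<close>, and concludes that the difference of
  \<open>u\<close> and its conditional expectation has conditional mean zero given \<open>Y\<close> up to time \<open>t\<close>.
\<close>
lemma causal_integral:
  assumes M: "prob_space \<pi>" "space \<pi> = UNIV" and X: "X \<in> borel_measurable \<pi>" and Y: "Y \<in> borel_measurable \<pi>"
    and c: "causal \<pi> X Y"
    and u: "u \<in> borel_measurable (gen_by X UNIV)" "integrable \<pi> u"
    and w: "w \<in> borel_measurable (gen_by Y {..t})"
    and int1: "integrable \<pi> (\<lambda>\<omega>. w \<omega> * u \<omega>)"
    and int2: "integrable \<pi> (\<lambda>\<omega>. w \<omega> * real_cond_exp \<pi> (gen_by X {..t}) u \<omega>)"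
  shows "(LINT \<omega>|\<pi>. w \<omega> * u \<omega>) = (LINT \<omega>|\<pi>. w \<omega> * real_cond_exp \<pi> (gen_by X {..t}) u \<omega>)"
proof -
  interpret prob_space \<pi> by fact
  interpret U: sigma_finite_subalgebra \<pi> "gen_by X UNIV" by (rule sigma_finite_gen_by; fact)
  interpret T: sigma_finite_subalgebra \<pi> "gen_by X {..t}" by (rule sigma_finite_gen_by; fact)
  interpret V: sigma_finite_subalgebra \<pi> "gen_by Y {..t}" by (rule sigma_finite_gen_by; fact)
  let ?ut = "real_cond_exp \<pi> (gen_by X {..t}) u"
  have iut: "integrable \<pi> ?ut" using u by auto
  have um[measurable]: "u \<in> borel_measurable \<pi>" using u by auto
  have key: "(LINT \<omega>|\<pi>. u \<omega> * indicator E \<omega>) = (LINT \<omega>|\<pi>. ?ut \<omega> * indicator E \<omega>)"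
    if E: "E \<in> sets (gen_by Y {..t})" for E
  proof -
    have Em[measurable]: "E \<in> sets \<pi>" using E V.subalg by (auto simp: subalgebra_def)
    let ?eU = "real_cond_exp \<pi> (gen_by X UNIV) (indicator E)"
    let ?eT = "real_cond_exp \<pi> (gen_by X {..t}) (indicator E)"
    have ie: "integrable \<pi> (indicator E :: _ \<Rightarrow> real)" by (intro integrable_real_indicator) (auto simp: less_top[symmetric])
    have iue: "integrable \<pi> (\<lambda>\<omega>. u \<omega> * indicator E \<omega>)"
      using integrable_mult_indicator[OF Em u(2)] by (simp add: mult.commute)
    have iute: "integrable \<pi> (\<lambda>\<omega>. ?ut \<omega> * indicator E \<omega>)"
      using integrable_mult_indicator[OF Em iut] by (simp add: mult.commute)
    have eq: "AE \<omega> in \<pi>. ?eU \<omega> = ?eT \<omega>" using c E unfolding causal_iff by auto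
    have "(LINT \<omega>|\<pi>. u \<omega> * indicator E \<omega>) = (LINT \<omega>|\<pi>. u \<omega> * ?eU \<omega>)"
      by (rule U.real_cond_exp_intg(2)[symmetric]) (use iue u in auto)
    also have "\<dots> = (LINT \<omega>|\<pi>. ?eT \<omega> * u \<omega>)"
      by (rule integral_cong_AE) (use eq in auto)
    also have "\<dots> = (LINT \<omega>|\<pi>. ?eT \<omega> * ?ut \<omega>)"
    proof (rule T.real_cond_exp_intg(2)[symmetric])
      have "integrable \<pi> (\<lambda>\<omega>. u \<omega> * ?eU \<omega>)"
        by (rule U.real_cond_exp_intg(1)) (use iue u in auto)
      then show "integrable \<pi> (\<lambda>x. ?eT x * u x)"
        by (rule integrable_cong_AE_imp) (use eq in auto)
    qed auto
    also have "\<dots> = (LINT \<omega>|\<pi>. ?ut \<omega> * ?eT \<omega>)" by (simp add: mult.commute)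
    also have "\<dots> = (LINT \<omega>|\<pi>. ?ut \<omega> * indicator E \<omega>)"
      by (rule T.real_cond_exp_intg(2)) (use iute in auto)
    finally show ?thesis .
  qed
  have z: "AE \<omega> in \<pi>. real_cond_exp \<pi> (gen_by Y {..t}) (\<lambda>\<omega>. u \<omega> - ?ut \<omega>) \<omega> = 0"
  proof (rule V.real_cond_exp_charact)
    fix E assume E: "E \<in> sets (gen_by Y {..t})"
    have Em[measurable]: "E \<in> sets \<pi>" using E V.subalg by (auto simp: subalgebra_def)
    have iue: "integrable \<pi> (\<lambda>\<omega>. u \<omega> * indicator E \<omega>)"
      using integrable_mult_indicator[OF Em u(2)] by (simp add: mult.commute)
    have iute: "integrable \<pi> (\<lambda>\<omega>. ?ut \<omega> * indicator E \<omega>)"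
      using integrable_mult_indicator[OF Em iut] by (simp add: mult.commute)
    have "(LINT \<omega>|\<pi>. u \<omega> * indicator E \<omega> - ?ut \<omega> * indicator E \<omega>) = 0"
      using key[OF E] iue iute by simp
    then show "(LINT x:E|\<pi>. u x - ?ut x) = (LINT x:E|\<pi>. 0)"
      by (simp add: set_lebesgue_integral_def algebra_simps)
  qed (use u iut in auto)
  have "(LINT \<omega>|\<pi>. w \<omega> * (u \<omega> - ?ut \<omega>)) = (LINT \<omega>|\<pi>. w \<omega> * real_cond_exp \<pi> (gen_by Y {..t}) (\<lambda>\<omega>. u \<omega> - ?ut \<omega>) \<omega>)"
    by (rule V.real_cond_exp_intg(2)[symmetric])
      (use int1 int2 w in \<open>auto simp: algebra_simps\<close>)
  also have "\<dots> = (LINT \<omega>|\<pi>. 0)"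
    by (rule integral_cong_AE) (use z w measurable_from_subalg[OF V.subalg w] in auto)
  finally show ?thesis using int1 int2 by (simp add: algebra_simps)
qed

text \<open>
  Conditioning a function of \<open>X\<close> on coordinates of \<open>X\<close> can be done on the law of \<open>X\<close>.
\<close>
lemma real_cond_exp_transfer:
  assumes M: "prob_space \<pi>" "space \<pi> = UNIV" and X[measurable]: "X \<in> borel_measurable \<pi>"
    and P: "P = distr \<pi> borel X" and g: "integrable P g"
  shows "AE \<omega> in \<pi>. real_cond_exp \<pi> (gen_by X S) (\<lambda>\<omega>. g (X \<omega>)) \<omega> = real_cond_exp P (gen_by (\<lambda>x. x) S) g (X \<omega>)"
proof -
  interpret prob_space \<pi> by fact
  interpret S: sigma_finite_subalgebra \<pi> "gen_by X S" by (rule sigma_finite_gen_by; fact)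
  have PP: "prob_space P" unfolding P by (rule prob_space_distr) simp
  have sP: "sets P = sets borel" "space P = UNIV" by (simp_all add: P)
  have idm: "(\<lambda>x. x) \<in> borel_measurable P" by (simp add: measurable_cong_sets[OF sP(1) refl])
  interpret C: sigma_finite_subalgebra P "gen_by (\<lambda>x. x) S" by (rule sigma_finite_gen_by[OF PP idm sP(2)])
  have gm[measurable]: "g \<in> borel_measurable borel" using g sP by (simp add: integrable_iff_bounded cong: measurable_cong_sets)
  let ?c = "real_cond_exp P (gen_by (\<lambda>x. x) S) g"
  have cm0: "?c \<in> borel_measurable (gen_by (\<lambda>x. x) S)" by simp
  have cm[measurable]: "?c \<in> borel_measurable borel"
    using measurable_from_subalg[OF C.subalg cm0] measurable_cong_sets[OF sP(1) refl] by blast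
  have ci: "integrable P ?c" using g by auto
  show ?thesis
  proof (rule S.real_cond_exp_charact)
    show "integrable \<pi> (\<lambda>\<omega>. g (X \<omega>))" using g integrable_distr_eq[OF X gm] by (simp add: P)
    show "integrable \<pi> (\<lambda>\<omega>. ?c (X \<omega>))" using ci integrable_distr_eq[OF X cm] by (simp add: P)
    show "(\<lambda>\<omega>. ?c (X \<omega>)) \<in> borel_measurable (gen_by X S)" by (rule measurable_gen_by_compose[OF cm0])
    fix A assume "A \<in> sets (gen_by X S)"
    then obtain B where A: "A = (\<lambda>\<omega>. keep S (X \<omega>)) -` B" and B[measurable]: "B \<in> sets borel"
      unfolding sets_gen_by_eq by auto
    have Cs: "keep S -` B \<in> sets (gen_by (\<lambda>x. x) S)" unfolding sets_gen_by_eq using B by auto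
    have Cb[measurable]: "keep S -` B \<in> sets borel" using measurable_sets[OF borel_measurable_keep B] by simp
    have *: "(LINT \<omega>:A|\<pi>. k (X \<omega>)) = (LINT x:keep S -` B|P. k x)" if [measurable]: "k \<in> borel_measurable borel" for k :: "_ \<Rightarrow> real"
      unfolding set_lebesgue_integral_def P by (subst integral_distr) (auto simp: A indicator_def intro!: Bochner_Integration.integral_cong)
    show "(LINT \<omega>:A|\<pi>. g (X \<omega>)) = (LINT \<omega>:A|\<pi>. ?c (X \<omega>))"
      using C.real_cond_exp_intA[OF g Cs] by (simp add: *)
  qed
qed

section \<open>Hoelder inequality and first-order expansion of the cost function\<close>

lemma conj_exponent:
  fixes p q :: real
  assumes "1 < p" "q = p / (p - 1)"
  shows "1 < q" "1 / q + 1 / p = 1" "(p - 1) * q = p" "q > 0" "(q - 1) * p = q"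
proof -
  show q1: "1 < q" unfolding assms(2) using assms(1) by (subst less_divide_eq) auto
  then show "q > 0" by simp
  show "(p - 1) * q = p" "1 / q + 1 / p = 1" "(q - 1) * p = q"
    using assms q1 by (simp_all add: field_simps)
qed

text \<open>Hoelder's inequality for finite families, with strictly positive upper bounds \<open>A\<close> and \<open>B\<close>
  in place of the norms. Normalising by \<open>A\<close> and \<open>B\<close> reduces it to Young's inequality without a case
  distinction for vanishing norms.\<close>
lemma Holder_sum:
  fixes G D :: "'n::finite \<Rightarrow> 'a \<Rightarrow> real"
  assumes p: "1 < p" "q = p / (p - 1)"
    and [measurable]: "\<And>s. G s \<in> borel_measurable M" "\<And>s. D s \<in> borel_measurable M"
    and iG: "\<And>s. integrable M (\<lambda>x. \<bar>G s x\<bar> powr q)" and iD: "\<And>s. integrable M (\<lambda>x. \<bar>D s x\<bar> powr p)"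
    and A: "0 < A" "(\<Sum>s\<in>UNIV. LINT x|M. \<bar>G s x\<bar> powr q) \<le> A powr q"
    and B: "0 < B" "(\<Sum>s\<in>UNIV. LINT x|M. \<bar>D s x\<bar> powr p) \<le> B powr p"
  shows "integrable M (\<lambda>x. G s x * D s x)"
    and "(\<Sum>s\<in>UNIV. LINT x|M. \<bar>G s x * D s x\<bar>) \<le> A * B"
proof -
  note q = conj_exponent[OF p]
  define U where "U s x = A * B * (\<bar>G s x\<bar> powr q / (A powr q * q) + \<bar>D s x\<bar> powr p / (B powr p * p))" for s x
  have le: "\<bar>G s x * D s x\<bar> \<le> U s x" for s x
  proof -
    have "(\<bar>G s x\<bar> / A) * (\<bar>D s x\<bar> / B) \<le> (\<bar>G s x\<bar> / A) powr q / q + (\<bar>D s x\<bar> / B) powr p / p"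
      using A B q p by (intro Youngs_inequality) auto
    then have "A * B * ((\<bar>G s x\<bar> / A) * (\<bar>D s x\<bar> / B)) \<le> U s x"
      unfolding U_def using A B by (intro mult_left_mono) (auto simp: powr_divide)
    then show ?thesis using A B by (simp add: abs_mult)
  qed
  have iU: "integrable M (U s)" for s unfolding U_def using iG iD by auto
  show int: "integrable M (\<lambda>x. G s x * D s x)" for s
    by (rule Bochner_Integration.integrable_bound[OF iU[of s]]) (use le in \<open>auto intro: order_trans[OF _ abs_ge_self]\<close>)
  have "(\<Sum>s\<in>UNIV. LINT x|M. \<bar>G s x * D s x\<bar>) \<le> (\<Sum>s\<in>UNIV. LINT x|M. U s x)"
    using int iU le by (intro sum_mono integral_mono) auto
  also have "\<dots> = (\<Sum>s\<in>UNIV. A * B * ((LINT x|M. \<bar>G s x\<bar> powr q) / (A powr q * q)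
       + (LINT x|M. \<bar>D s x\<bar> powr p) / (B powr p * p)))"
    unfolding U_def using iG iD by simp
  also have "\<dots> = A * B * ((\<Sum>s\<in>UNIV. LINT x|M. \<bar>G s x\<bar> powr q) / (A powr q * q)
       + (\<Sum>s\<in>UNIV. LINT x|M. \<bar>D s x\<bar> powr p) / (B powr p * p))"
    by (simp add: sum_distrib_left[symmetric] sum.distrib sum_divide_distrib[symmetric])
  also have "\<dots> \<le> A * B * (A powr q / (A powr q * q) + B powr p / (B powr p * p))"
    using A B p q by (intro mult_left_mono add_mono divide_right_mono) auto
  also have "\<dots> = A * B * (1 / q + 1 / p)" using A B by simp
  also have "\<dots> = A * B" using q by simp
  finally show "(\<Sum>s\<in>UNIV. LINT x|M. \<bar>G s x * D s x\<bar>) \<le> A * B" .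
qed

text \<open>The total derivative of a continuously differentiable function is given by its partial derivatives.\<close>
lemma C1_fun_partial:
  fixes g :: "'n::finite path \<Rightarrow> real"
  assumes "C1_fun g"
  shows "(g has_derivative (\<lambda>h. \<Sum>s\<in>UNIV. partial_deriv s g x * h $ s)) (at x)"
    and "continuous_on UNIV (partial_deriv s g)"
proof -
  obtain g' :: "'n path \<Rightarrow> ('n path \<Rightarrow>\<^sub>L real)" where
    g': "\<And>x. (g has_derivative blinfun_apply (g' x)) (at x)" and c: "continuous_on UNIV g'"
    using assms unfolding C1_fun_def by blast
  have pd: "partial_deriv s g x = blinfun_apply (g' x) (axis s 1)" for s x
  proof -
    have curve: "(\<chi> i. if i = s then y else x $ i) = x + (y - x $ s) *\<^sub>R axis s 1" for y
      by (auto simp: vec_eq_iff axis_def)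
    have "((\<lambda>y. x + (y - x $ s) *\<^sub>R axis s 1) has_derivative (\<lambda>h. h *\<^sub>R axis s 1)) (at (x $ s))"
      by (auto intro!: derivative_eq_intros)
    from has_derivative_compose[OF this, of g "blinfun_apply (g' x)"] g'[of x]
    have "((\<lambda>y. g (x + (y - x $ s) *\<^sub>R axis s 1)) has_derivative (\<lambda>h. blinfun_apply (g' x) (h *\<^sub>R axis s 1))) (at (x $ s))"
      by simp
    then have "((\<lambda>y. g (x + (y - x $ s) *\<^sub>R axis s 1)) has_field_derivative (blinfun_apply (g' x) (axis s 1))) (at (x $ s))"
      unfolding has_field_derivative_def by (simp add: blinfun.scaleR_right mult.commute mult_commute_abs)
    then show ?thesis unfolding partial_deriv_def curve by (rule DERIV_imp_deriv)
  qed
  have "blinfun_apply (g' x) h = (\<Sum>s\<in>UNIV. partial_deriv s g x * h $ s)" for h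
  proof -
    have "h = (\<Sum>s\<in>UNIV. h $ s *\<^sub>R axis s 1)" by (simp add: vec_eq_iff axis_def if_distrib cong: if_cong)
    then have "blinfun_apply (g' x) h = blinfun_apply (g' x) (\<Sum>s\<in>UNIV. h $ s *\<^sub>R axis s 1)" by simp
    then show ?thesis by (simp add: blinfun.sum_right blinfun.scaleR_right pd mult.commute)
  qed
  then show "(g has_derivative (\<lambda>h. \<Sum>s\<in>UNIV. partial_deriv s g x * h $ s)) (at x)"
    using g'[of x] has_derivative_transform by (metis (no_types, lifting) ext)
  show "continuous_on UNIV (partial_deriv s g)"
    unfolding pd by (intro continuous_intros c)
qed

lemma abs_nth_le_norm: "\<bar>x $ s\<bar> \<le> norm (x :: 'n::finite path)"
  using component_le_norm_cart by auto

lemma norm_powr_le_sum: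
  fixes x :: "'n::finite path"
  assumes "p > 0"
  shows "norm x powr p \<le> real CARD('n) powr p * (\<Sum>s\<in>UNIV. \<bar>x $ s\<bar> powr p)"
proof -
  let ?R = "range (\<lambda>s. \<bar>x $ s\<bar>)"
  have "Max ?R \<in> ?R" by (rule Max_in) auto
  then obtain m where "Max ?R = \<bar>x $ m\<bar>" by (rule rangeE)
  then have m: "\<bar>x $ s\<bar> \<le> \<bar>x $ m\<bar>" for s using Max_ge[of ?R "\<bar>x $ s\<bar>"] by auto
  have "norm x \<le> (\<Sum>s\<in>UNIV. \<bar>x $ s\<bar>)" by (rule norm_le_l1_cart)
  also have "\<dots> \<le> real CARD('n) * \<bar>x $ m\<bar>" using sum_bounded_above[of UNIV "\<lambda>s. \<bar>x $ s\<bar>" "\<bar>x $ m\<bar>"] m by simp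
  finally have "norm x powr p \<le> (real CARD('n) * \<bar>x $ m\<bar>) powr p" using assms by (intro powr_mono2) auto
  also have "\<dots> = real CARD('n) powr p * \<bar>x $ m\<bar> powr p" by (simp add: powr_mult)
  also have "\<dots> \<le> real CARD('n) powr p * (\<Sum>s\<in>UNIV. \<bar>x $ s\<bar> powr p)"
    by (intro mult_left_mono member_le_sum) auto
  finally show ?thesis .
qed

lemma powr_add_le:
  fixes a b r :: real
  assumes "0 \<le> a" "0 \<le> b" "0 \<le> r"
  shows "(a + b) powr r \<le> 2 powr r * (a powr r + b powr r)"
proof -
  have "(a + b) powr r \<le> (2 * max a b) powr r" using assms by (intro powr_mono2) auto
  also have "\<dots> = 2 powr r * (max a b) powr r" using assms by (simp add: powr_mult)
  also have "\<dots> \<le> 2 powr r * (a powr r + b powr r)" by (intro mult_left_mono) (auto simp: max_def)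
  finally show ?thesis .
qed

text \<open>A continuously differentiable cost whose gradient grows at most with order \<open>p - 1\<close>.\<close>
locale integrand =
  fixes p c :: real and f :: "'n::{finite, linorder} path \<Rightarrow> 'n \<Rightarrow> real"
  assumes p: "1 < p"
    and C1: "\<And>t. C1_fun (\<lambda>x. f x t)"
    and c: "c > 0"
    and growth: "\<And>x t. (\<Sum>s\<in>UNIV. \<bar>partial_deriv s (\<lambda>y. f y t) x\<bar>)
                        \<le> c * (1 + (\<Sum>s\<in>UNIV. \<bar>x $ s\<bar> powr (p - 1)))"
begin

text \<open>The partial derivative of \<open>f\<close> in coordinate \<open>s\<close>, at the point \<open>x\<close> and with fixed stopping index \<open>t\<close>.\<close>
definition D :: "'n \<Rightarrow> 'n path \<Rightarrow> 'n \<Rightarrow> real" where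
  "D s x t = partial_deriv s (\<lambda>y. f y t) x"

text \<open>The remainder of the first-order expansion of \<open>f\<close> at \<open>x\<close>, evaluated at \<open>y\<close>.\<close>
definition taylor_rem :: "'n path \<Rightarrow> 'n path \<Rightarrow> 'n \<Rightarrow> real" where
  "taylor_rem x y t = f y t - f x t - (\<Sum>s\<in>UNIV. D s x t * (y $ s - x $ s))"

lemma f_deriv: "((\<lambda>x. f x t) has_derivative (\<lambda>h. \<Sum>s\<in>UNIV. D s x t * h $ s)) (at x)"
  unfolding D_def by (rule C1_fun_partial(1)[OF C1])

lemma cont_D: "continuous_on S (\<lambda>x. D s x t)"
  unfolding D_def using C1_fun_partial(2)[OF C1] continuous_on_subset by blast

lemma cont_f: "continuous_on S (\<lambda>x. f x t)"
  by (intro continuous_at_imp_continuous_on ballI has_derivative_continuous[OF f_deriv])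

lemma meas_f [measurable]: "(\<lambda>x. f x t) \<in> borel_measurable borel"
  by (rule borel_measurable_continuous_onI[OF cont_f])

lemma meas_D [measurable]: "(\<lambda>x. D s x t) \<in> borel_measurable borel"
  by (rule borel_measurable_continuous_onI[OF cont_D])

text \<open>The constant in the gradient bound when it is written in terms of the norm of \<open>x\<close>.\<close>
definition K0 :: real where "K0 = c * (1 + real CARD('n))"

lemma K0_pos: "K0 > 0" using c by (simp add: K0_def add_pos_nonneg)

lemma D_growth: "(\<Sum>s\<in>UNIV. \<bar>D s x t\<bar>) \<le> K0 * (1 + norm x) powr (p - 1)"
proof -
  have 1: "\<bar>x $ s\<bar> powr (p - 1) \<le> (1 + norm x) powr (p - 1)" for s
    using abs_nth_le_norm[of x s] p by (intro powr_mono2) auto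
  have 2: "1 \<le> (1 + norm x) powr (p - 1)" using p by (intro ge_one_powr_ge_zero) auto
  have "(\<Sum>s\<in>UNIV. \<bar>D s x t\<bar>) \<le> c * (1 + (\<Sum>s\<in>UNIV. \<bar>x $ s\<bar> powr (p - 1)))"
    unfolding D_def by (rule growth)
  also have "\<dots> \<le> c * ((1 + norm x) powr (p - 1) + (\<Sum>s\<in>(UNIV::'n set). (1 + norm x) powr (p - 1)))"
    using c 1 2 by (intro mult_left_mono add_mono sum_mono) auto
  finally show ?thesis by (simp add: K0_def algebra_simps)
qed

lemma D_growth1: "\<bar>D s x t\<bar> \<le> K0 * (1 + norm x) powr (p - 1)"
  by (rule order_trans[OF member_le_sum D_growth]) auto

lemma f_mvt: "\<exists>\<xi>. norm (\<xi> - x) \<le> norm (y - x) \<and> f y t - f x t = (\<Sum>s\<in>UNIV. D s \<xi> t * (y $ s - x $ s))"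
proof -
  let ?\<phi> = "\<lambda>\<theta>::real. f (x + \<theta> *\<^sub>R (y - x)) t"
  have "(?\<phi> has_derivative (\<lambda>h. \<Sum>s\<in>UNIV. D s (x + \<theta> *\<^sub>R (y - x)) t * (h *\<^sub>R (y - x)) $ s)) (at \<theta> within {0..1})" for \<theta>
    by (rule has_derivative_compose[OF _ f_deriv]) (auto intro!: derivative_eq_intros)
  from mvt_simple[of 0 1 ?\<phi>, OF _ this]
  obtain \<theta> where "\<theta> \<in> {0<..<1}" and 1: "?\<phi> 1 - ?\<phi> 0 = (\<Sum>s\<in>UNIV. D s (x + \<theta> *\<^sub>R (y - x)) t * ((1 - 0) *\<^sub>R (y - x)) $ s)"
    by auto
  have "norm (x + \<theta> *\<^sub>R (y - x) - x) \<le> norm (y - x)" using \<open>\<theta> \<in> _\<close> by (auto intro: mult_left_le_one_le)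
  then show ?thesis using 1 by (intro exI[of _ "x + \<theta> *\<^sub>R (y - x)"]) auto
qed

lemma f_growth: "\<exists>K>0. \<forall>x t. \<bar>f x t\<bar> \<le> K * (1 + norm x powr p)"
proof -
  let ?F = "\<Sum>t\<in>UNIV. \<bar>f 0 t\<bar>"
  let ?K = "(?F + K0) * (2 powr p)"
  have F0: "0 \<le> ?F" by (simp add: sum_nonneg)
  have "\<bar>f x t\<bar> \<le> ?K * (1 + norm x powr p)" for x t
  proof -
    obtain \<xi> where \<xi>: "norm (\<xi> - 0) \<le> norm (x - 0)" "f x t - f 0 t = (\<Sum>s\<in>UNIV. D s \<xi> t * (x $ s - 0 $ s))"
      using f_mvt[of 0 x t] by blast
    have "\<bar>f x t - f 0 t\<bar> \<le> (\<Sum>s\<in>UNIV. \<bar>D s \<xi> t\<bar> * norm x)"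
      unfolding \<xi> by (rule order_trans[OF sum_abs sum_mono]) (auto simp: abs_mult intro!: mult_left_mono abs_nth_le_norm)
    also have "\<dots> \<le> K0 * (1 + norm \<xi>) powr (p - 1) * norm x"
      unfolding sum_distrib_right[symmetric] by (intro mult_right_mono D_growth) auto
    also have "\<dots> \<le> K0 * (1 + norm x) powr (p - 1) * (1 + norm x)"
      using \<xi>(1) p K0_pos by (intro mult_mono powr_mono2) auto
    also have "\<dots> = K0 * (1 + norm x) powr p"
      using powr_add[of "1 + norm x" "p - 1" 1] by (simp add: add_pos_nonneg)
    finally have 1: "\<bar>f x t - f 0 t\<bar> \<le> K0 * (1 + norm x) powr p" .
    have "\<bar>f 0 t\<bar> \<le> ?F" by (rule member_le_sum) auto
    also have "\<dots> \<le> ?F * (1 + norm x) powr p"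
      using mult_left_mono[OF ge_one_powr_ge_zero[of "1 + norm x" p] F0] p by simp
    finally have "\<bar>f x t\<bar> \<le> (?F + K0) * (1 + norm x) powr p" using 1 by (simp add: algebra_simps)
    also have "\<dots> \<le> (?F + K0) * (2 powr p * (1 powr p + norm x powr p))"
      using F0 K0_pos p by (intro mult_left_mono powr_add_le) auto
    finally show ?thesis by (simp add: algebra_simps)
  qed
  moreover have "?K > 0" using F0 K0_pos by (simp add: add_nonneg_pos)
  ultimately show ?thesis by blast
qed

text \<open>The constant in front of \<open>(1 + \<parallel>x\<parallel>)\<^sup>p\<^sup>-\<^sup>1\<close> when the gradient is bounded by the growth condition
  at \<open>x\<close> and at a point between \<open>x\<close> and \<open>y\<close>.\<close>
definition C0 :: real where "C0 = K0 * (1 + 2 powr (p - 1))"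

lemma rem_le_grad:
  "\<exists>\<xi>. norm (\<xi> - x) \<le> norm (y - x) \<and> \<bar>taylor_rem x y t\<bar> \<le> (\<Sum>s\<in>UNIV. \<bar>D s \<xi> t - D s x t\<bar>) * norm (y - x)"
proof -
  obtain \<xi> where \<xi>: "norm (\<xi> - x) \<le> norm (y - x)" "f y t - f x t = (\<Sum>s\<in>UNIV. D s \<xi> t * (y $ s - x $ s))"
    using f_mvt by blast
  have "taylor_rem x y t = (\<Sum>s\<in>UNIV. (D s \<xi> t - D s x t) * (y - x) $ s)"
    unfolding taylor_rem_def \<xi> by (simp add: sum_subtractf[symmetric] algebra_simps)
  then have "\<bar>taylor_rem x y t\<bar> \<le> (\<Sum>s\<in>UNIV. \<bar>D s \<xi> t - D s x t\<bar> * norm (y - x))"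
    by (simp only:) (rule order_trans[OF sum_abs sum_mono], auto simp only: abs_mult intro!: mult_left_mono abs_nth_le_norm)
  then show ?thesis using \<xi>(1) unfolding sum_distrib_right[symmetric] by blast
qed

text \<open>Uniform continuity of the gradient on bounded sets, where only one of the two points need be in the set.\<close>
lemma unif_D:
  assumes "\<eta> > 0"
  shows "\<exists>\<delta>>0. \<delta> < 1 \<and> (\<forall>x \<xi> t. norm x \<le> N \<longrightarrow> norm (\<xi> - x) < \<delta> \<longrightarrow> (\<Sum>s\<in>UNIV. \<bar>D s \<xi> t - D s x t\<bar>) \<le> \<eta>)"
proof -
  let ?g = "\<lambda>x. \<chi> t. \<chi> s. D s x t"
  let ?n = "real CARD('n)"
  have "continuous_on (cball 0 (N + 1)) ?g" by (intro continuous_on_vec_lambda cont_D)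
  then have "uniformly_continuous_on (cball 0 (N + 1)) ?g" by (intro compact_uniformly_continuous) auto
  moreover have "\<eta> / ?n > 0" using assms by simp
  ultimately obtain d where d: "d > 0" "\<And>x \<xi>. x \<in> cball 0 (N+1) \<Longrightarrow> \<xi> \<in> cball 0 (N+1) \<Longrightarrow> dist \<xi> x < d \<Longrightarrow> dist (?g \<xi>) (?g x) < \<eta> / ?n"
    unfolding uniformly_continuous_on_def by metis
  have "(\<Sum>s\<in>UNIV. \<bar>D s \<xi> t - D s x t\<bar>) \<le> \<eta>" if "norm x \<le> N" "norm (\<xi> - x) < min d (1/2)" for x \<xi> t
  proof -
    have "norm \<xi> \<le> N + 1" using that norm_triangle_ineq[of "\<xi> - x" x] by auto
    then have 1: "norm (?g \<xi> - ?g x) < \<eta> / ?n" using d(2)[of x \<xi>] that by (auto simp: dist_norm)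
    have "\<bar>D s \<xi> t - D s x t\<bar> \<le> \<eta> / ?n" for s
    proof -
      have "\<bar>D s \<xi> t - D s x t\<bar> = \<bar>(?g \<xi> - ?g x) $ t $ s\<bar>" by simp
      also have "\<dots> \<le> norm ((?g \<xi> - ?g x) $ t)" by (rule abs_nth_le_norm)
      also have "\<dots> \<le> norm (?g \<xi> - ?g x)" by (rule Finite_Cartesian_Product.norm_nth_le)
      finally show ?thesis using 1 by simp
    qed
    from sum_bounded_above[of UNIV "\<lambda>s. \<bar>D s \<xi> t - D s x t\<bar>", OF this] show ?thesis by simp
  qed
  then show ?thesis using d(1) by (intro exI[of _ "min d (1/2)"]) auto
qed

text \<open>A pointwise bound for the remainder. For \<open>\<parallel>x\<parallel> \<le> N\<close> and \<open>y\<close> close to \<open>x\<close> it is uniform continuity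
  of the gradient; for \<open>\<parallel>x\<parallel> \<le> N\<close> and \<open>y\<close> at a distance bounded below, the growth condition is
  absorbed in the \<open>p\<close>-th power of the distance; for \<open>\<parallel>x\<parallel> > N\<close> the growth condition leaves, besides a
  multiple of this power, a weight that depends on \<open>x\<close> only.\<close>
lemma rem_bound:
  assumes "\<eta> > 0" "N \<ge> 0"
  shows "\<exists>K\<ge>0. \<forall>x y t. \<bar>taylor_rem x y t\<bar> \<le>
      (\<eta> + (if norm x > N then C0 * (1 + norm x) powr (p - 1) else 0)) * norm (y - x) + K * norm (y - x) powr p"
proof -
  obtain \<delta> where \<delta>: "\<delta> > 0" "\<delta> < 1" "\<And>x \<xi> t. norm x \<le> N \<Longrightarrow> norm (\<xi> - x) < \<delta> \<Longrightarrow> (\<Sum>s\<in>UNIV. \<bar>D s \<xi> t - D s x t\<bar>) \<le> \<eta>"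
    using unif_D[OF assms(1), of N] by metis
  define K1 where "K1 = 2 * K0 * ((1 + N) / \<delta> + 1) powr (p - 1)"
  define K2 where "K2 = K0 * 2 powr (p - 1)"
  have K: "K1 \<ge> 0" "K2 \<ge> 0" using K0_pos by (auto simp: K1_def K2_def)
  have "\<bar>taylor_rem x y t\<bar> \<le> (\<eta> + (if norm x > N then C0 * (1 + norm x) powr (p - 1) else 0)) * norm (y - x) + (K1 + K2) * norm (y - x) powr p" for x y t
  proof -
    obtain \<xi> where \<xi>: "norm (\<xi> - x) \<le> norm (y - x)" "\<bar>taylor_rem x y t\<bar> \<le> (\<Sum>s\<in>UNIV. \<bar>D s \<xi> t - D s x t\<bar>) * norm (y - x)"
      using rem_le_grad by blast
    let ?d = "norm (y - x)" and ?S = "\<Sum>s\<in>UNIV. \<bar>D s \<xi> t - D s x t\<bar>"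
    have pd: "?d powr (p - 1) * ?d = ?d powr p" using powr_add[of ?d "p - 1" 1] by (cases "?d = 0") auto
    have nxi: "norm \<xi> \<le> norm x + ?d" using \<xi>(1) norm_triangle_ineq[of "\<xi> - x" x] by auto
    have "?S \<le> (\<Sum>s\<in>UNIV. \<bar>D s \<xi> t\<bar> + \<bar>D s x t\<bar>)" by (intro sum_mono) auto
    also have "\<dots> \<le> K0 * (1 + norm \<xi>) powr (p - 1) + K0 * (1 + norm x) powr (p - 1)"
      unfolding sum.distrib by (intro add_mono D_growth)
    also have "\<dots> \<le> K0 * (1 + norm x + ?d) powr (p - 1) + K0 * (1 + norm x) powr (p - 1)"
    proof -
      have "(1 + norm \<xi>) powr (p - 1) \<le> (1 + norm x + ?d) powr (p - 1)"
        using nxi p by (intro powr_mono2) auto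
      then show ?thesis using K0_pos by simp
    qed
    finally have gr: "?S \<le> K0 * (1 + norm x + ?d) powr (p - 1) + K0 * (1 + norm x) powr (p - 1)" .
    consider (a) "norm x \<le> N" "?d < \<delta>" | (b) "norm x \<le> N" "?d \<ge> \<delta>" | (c) "norm x > N" by linarith
    then show ?thesis
    proof cases
      case a
      then have "?S \<le> \<eta>" using \<delta>(3)[of x \<xi> t] \<xi>(1) by auto
      then have "\<bar>taylor_rem x y t\<bar> \<le> \<eta> * ?d" using \<xi>(2) by (meson mult_right_mono norm_ge_zero order_trans)
      also have "\<dots> \<le> \<eta> * ?d + (K1 + K2) * ?d powr p" using K by simp
      finally show ?thesis using a by simp
    next
      case b
      have "1 + norm x + ?d \<le> (1 + N) / \<delta> * ?d + ?d"
      proof -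
        have "(1 + N) * \<delta> \<le> (1 + N) * ?d" using b assms by (intro mult_left_mono) auto
        then have "1 + N \<le> (1 + N) / \<delta> * ?d" using \<delta>(1) by (simp add: field_simps)
        then show ?thesis using b by simp
      qed
      then have bb: "1 + norm x + ?d \<le> ((1 + N) / \<delta> + 1) * ?d" by (simp add: algebra_simps)
      have "(1 + norm x + ?d) powr (p - 1) \<le> (((1 + N) / \<delta> + 1) * ?d) powr (p - 1)"
        using bb p by (intro powr_mono2) auto
      moreover have "(1 + norm x) powr (p - 1) \<le> (((1 + N) / \<delta> + 1) * ?d) powr (p - 1)"
        using bb p by (intro powr_mono2) (auto intro: order_trans[rotated])
      ultimately have "K0 * (1 + norm x + ?d) powr (p - 1) + K0 * (1 + norm x) powr (p - 1) \<le>
          K0 * (((1 + N) / \<delta> + 1) * ?d) powr (p - 1) + K0 * (((1 + N) / \<delta> + 1) * ?d) powr (p - 1)"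
        using K0_pos by (intro add_mono mult_left_mono) auto
      also have "\<dots> = K1 * ?d powr (p - 1)" using \<delta> assms by (simp add: K1_def powr_mult)
      finally have "\<bar>taylor_rem x y t\<bar> \<le> K1 * ?d powr (p - 1) * ?d"
        using gr \<xi>(2) by (meson mult_right_mono norm_ge_zero order_trans)
      also have "\<dots> = K1 * ?d powr p" using pd by (simp add: mult.assoc)
      also have "\<dots> \<le> \<eta> * ?d + (K1 + K2) * ?d powr p" using K assms by (simp add: algebra_simps)
      finally show ?thesis using b by simp
    next
      case c
      have "K0 * (1 + norm x + ?d) powr (p - 1) \<le> K0 * (2 powr (p - 1) * ((1 + norm x) powr (p - 1) + ?d powr (p - 1)))"
        using K0_pos p by (intro mult_left_mono powr_add_le) auto
      then have "?S \<le> C0 * (1 + norm x) powr (p - 1) + K2 * ?d powr (p - 1)"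
        using gr by (simp add: C0_def K2_def algebra_simps)
      then have "\<bar>taylor_rem x y t\<bar> \<le> (C0 * (1 + norm x) powr (p - 1) + K2 * ?d powr (p - 1)) * ?d"
        using \<xi>(2) by (meson mult_right_mono norm_ge_zero order_trans)
      also have "\<dots> = C0 * (1 + norm x) powr (p - 1) * ?d + K2 * ?d powr p" using pd by (simp add: algebra_simps)
      also have "\<dots> \<le> (\<eta> + C0 * (1 + norm x) powr (p - 1)) * ?d + (K1 + K2) * ?d powr p"
        using K assms by (simp add: algebra_simps)
      finally show ?thesis using c by simp
    qed
  qed
  then show ?thesis using K by (intro exI[of _ "K1 + K2"]) auto
qed

end

section \<open>The first-order remainder along a coupling\<close>

lemma wass_spaceD:
  assumes "Q \<in> wass_space p"
  shows "prob_space Q" "sets Q = sets borel" "space Q = UNIV" "integrable Q (\<lambda>x. norm x powr p)"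
  using assms sets_eq_imp_space_eq[of Q borel] by (auto simp: wass_space_def)

lemma wass_measurable: "Q \<in> wass_space p \<Longrightarrow> borel_measurable Q = borel_measurable borel"
  using wass_spaceD(2) measurable_cong_sets by blast

lemma wass_integrable:
  fixes h :: "'n::finite path \<Rightarrow> real"
  assumes Q: "Q \<in> wass_space p" and h: "h \<in> borel_measurable borel" "\<And>x. \<bar>h x\<bar> \<le> K * (1 + norm x powr p)"
  shows "integrable Q h"
proof -
  interpret prob_space Q using wass_spaceD(1)[OF Q] .
  have "integrable Q (\<lambda>x. K * (1 + norm x powr p))" using wass_spaceD(4)[OF Q] by auto
  then show ?thesis
    by (rule Bochner_Integration.integrable_bound)
      (use h wass_measurable[OF Q] in \<open>auto intro!: AE_I2 intro: order_trans[OF _ abs_ge_self]\<close>)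
qed

lemma wass_integrable_plus:
  fixes h :: "'n::finite path \<Rightarrow> real"
  assumes Q: "Q \<in> wass_space p" and p: "p > 0"
    and h: "h \<in> borel_measurable borel" "\<And>x. \<bar>h x\<bar> \<le> K * (1 + norm x) powr p" and K: "K \<ge> 0"
  shows "integrable Q h"
proof (rule wass_integrable[OF Q h(1)])
  fix x :: "'n path"
  have "(1 + norm x) powr p \<le> 2 powr p * (1 powr p + norm x powr p)" using p by (intro powr_add_le) auto
  then have "K * (1 + norm x) powr p \<le> K * (2 powr p * (1 + norm x powr p))" using K by (intro mult_left_mono) auto
  then show "\<bar>h x\<bar> \<le> (K * 2 powr p) * (1 + norm x powr p)" using h(2)[of x] by (simp add: mult.assoc)
qed

lemma wass_nth: "Q \<in> wass_space p \<Longrightarrow> p > 0 \<Longrightarrow> integrable Q (\<lambda>x::'n::finite path. \<bar>x $ s\<bar> powr p)"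
proof (rule wass_integrable_plus[where K=1])
  fix x :: "'n path" assume "p > 0"
  then have "\<bar>x $ s\<bar> powr p \<le> (1 + norm x) powr p"
    using abs_nth_le_norm[of x s] by (intro powr_mono2) auto
  then show "\<bar>\<bar>x $ s\<bar> powr p\<bar> \<le> 1 * (1 + norm x) powr p" by simp
qed auto

text \<open>The cost of a coupling before the \<open>p\<close>-th root is taken.\<close>
abbreviation transport_cost :: "real \<Rightarrow> ('n::finite path \<times> 'n path) measure \<Rightarrow> real" where
  "transport_cost p \<pi> \<equiv> (\<Sum>s\<in>UNIV. LINT \<omega>|\<pi>. \<bar>fst \<omega> $ s - snd \<omega> $ s\<bar> powr p)"

lemma coupling_Lp:
  fixes P Q :: "'n::finite path measure"
  assumes \<pi>: "\<pi> \<in> couplings P Q" and P: "P \<in> wass_space p" and Q: "Q \<in> wass_space p" and p: "p > 0"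
  shows "integrable \<pi> (\<lambda>\<omega>. \<bar>fst \<omega> $ s\<bar> powr p)" "integrable \<pi> (\<lambda>\<omega>. \<bar>snd \<omega> $ s\<bar> powr p)"
    and "integrable \<pi> (\<lambda>\<omega>. \<bar>fst \<omega> $ s - snd \<omega> $ s\<bar> powr p)"
proof -
  have s\<pi>: "sets \<pi> = sets borel" and dP: "distr \<pi> borel fst = P" and dQ: "distr \<pi> borel snd = Q"
    using \<pi> by (auto simp: couplings_def)
  note mf = measurable_fst_snd[OF s\<pi>]
  have m: "(\<lambda>x::'n path. \<bar>x $ s\<bar> powr p) \<in> borel_measurable borel" by measurable
  show 1: "integrable \<pi> (\<lambda>\<omega>. \<bar>fst \<omega> $ s\<bar> powr p)"
    using integrable_distr_eq[OF mf(1) m] wass_nth[OF P p] by (simp add: dP)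
  show 2: "integrable \<pi> (\<lambda>\<omega>. \<bar>snd \<omega> $ s\<bar> powr p)"
    using integrable_distr_eq[OF mf(2) m] wass_nth[OF Q p] by (simp add: dQ)
  show "integrable \<pi> (\<lambda>\<omega>. \<bar>fst \<omega> $ s - snd \<omega> $ s\<bar> powr p)"
  proof (rule Bochner_Integration.integrable_bound)
    show "integrable \<pi> (\<lambda>\<omega>. 2 powr p * (\<bar>fst \<omega> $ s\<bar> powr p + \<bar>snd \<omega> $ s\<bar> powr p))" using 1 2 by auto
    show "(\<lambda>\<omega>. \<bar>fst \<omega> $ s - snd \<omega> $ s\<bar> powr p) \<in> borel_measurable \<pi>"
    proof -
      note [measurable] = mf
      show ?thesis by measurable
    qed
    show "AE \<omega> in \<pi>. norm (\<bar>fst \<omega> $ s - snd \<omega> $ s\<bar> powr p) \<le> norm (2 powr p * (\<bar>fst \<omega> $ s\<bar> powr p + \<bar>snd \<omega> $ s\<bar> powr p))"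
    proof (rule AE_I2)
      fix \<omega> :: "'n path \<times> 'n path"
      have "\<bar>fst \<omega> $ s - snd \<omega> $ s\<bar> powr p \<le> (\<bar>fst \<omega> $ s\<bar> + \<bar>snd \<omega> $ s\<bar>) powr p"
        using p by (intro powr_mono2) auto
      also have "\<dots> \<le> 2 powr p * (\<bar>fst \<omega> $ s\<bar> powr p + \<bar>snd \<omega> $ s\<bar> powr p)"
        using p by (intro powr_add_le) auto
      finally show "norm (\<bar>fst \<omega> $ s - snd \<omega> $ s\<bar> powr p) \<le> norm (2 powr p * (\<bar>fst \<omega> $ s\<bar> powr p + \<bar>snd \<omega> $ s\<bar> powr p))"
        by simp
    qed
  qed
qed

context integrand
begin

text \<open>The weight in front of \<open>\<parallel>y - x\<parallel>\<close> in the pointwise bound for the remainder.\<close>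
definition W :: "real \<Rightarrow> real \<Rightarrow> 'n path \<Rightarrow> real" where
  "W \<eta> N x = \<eta> + (if norm x > N then C0 * (1 + norm x) powr (p - 1) else 0)"

lemma C0_pos: "C0 > 0" using K0_pos by (simp add: C0_def add_pos_nonneg)

lemma meas_W [measurable]: "W \<eta> N \<in> borel_measurable borel"
  unfolding W_def[abs_def] by measurable

lemma W_pos: "\<eta> > 0 \<Longrightarrow> W \<eta> N x > 0"
  using C0_pos by (auto simp: W_def intro!: add_pos_nonneg)

lemma W_powr_le:
  assumes q: "q = p / (p - 1)" and "\<eta> > 0"
  shows "W \<eta> N x powr q \<le> (2 powr q * (\<eta> powr q + C0 powr q)) * (1 + norm x) powr p"
proof -
  note qq = conj_exponent[OF p q]
  have "W \<eta> N x powr q \<le> (\<eta> + C0 * (1 + norm x) powr (p - 1)) powr q"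
    using W_pos[of \<eta> N x] assms C0_pos qq by (intro powr_mono2) (auto simp: W_def)
  also have "\<dots> \<le> 2 powr q * (\<eta> powr q + (C0 * (1 + norm x) powr (p - 1)) powr q)"
    using assms C0_pos qq by (intro powr_add_le) auto
  also have "(C0 * (1 + norm x) powr (p - 1)) powr q = C0 powr q * (1 + norm x) powr p"
    using C0_pos qq by (simp add: powr_mult powr_powr)
  also have "\<eta> powr q + C0 powr q * (1 + norm x) powr p \<le> (\<eta> powr q + C0 powr q) * (1 + norm x) powr p"
    using mult_left_mono[OF ge_one_powr_ge_zero[of "1 + norm x" p], of "\<eta> powr q"] p by (simp add: algebra_simps)
  finally show ?thesis by (simp add: mult.assoc)
qed

lemma W_integrable:
  assumes P: "P \<in> wass_space p" and q: "q = p / (p - 1)" and "\<eta> > 0"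
  shows "integrable P (\<lambda>x. W \<eta> N x powr q)"
  by (rule wass_integrable_plus[OF P, where K="2 powr q * (\<eta> powr q + C0 powr q)"])
    (use W_powr_le[OF q \<open>\<eta> > 0\<close>] p in auto)

text \<open>The constant \<open>2 * CARD('n) * \<eta>\<close> leaves room for strict inequality: as \<open>N\<close> tends to infinity,
  the left-hand side tends to \<open>CARD('n) * \<eta>\<^sup>q\<close>.\<close>
lemma W_small:
  assumes P: "P \<in> wass_space p" and q: "q = p / (p - 1)" and \<eta>: "\<eta> > 0"
  shows "\<exists>N\<ge>0. real CARD('n) * (LINT x|P. W \<eta> N x powr q) \<le> (2 * real CARD('n) * \<eta>) powr q"
proof -
  interpret prob_space P using wass_spaceD(1)[OF P] .
  note qq = conj_exponent[OF p q]
  let ?T = "real CARD('n)"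
  have T1: "?T \<ge> 1" using zero_less_card_finite[where 'a='n] by linarith
  have "(\<lambda>N. LINT x|P. W \<eta> (real N) x powr q) \<longlonglongrightarrow> (LINT x|P. \<eta> powr q)"
  proof (rule integral_dominated_convergence)
    show "integrable P (\<lambda>x. (2 powr q * (\<eta> powr q + C0 powr q)) * (1 + norm x) powr p)"
      by (rule wass_integrable_plus[OF P, where K="2 powr q * (\<eta> powr q + C0 powr q)"]) (use p in auto)
    show "AE x in P. (\<lambda>N. W \<eta> (real N) x powr q) \<longlonglongrightarrow> \<eta> powr q"
    proof (rule AE_I2, rule tendsto_eventually)
      fix x :: "'n path"
      obtain n where "norm x \<le> real n" using real_arch_simple by blast
      then show "\<forall>\<^sub>F N in sequentially. W \<eta> (real N) x powr q = \<eta> powr q"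
        by (intro eventually_sequentiallyI[of n]) (auto simp: W_def)
    qed
  qed (use W_powr_le[OF q \<eta>] in \<open>auto simp: wass_measurable[OF P]\<close>)
  then have lim: "(\<lambda>N. ?T * (LINT x|P. W \<eta> (real N) x powr q)) \<longlonglongrightarrow> ?T * \<eta> powr q"
    by (auto intro!: tendsto_mult_left simp: prob_space)
  have "?T * \<eta> powr q < (2 * ?T * \<eta>) powr q"
  proof -
    have "1 < 2 powr q" using qq by (intro gr_one_powr) auto
    moreover have "?T \<le> ?T powr q" using powr_mono[of 1 q ?T] T1 qq by simp
    then have "2 powr q * ?T \<le> 2 powr q * ?T powr q" by (intro mult_left_mono) auto
    ultimately have "?T < 2 powr q * ?T powr q" using T1 less_le_trans[of ?T "2 powr q * ?T"] by simp
    then show ?thesis using \<eta> T1 by (simp add: powr_mult)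
  qed
  from order_tendstoD(2)[OF lim this] obtain N where "?T * (LINT x|P. W \<eta> (real N) x powr q) < (2 * ?T * \<eta>) powr q"
    by (meson eventually_sequentially order_refl)
  then show ?thesis by (intro exI[of _ "real N"]) auto
qed

text \<open>The expected remainder is of smaller order than the cost \<open>B\<close>, uniformly over all couplings of
  \<open>P\<close> with laws of finite \<open>p\<close>-th moment. The dominating function \<open>V\<close> does not depend on the stopping index, so the bound
  applies to every stopping rule at once.\<close>
lemma rem_integral:
  assumes P: "P \<in> wass_space p" and \<epsilon>: "\<epsilon> > 0"
  shows "\<exists>r0>0. \<forall>Q \<pi> B. Q \<in> wass_space p \<longrightarrow> \<pi> \<in> couplings P Q \<longrightarrow> 0 < B \<longrightarrow> B \<le> r0 \<longrightarrow>
     transport_cost p \<pi> \<le> B powr p \<longrightarrow>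
     (\<exists>V. integrable \<pi> V \<and> (LINT \<omega>|\<pi>. V \<omega>) \<le> \<epsilon> * B \<and> (\<forall>x y t. \<bar>taylor_rem x y t\<bar> \<le> V (x, y)))"
proof -
  define q where q: "q = p / (p - 1)"
  note qq = conj_exponent[OF p q]
  let ?T = "real CARD('n)"
  have T1: "?T \<ge> 1" using zero_less_card_finite[where 'a='n] by linarith
  define \<eta> where "\<eta> = \<epsilon> / (4 * ?T)"
  have \<eta>: "\<eta> > 0" using \<epsilon> T1 by (simp add: \<eta>_def)
  obtain N where N: "N \<ge> 0" "?T * (LINT x|P. W \<eta> N x powr q) \<le> (2 * ?T * \<eta>) powr q"
    using W_small[OF P q \<eta>] by blast
  have A: "2 * ?T * \<eta> = \<epsilon> / 2" using T1 by (simp add: \<eta>_def)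
  obtain K where K: "K \<ge> 0" "\<And>x y t. \<bar>taylor_rem x y t\<bar> \<le> W \<eta> N x * norm (y - x) + K * norm (y - x) powr p"
    using rem_bound[OF \<eta> N(1)] unfolding W_def by blast
  define L where "L = K * ?T powr p"
  have L0: "L \<ge> 0" using K by (simp add: L_def)
  define r0 where "r0 = (\<epsilon> / (2 * (L + 1))) powr (1 / (p - 1))"
  have r0: "r0 > 0" using \<epsilon> L0 by (simp add: r0_def)
  show ?thesis
  proof (intro exI[of _ r0] conjI r0 allI impI)
    fix Q :: "'n path measure" and \<pi> :: "('n path \<times> 'n path) measure" and B :: real
    assume Q: "Q \<in> wass_space p" and pc: "\<pi> \<in> couplings P Q"
      and B: "0 < B" "B \<le> r0" "transport_cost p \<pi> \<le> B powr p"
    have pr: "prob_space \<pi>" and s: "sets \<pi> = sets borel" and dP: "distr \<pi> borel fst = P"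
      using pc by (auto simp: couplings_def)
    have i: "\<forall>s. integrable \<pi> (\<lambda>\<omega>. \<bar>fst \<omega> $ s - snd \<omega> $ s\<bar> powr p)"
      using coupling_Lp(3)[OF pc P Q] p by auto
    interpret prob_space \<pi> by fact
    have [measurable_cong]: "sets \<pi> = sets (borel \<Otimes>\<^sub>M borel)" using s by (simp only: borel_prod)
    let ?d = "\<lambda>s \<omega>. fst \<omega> $ s - snd \<omega> $ s"
    let ?G = "\<lambda>s \<omega>. W \<eta> N (fst \<omega>)"
    have dsq: "integrable \<pi> (\<lambda>\<omega>. W \<eta> N (fst \<omega>) powr q)" "(LINT \<omega>|\<pi>. W \<eta> N (fst \<omega>) powr q) = (LINT x|P. W \<eta> N x powr q)"
      using W_integrable[OF P q \<eta>, of N] unfolding dP[symmetric]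
      by (auto simp: integrable_distr_eq integral_distr)
    have Wabs: "\<bar>W \<eta> N x\<bar> = W \<eta> N x" for x using W_pos[OF \<eta>, of N x] by simp
    have iG: "integrable \<pi> (\<lambda>\<omega>. \<bar>W \<eta> N (fst \<omega>)\<bar> powr q)" using dsq(1) by (simp add: Wabs)
    have sG: "(\<Sum>s\<in>(UNIV::'n set). LINT \<omega>|\<pi>. \<bar>W \<eta> N (fst \<omega>)\<bar> powr q) \<le> (\<epsilon> / 2) powr q"
      using N(2) by (simp add: Wabs dsq(2) A)
    have e2: "\<epsilon> / 2 > 0" using \<epsilon> by simp
    note H = Holder_sum[of p q ?G \<pi> ?d "\<epsilon>/2" B, OF p q _ _ iG _ e2 sG B(1) B(3)]
    have iWd: "integrable \<pi> (\<lambda>\<omega>. W \<eta> N (fst \<omega>) * ?d s \<omega>)" for s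
      by (rule H(1)) (use i in auto)
    have sWd: "(\<Sum>s\<in>UNIV. LINT \<omega>|\<pi>. \<bar>W \<eta> N (fst \<omega>) * ?d s \<omega>\<bar>) \<le> \<epsilon> / 2 * B"
      by (rule H(2)) (use i in auto)
    define V where "V \<omega> = (\<Sum>s\<in>UNIV. \<bar>W \<eta> N (fst \<omega>) * ?d s \<omega>\<bar>) + L * (\<Sum>s\<in>UNIV. \<bar>?d s \<omega>\<bar> powr p)" for \<omega>
    have "integrable \<pi> V" unfolding V_def using iWd i by auto
    moreover have "(LINT \<omega>|\<pi>. V \<omega>) \<le> \<epsilon> * B"
    proof -
      have "(LINT \<omega>|\<pi>. V \<omega>) = (\<Sum>s\<in>UNIV. LINT \<omega>|\<pi>. \<bar>W \<eta> N (fst \<omega>) * ?d s \<omega>\<bar>) + L * (\<Sum>s\<in>UNIV. LINT \<omega>|\<pi>. \<bar>?d s \<omega>\<bar> powr p)"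
        unfolding V_def using iWd i by (simp add: Bochner_Integration.integral_sum)
      also have "\<dots> \<le> \<epsilon> / 2 * B + L * B powr p" using sWd B L0 by (intro add_mono mult_left_mono) auto
      also have "L * B powr p \<le> \<epsilon> / 2 * B"
      proof -
        have "B powr (p - 1) \<le> r0 powr (p - 1)" using B p by (intro powr_mono2) auto
        also have "r0 powr (p - 1) = \<epsilon> / (2 * (L + 1))" using p \<epsilon> L0 by (simp add: r0_def powr_powr)
        finally have "(L + 1) * B powr (p - 1) \<le> \<epsilon> / 2" using L0 by (simp add: field_simps)
        then have "L * B powr (p - 1) \<le> \<epsilon> / 2" using mult_right_mono[of L "L + 1" "B powr (p - 1)"] by simp
        then have "L * B powr (p - 1) * B \<le> \<epsilon> / 2 * B" using B by (intro mult_right_mono) auto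
        then show ?thesis using powr_add[of B "p - 1" 1] B by (simp add: mult.assoc)
      qed
      finally show ?thesis by (simp add: mult.commute)
    qed
    moreover have "\<bar>taylor_rem x y t\<bar> \<le> V (x, y)" for x y t
    proof -
      have "W \<eta> N x * norm (y - x) \<le> W \<eta> N x * (\<Sum>s\<in>UNIV. \<bar>(y - x) $ s\<bar>)"
        using W_pos[OF \<eta>, of N x] norm_le_l1_cart[of "y - x"] by (intro mult_left_mono) auto
      also have "\<dots> = (\<Sum>s\<in>UNIV. \<bar>W \<eta> N x * (x $ s - y $ s)\<bar>)"
        by (simp add: sum_distrib_left abs_mult Wabs abs_minus_commute)
      finally have 1: "W \<eta> N x * norm (y - x) \<le> (\<Sum>s\<in>UNIV. \<bar>W \<eta> N x * (x $ s - y $ s)\<bar>)" .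
      have "K * norm (y - x) powr p \<le> K * (?T powr p * (\<Sum>s\<in>UNIV. \<bar>(y - x) $ s\<bar> powr p))"
        using K p by (intro mult_left_mono norm_powr_le_sum) auto
      also have "\<dots> = L * (\<Sum>s\<in>UNIV. \<bar>x $ s - y $ s\<bar> powr p)"
        by (simp add: L_def mult.assoc abs_minus_commute)
      finally show ?thesis using K(2)[of x y t] 1 unfolding V_def by simp
    qed
    ultimately show "\<exists>V. integrable \<pi> V \<and> (LINT \<omega>|\<pi>. V \<omega>) \<le> \<epsilon> * B \<and> (\<forall>x y t. \<bar>taylor_rem x y t\<bar> \<le> V (x, y))" by blast
  qed
qed

end

section \<open>Stopping times and minimising sequences\<close>

lemma stopping_le_sets: "\<tau> \<in> ST \<Longrightarrow> {x. \<tau> x \<le> t} \<in> sets (canon_filt t)"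
  using stopping_timeD[of canon_filt \<tau> t] by (simp add: ST_def pred_def)

lemma STI: "(\<And>t. {x. \<tau> x \<le> t} \<in> sets (canon_filt t)) \<Longrightarrow> \<tau> \<in> ST"
  by (auto simp: ST_def stopping_time_def pred_def)

lemma canon_filt_borel: "A \<in> sets (canon_filt t) \<Longrightarrow> A \<in> sets borel"
  using subalgebra_gen_by[of "\<lambda>x. x" borel] by (auto simp: subalgebra_def canon_filt_def)

text \<open>A map into a finite chain is measurable if its lower level sets are.\<close>
lemma measurable_count_space_le:
  fixes h :: "'a \<Rightarrow> 'n::{finite,linorder}"
  assumes le: "\<And>t. {z \<in> space M. h z \<le> t} \<in> sets M"
  shows "h \<in> M \<rightarrow>\<^sub>M count_space UNIV"
proof -
  have "h -` {t} \<inter> space M = {z \<in> space M. h z \<le> t} - (\<Union>s\<in>{..<t}. {z \<in> space M. h z \<le> s})" for t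
  proof (intro set_eqI iffI)
    fix z assume "z \<in> {z \<in> space M. h z \<le> t} - (\<Union>s\<in>{..<t}. {z \<in> space M. h z \<le> s})"
    then show "z \<in> h -` {t} \<inter> space M" by (cases "h z < t") auto
  qed (auto simp: not_le)
  moreover have "{z \<in> space M. h z \<le> t} - (\<Union>s\<in>{..<t}. {z \<in> space M. h z \<le> s}) \<in> sets M" for t
    using le by (intro sets.Diff sets.finite_UN) auto
  ultimately show ?thesis by (auto simp: measurable_count_space_eq2)
qed

lemma ST_measurable: "\<tau> \<in> ST \<Longrightarrow> \<tau> \<in> borel \<rightarrow>\<^sub>M count_space UNIV"
  using canon_filt_borel[OF stopping_le_sets] by (intro measurable_count_space_le) simp

lemma ST_max: "\<sigma> \<in> ST \<Longrightarrow> \<tau> \<in> ST \<Longrightarrow> (\<lambda>x. max (\<sigma> x) (\<tau> x)) \<in> ST"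
  unfolding ST_def by (simp add: stopping_time_max)

lemma ST_min: "\<sigma> \<in> ST \<Longrightarrow> \<tau> \<in> ST \<Longrightarrow> (\<lambda>x. min (\<sigma> x) (\<tau> x)) \<in> ST"
  unfolding ST_def by (simp add: stopping_time_min)

text \<open>Pointwise limits of stopping times, in the discrete topology of the time set, are stopping times.\<close>
lemma ST_limit:
  assumes "\<And>n. \<tau> n \<in> ST" and "\<And>x. \<forall>\<^sub>F n in sequentially. \<tau> n x = \<sigma> x"
  shows "\<sigma> \<in> ST"
proof (rule STI)
  fix t
  have "{x. \<sigma> x \<le> t} = (\<Union>N. \<Inter>n\<in>{N..}. {x. \<tau> n x \<le> t})"
  proof safe
    fix x assume "\<sigma> x \<le> t"
    obtain N where "\<And>n. n \<ge> N \<Longrightarrow> \<tau> n x = \<sigma> x" using assms(2)[of x] by (auto simp: eventually_sequentially)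
    then show "x \<in> (\<Union>N. \<Inter>n\<in>{N..}. {x. \<tau> n x \<le> t})" using \<open>\<sigma> x \<le> t\<close> by (auto intro!: exI[of _ N])
  next
    fix x N assume "x \<in> (\<Inter>n\<in>{N..}. {x. \<tau> n x \<le> t})"
    moreover obtain M where "\<And>n. n \<ge> M \<Longrightarrow> \<tau> n x = \<sigma> x" using assms(2)[of x] by (auto simp: eventually_sequentially)
    ultimately show "\<sigma> x \<le> t" by (auto dest: bspec[of _ _ "max M N"])
  qed
  also have "\<dots> \<in> sets (canon_filt t)"
    using stopping_le_sets[OF assms(1)] by (intro sets.countable_UN sets.countable_INT'') auto
  finally show "{x. \<sigma> x \<le> t} \<in> sets (canon_filt t)" .
qed

text \<open>An optimal stopping problem with integrable costs.\<close>
locale stopping = prob_space P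
  for P :: "'n::{finite, linorder} path measure" +
  fixes f :: "'n path \<Rightarrow> 'n \<Rightarrow> real"
  assumes sets_P [measurable_cong]: "sets P = sets borel"
    and integrable_f: "\<And>t. integrable P (\<lambda>x. f x t)"
begin

text \<open>The expected cost of a stopping rule.\<close>
definition J :: "('n path \<Rightarrow> 'n) \<Rightarrow> real" where "J \<tau> = (LINT x|P. f x (\<tau> x))"

lemma f_meas [measurable]: "(\<lambda>x. f x t) \<in> borel_measurable P"
  using integrable_f by auto

lemma ST_P [measurable_dest]: "\<tau> \<in> ST \<Longrightarrow> \<tau> \<in> P \<rightarrow>\<^sub>M count_space UNIV"
  using ST_measurable by (simp add: measurable_cong_sets[OF sets_P refl])

lemma f_tau_meas: "\<tau> \<in> P \<rightarrow>\<^sub>M count_space UNIV \<Longrightarrow> (\<lambda>x. f x (\<tau> x)) \<in> borel_measurable P"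
  by (rule measurable_compose_countable'[where I=UNIV]) (auto simp: countable_finite)

lemma f_tau_le: "\<bar>f x (\<tau> x)\<bar> \<le> (\<Sum>t\<in>UNIV. \<bar>f x t\<bar>)"
  by (rule member_le_sum) auto

lemma f_sum_int: "integrable P (\<lambda>x. \<Sum>t\<in>UNIV. \<bar>f x t\<bar>)" using integrable_f by auto

lemma f_tau_int: "\<tau> \<in> ST \<Longrightarrow> integrable P (\<lambda>x. f x (\<tau> x))"
  by (rule integrable_select[OF integrable_f ST_P])

lemma stop_value_le: "\<tau> \<in> ST \<Longrightarrow> stop_value f P \<le> J \<tau>"
  unfolding stop_value_def J_def
proof (rule cINF_lower)
  show "bdd_below ((\<lambda>\<tau>. LINT x|P. f x (\<tau> x)) ` ST)"
  proof (rule bdd_belowI2)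
    fix \<tau> :: "'n path \<Rightarrow> 'n" assume \<tau>: "\<tau> \<in> ST"
    have "(LINT x|P. - (\<Sum>t\<in>UNIV. \<bar>f x t\<bar>)) \<le> (LINT x|P. f x (\<tau> x))"
    proof (rule integral_mono)
      show "- (\<Sum>t\<in>UNIV. \<bar>f x t\<bar>) \<le> f x (\<tau> x)" for x using f_tau_le[of x \<tau>] by linarith
    qed (use f_sum_int f_tau_int[OF \<tau>] in auto)
    then show "(LINT x|P. - (\<Sum>t\<in>UNIV. \<bar>f x t\<bar>)) \<le> (LINT x|P. f x (\<tau> x))" .
  qed
qed auto

lemma J_limit:
  assumes "\<And>n. \<tau> n \<in> ST" and "\<And>x. \<forall>\<^sub>F n in sequentially. \<tau> n x = \<sigma> x"
  shows "(\<lambda>n. J (\<tau> n)) \<longlonglongrightarrow> J \<sigma>"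
  unfolding J_def
proof (rule integral_dominated_convergence[OF _ _ f_sum_int])
  have "\<sigma> \<in> ST" by (rule ST_limit[OF assms])
  then show "(\<lambda>x. f x (\<sigma> x)) \<in> borel_measurable P" by (intro f_tau_meas ST_P)
  show "(\<lambda>x. f x (\<tau> n x)) \<in> borel_measurable P" for n using assms(1) by (intro f_tau_meas ST_P)
  show "AE x in P. (\<lambda>n. f x (\<tau> n x)) \<longlonglongrightarrow> f x (\<sigma> x)"
  proof (rule AE_I2, rule tendsto_eventually)
    fix x show "\<forall>\<^sub>F n in sequentially. f x (\<tau> n x) = f x (\<sigma> x)"
      using assms(2)[of x] by eventually_elim simp
  qed
  show "AE x in P. norm (f x (\<tau> n x)) \<le> (\<Sum>t\<in>UNIV. \<bar>f x t\<bar>)" for n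
    using f_tau_le by auto
qed

text \<open>At each path, the maximum and the minimum of two times are these two times in some order.\<close>
lemma J_modular:
  assumes "\<sigma> \<in> ST" "\<tau> \<in> ST"
  shows "J (\<lambda>x. max (\<sigma> x) (\<tau> x)) + J (\<lambda>x. min (\<sigma> x) (\<tau> x)) = J \<sigma> + J \<tau>"
proof -
  have "J (\<lambda>x. max (\<sigma> x) (\<tau> x)) + J (\<lambda>x. min (\<sigma> x) (\<tau> x)) =
    (LINT x|P. f x (max (\<sigma> x) (\<tau> x)) + f x (min (\<sigma> x) (\<tau> x)))"
    unfolding J_def using assms by (intro Bochner_Integration.integral_add[symmetric] f_tau_int ST_max ST_min)
  also have "\<dots> = (LINT x|P. f x (\<sigma> x) + f x (\<tau> x))"
    by (intro Bochner_Integration.integral_cong) (auto simp: max_def min_def)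
  also have "\<dots> = J \<sigma> + J \<tau>"
    unfolding J_def using assms by (intro Bochner_Integration.integral_add f_tau_int)
  finally show ?thesis .
qed

text \<open>
  For a minimising sequence with summable excess, the superior limit (\<open>m = max\<close>) and the inferior
  limit (\<open>m = min\<close>) are optimal stopping times. In a finite chain they are the largest and the
  smallest value that is attained infinitely often. By modularity the excess of the maximum of
  \<open>\<tau>\<^sub>N, ..., \<tau>\<^sub>N\<^sub>+\<^sub>k\<close> is at most the sum of their excesses; then \<open>k\<close> and \<open>N\<close> tend to infinity.
\<close>
lemma extremal_limit:
  fixes m :: "'n \<Rightarrow> 'n \<Rightarrow> 'n" and Mx :: "'n set \<Rightarrow> 'n"
  assumes mMx: "(m = max \<and> Mx = Max) \<or> (m = min \<and> Mx = Min)"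
    and \<tau>: "\<And>n::nat. \<tau> n \<in> ST" and J: "\<And>n. J (\<tau> n) \<le> stop_value f P + (1/2)^n"
  shows "(\<lambda>x. Mx {v. \<exists>\<^sub>\<infinity>n. \<tau> n x = v}) \<in> ST" "J (\<lambda>x. Mx {v. \<exists>\<^sub>\<infinity>n. \<tau> n x = v}) \<le> stop_value f P"
proof -
  let ?s = "stop_value f P"
  have m: "(\<lambda>x. m (\<sigma> x) (\<rho> x)) \<in> ST" "J (\<lambda>x. m (\<sigma> x) (\<rho> x)) \<le> J \<sigma> + J \<rho> - ?s" if "\<sigma> \<in> ST" "\<rho> \<in> ST" for \<sigma> \<rho>
  proof -
    show "(\<lambda>x. m (\<sigma> x) (\<rho> x)) \<in> ST" using mMx ST_max[OF that] ST_min[OF that] by auto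
    show "J (\<lambda>x. m (\<sigma> x) (\<rho> x)) \<le> J \<sigma> + J \<rho> - ?s"
      using mMx J_modular[OF that] stop_value_le[OF ST_max[OF that]] stop_value_le[OF ST_min[OF that]] by auto
  qed
  define g where "g N k x = Mx ((\<lambda>n. \<tau> n x) ` {N..N + k})" for N k x
  have gS: "g N (Suc k) x = m (\<tau> (N + Suc k) x) (g N k x)" for N k x
  proof -
    have "(\<lambda>n. \<tau> n x) ` {N..N + Suc k} = insert (\<tau> (N + Suc k) x) ((\<lambda>n. \<tau> n x) ` {N..N + k})"
      by (simp add: atLeastAtMostSuc_conv)
    then show ?thesis unfolding g_def using mMx by auto
  qed
  have g: "g N k \<in> ST \<and> J (g N k) \<le> ?s + (\<Sum>i\<le>k. (1/2)^(N + i))" for N k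
  proof (induction k)
    case 0
    have "g N 0 = \<tau> N" using mMx by (auto simp: g_def)
    then show ?case using \<tau> J by simp
  next
    case (Suc k)
    have "g N (Suc k) = (\<lambda>x. m (\<tau> (N + Suc k) x) (g N k x))" using gS by auto
    then show ?case using m[OF \<tau>[of "N + Suc k"], of "g N k"] Suc J[of "N + Suc k"] by auto
  qed
  have geo: "(\<Sum>i\<le>k. (1/2)^(N + i)) \<le> 2 * (1/2::real)^N" for N k
  proof -
    have "(\<Sum>i\<le>k. (1/2)^(N + i)) = (1/2::real)^N * (\<Sum>i\<le>k. (1/2)^i)" by (simp add: power_add sum_distrib_left)
    also have "(\<Sum>i\<le>k. (1/2)^i) = 2 - (1/2::real)^k" by (induction k) (auto simp: field_simps)
    also have "(1/2::real)^N * (2 - (1/2)^k) \<le> (1/2)^N * 2" by (intro mult_left_mono) auto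
    finally show ?thesis by simp
  qed
  define S where "S N x = Mx ((\<lambda>n. \<tau> n x) ` {N..})" for N x
  have gS: "\<forall>\<^sub>F k in sequentially. g N k x = S N x" for N x
  proof -
    have "\<forall>\<^sub>F k in sequentially. v \<in> (\<lambda>n. \<tau> n x) ` {N..N + k} \<longleftrightarrow> v \<in> (\<lambda>n. \<tau> n x) ` {N..}" for v
    proof (cases "v \<in> (\<lambda>n. \<tau> n x) ` {N..}")
      case True
      then obtain j where "j \<ge> N" "v = \<tau> j x" by auto
      then show ?thesis by (intro eventually_sequentiallyI[of j]) auto
    next
      case False
      then have "v \<notin> (\<lambda>n. \<tau> n x) ` {N..N + k}" for k by auto
      then show ?thesis using False by simp
    qed
    then have "\<forall>\<^sub>F k in sequentially. \<forall>v. v \<in> (\<lambda>n. \<tau> n x) ` {N..N + k} \<longleftrightarrow> v \<in> (\<lambda>n. \<tau> n x) ` {N..}"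
      by (rule eventually_all_finite)
    then show ?thesis by eventually_elim (simp add: g_def S_def set_eq_iff[symmetric])
  qed
  have S: "S N \<in> ST" "J (S N) \<le> ?s + 2 * (1/2)^N" for N
  proof -
    show "S N \<in> ST" by (rule ST_limit[OF _ gS]) (use g in auto)
    have "(\<lambda>k. J (g N k)) \<longlonglongrightarrow> J (S N)" by (rule J_limit[OF _ gS]) (use g in auto)
    moreover have "J (g N k) \<le> ?s + 2 * (1/2)^N" for k using g[of N k] geo[of N k] by linarith
    ultimately show "J (S N) \<le> ?s + 2 * (1/2)^N" by (intro LIMSEQ_le_const2[of "\<lambda>k. J (g N k)"]) auto
  qed
  let ?R = "\<lambda>x. Mx {v. \<exists>\<^sub>\<infinity>n. \<tau> n x = v}"
  have SR: "\<forall>\<^sub>F N in sequentially. S N x = ?R x" for x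
  proof -
    have "\<forall>\<^sub>F N in sequentially. v \<in> (\<lambda>n. \<tau> n x) ` {N..} \<longleftrightarrow> v \<in> {v. \<exists>\<^sub>\<infinity>n. \<tau> n x = v}" for v
    proof (cases "\<exists>\<^sub>\<infinity>n. \<tau> n x = v")
      case True
      then have "v \<in> (\<lambda>n. \<tau> n x) ` {N..}" for N unfolding INFM_nat_le by auto
      then show ?thesis using True by auto
    next
      case False
      then obtain M where "\<And>n. n \<ge> M \<Longrightarrow> \<tau> n x \<noteq> v" by (auto simp: INFM_nat_le)
      then have "v \<notin> (\<lambda>n. \<tau> n x) ` {N..}" if "N \<ge> M" for N
        using that by (metis imageE atLeast_iff order_trans)
      moreover have "v \<notin> {v. \<exists>\<^sub>\<infinity>n. \<tau> n x = v}" using False by simp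
      ultimately show ?thesis by (intro eventually_sequentiallyI[of M] iffI) (simp_all only: simp_thms)
    qed
    then have "\<forall>\<^sub>F N in sequentially. \<forall>v. v \<in> (\<lambda>n. \<tau> n x) ` {N..} \<longleftrightarrow> v \<in> {v. \<exists>\<^sub>\<infinity>n. \<tau> n x = v}"
      by (rule eventually_all_finite)
    then show ?thesis by eventually_elim (simp only: S_def set_eq_iff[symmetric])
  qed
  show "?R \<in> ST" by (rule ST_limit[OF S(1) SR])
  have "(\<lambda>N. J (S N)) \<longlonglongrightarrow> J ?R" by (rule J_limit[OF S(1) SR])
  moreover have "(\<lambda>N. ?s + 2 * (1/2)^N) \<longlonglongrightarrow> ?s + 2 * 0" by (intro tendsto_intros LIMSEQ_power_zero) auto
  ultimately show "J ?R \<le> ?s" using S(2) by (intro LIMSEQ_le) auto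
qed

lemma minimising_sequence_converges:
  assumes unique: "\<And>\<tau>. \<tau> \<in> ST \<Longrightarrow> stop_value f P = J \<tau> \<Longrightarrow> AE x in P. \<tau> x = \<tau>o x"
    and \<tau>: "\<And>n::nat. \<tau> n \<in> ST" and J: "\<And>n. J (\<tau> n) \<le> stop_value f P + (1/2)^n"
  shows "AE x in P. \<forall>\<^sub>F n in sequentially. \<tau> n x = \<tau>o x"
proof -
  note mx = extremal_limit[of max Max \<tau>, OF _ \<tau> J] and mn = extremal_limit[of min Min \<tau>, OF _ \<tau> J]
  have "AE x in P. Max {v. \<exists>\<^sub>\<infinity>n. \<tau> n x = v} = \<tau>o x"
    by (rule unique) (use mx stop_value_le in \<open>auto intro!: antisym\<close>)
  moreover have "AE x in P. Min {v. \<exists>\<^sub>\<infinity>n. \<tau> n x = v} = \<tau>o x"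
    by (rule unique) (use mn stop_value_le in \<open>auto intro!: antisym\<close>)
  ultimately show ?thesis
  proof eventually_elim
    case (elim x)
    have "\<forall>\<^sub>F n in sequentially. \<tau> n x = v \<longrightarrow> v = \<tau>o x" for v
    proof (cases "\<exists>\<^sub>\<infinity>n. \<tau> n x = v")
      case True
      then have "v \<le> Max {v. \<exists>\<^sub>\<infinity>n. \<tau> n x = v}" "Min {v. \<exists>\<^sub>\<infinity>n. \<tau> n x = v} \<le> v" by auto
      then have "v = \<tau>o x" using elim by auto
      then show ?thesis by simp
    next
      case False
      then have "\<forall>\<^sub>F n in sequentially. \<tau> n x \<noteq> v"
        by (simp add: frequently_cofinite[symmetric] not_frequently cofinite_eq_sequentially)
      then show ?thesis by eventually_elim simp
    qed
    then have "\<forall>\<^sub>F n in sequentially. \<forall>v. \<tau> n x = v \<longrightarrow> v = \<tau>o x" by (rule eventually_all_finite)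
    then show ?case by eventually_elim simp
  qed
qed

text \<open>Stability of the unique optimiser: nearly optimal stopping times differ from it only on events
  that are small for the finite measure with density \<open>|W|\<close>.\<close>
lemma near_optimal:
  fixes W :: "'n path \<Rightarrow> real"
  assumes \<tau>o: "\<tau>o \<in> ST" and unique: "\<And>\<tau>. \<tau> \<in> ST \<Longrightarrow> stop_value f P = J \<tau> \<Longrightarrow> AE x in P. \<tau> x = \<tau>o x"
    and W: "integrable P W" and \<eta>: "\<eta> > 0"
  shows "\<exists>\<epsilon>>0. \<forall>\<tau>\<in>ST. J \<tau> \<le> stop_value f P + \<epsilon> \<longrightarrow> (LINT x|P. \<bar>W x\<bar> * indicator {x. \<tau> x \<noteq> \<tau>o x} x) < \<eta>"
proof (rule ccontr)
  assume neg: "\<not> ?thesis"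
  have "\<forall>n::nat. \<exists>\<tau>. \<tau> \<in> ST \<and> J \<tau> \<le> stop_value f P + (1/2)^n \<and> (LINT x|P. \<bar>W x\<bar> * indicator {x. \<tau> x \<noteq> \<tau>o x} x) \<ge> \<eta>"
  proof
    fix n :: nat
    have "(1/2::real)^n > 0" by simp
    then have "\<not> (\<forall>\<tau>\<in>ST. J \<tau> \<le> stop_value f P + (1/2)^n \<longrightarrow> (LINT x|P. \<bar>W x\<bar> * indicator {x. \<tau> x \<noteq> \<tau>o x} x) < \<eta>)"
      using neg by blast
    then obtain \<tau> where "\<tau> \<in> ST" "J \<tau> \<le> stop_value f P + (1/2)^n"
      "\<not> (LINT x|P. \<bar>W x\<bar> * indicator {x. \<tau> x \<noteq> \<tau>o x} x) < \<eta>" by blast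
    then show "\<exists>\<tau>. \<tau> \<in> ST \<and> J \<tau> \<le> stop_value f P + (1/2)^n \<and> (LINT x|P. \<bar>W x\<bar> * indicator {x. \<tau> x \<noteq> \<tau>o x} x) \<ge> \<eta>"
      by (intro exI[of _ \<tau>]) (simp add: not_less)
  qed
  from choice[OF this] obtain \<tau> where \<tau>: "\<And>n. \<tau> n \<in> ST" "\<And>n. J (\<tau> n) \<le> stop_value f P + (1/2)^n"
    "\<And>n. (LINT x|P. \<bar>W x\<bar> * indicator {x. \<tau> n x \<noteq> \<tau>o x} x) \<ge> \<eta>" by blast
  note [measurable] = ST_P[OF \<tau>(1)] ST_P[OF \<tau>o]
  have [measurable]: "W \<in> borel_measurable P" using W by auto
  have "(\<lambda>n. LINT x|P. \<bar>W x\<bar> * indicator {x. \<tau> n x \<noteq> \<tau>o x} x) \<longlonglongrightarrow> (LINT x|P. 0)"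
  proof (rule integral_dominated_convergence)
    show "integrable P (\<lambda>x. \<bar>W x\<bar>)" using W by auto
    have "AE x in P. \<forall>\<^sub>F n in sequentially. \<tau> n x = \<tau>o x"
      by (rule minimising_sequence_converges[OF unique \<tau>(1,2)])
    then show "AE x in P. (\<lambda>n. \<bar>W x\<bar> * indicator {x. \<tau> n x \<noteq> \<tau>o x} x) \<longlonglongrightarrow> 0"
    proof eventually_elim
      case (elim x)
      then show ?case by (intro tendsto_eventually) (erule eventually_mono, simp)
    qed
    show "AE x in P. norm (\<bar>W x\<bar> * indicator {x. \<tau> n x \<noteq> \<tau>o x} x) \<le> \<bar>W x\<bar>" for n
      by (auto simp: indicator_def)
    have [measurable]: "{x. \<tau> n x \<noteq> \<tau>o x} \<in> sets P" for n
    proof -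
      have "{x \<in> space P. \<tau> n x \<noteq> \<tau>o x} \<in> sets P" by measurable
      then show ?thesis using sets_eq_imp_space_eq[OF sets_P] by simp
    qed
    show "(\<lambda>x. \<bar>W x\<bar> * indicator {x. \<tau> n x \<noteq> \<tau>o x} x) \<in> borel_measurable P" for n by measurable
  qed auto
  then have "(\<lambda>n. LINT x|P. \<bar>W x\<bar> * indicator {x. \<tau> n x \<noteq> \<tau>o x} x) \<longlonglongrightarrow> 0" by simp
  from LIMSEQ_le_const[OF this, of \<eta>] \<tau>(3) \<eta> show False by auto
qed

end

section \<open>Randomised stopping times\<close>

text \<open>
  The sum of \<open>g t\<close> times the increment of \<open>L\<close> at \<open>t\<close>, where \<open>L\<close> is taken to be \<open>0\<close> before the first
  time. If \<open>L\<close> is the distribution function of a random time, it is the mean of \<open>g\<close> at this time.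
\<close>
definition by_parts :: "('n::{finite,linorder} \<Rightarrow> real) \<Rightarrow> ('n \<Rightarrow> real) \<Rightarrow> real" where
  "by_parts g L = (\<Sum>t\<in>UNIV. g t * (L t - (if {..<t} = {} then 0 else L (Max {..<t}))))"

lemma by_parts_step: "by_parts g (\<lambda>s. if i \<le> s then 1 else 0) = g i"
proof -
  have "(if i \<le> t then 1 else 0) - (if {..<t} = {} then 0 else if i \<le> Max {..<t} then 1 else 0) = (if t = i then 1 else (0::real))" for t
  proof (cases "i < t")
    case True
    then have "i \<le> Max {..<t}" "{..<t} \<noteq> {}" by auto
    then show ?thesis using True by auto
  next
    case False
    have "\<not> i \<le> Max {..<t}" if "{..<t} \<noteq> {}"
      using Max_in[OF _ that] False by auto
    then show ?thesis using False by auto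
  qed
  then have "by_parts g (\<lambda>s. if i \<le> s then 1 else 0) = (\<Sum>t\<in>UNIV. g t * (if t = i then 1 else 0))"
    unfolding by_parts_def by simp
  also have "\<dots> = (\<Sum>t\<in>UNIV. if t = i then g t else 0)" by (intro sum.cong) auto
  finally show ?thesis by simp
qed

lemma by_parts_integral:
  assumes "\<And>t s. integrable M (\<lambda>\<omega>. g \<omega> t * L \<omega> s)"
  shows "integrable M (\<lambda>\<omega>. by_parts (g \<omega>) (L \<omega>))"
    and "(LINT \<omega>|M. by_parts (g \<omega>) (L \<omega>)) =
      (\<Sum>t\<in>UNIV. (LINT \<omega>|M. g \<omega> t * L \<omega> t) - (if {..<t} = {} then 0 else LINT \<omega>|M. g \<omega> t * L \<omega> (Max {..<t})))"
proof -
  have *: "by_parts (g \<omega>) (L \<omega>) = (\<Sum>t\<in>UNIV. g \<omega> t * L \<omega> t - (if {..<t} = {} then 0 else g \<omega> t * L \<omega> (Max {..<t})))" for \<omega>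
    unfolding by_parts_def by (intro sum.cong) (auto simp: algebra_simps)
  have i: "integrable M (\<lambda>\<omega>. if {..<t} = {} then 0 else g \<omega> t * L \<omega> (Max {..<t}))" for t
    using assms by (cases "{..<t} = {}") auto
  show "integrable M (\<lambda>\<omega>. by_parts (g \<omega>) (L \<omega>))" unfolding * using assms i by auto
  have "(LINT \<omega>|M. by_parts (g \<omega>) (L \<omega>)) =
     (\<Sum>t\<in>UNIV. (LINT \<omega>|M. g \<omega> t * L \<omega> t) - (LINT \<omega>|M. (if {..<t} = {} then 0 else g \<omega> t * L \<omega> (Max {..<t}))))"
    unfolding * using assms i by (subst Bochner_Integration.integral_sum) (auto intro!: sum.cong)
  also have "\<dots> = (\<Sum>t\<in>UNIV. (LINT \<omega>|M. g \<omega> t * L \<omega> t) - (if {..<t} = {} then 0 else LINT \<omega>|M. g \<omega> t * L \<omega> (Max {..<t})))"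
    by (intro sum.cong) auto
  finally show "(LINT \<omega>|M. by_parts (g \<omega>) (L \<omega>)) =
      (\<Sum>t\<in>UNIV. (LINT \<omega>|M. g \<omega> t * L \<omega> t) - (if {..<t} = {} then 0 else LINT \<omega>|M. g \<omega> t * L \<omega> (Max {..<t})))" .
qed

text \<open>The uniform distribution on the unit interval.\<close>
abbreviation unit_unif :: "real measure" where "unit_unif \<equiv> uniform_measure lborel {0<..1}"

lemma unit_unif_prob: "prob_space unit_unif" "sets unit_unif = sets borel" "space unit_unif = UNIV"
  by (auto intro!: prob_space_uniform_measure)

lemma unit_unif_atMost:
  assumes "0 \<le> a" "a \<le> 1"
  shows "(LINT u|unit_unif. indicator {..a} u) = a"
proof -
  have "{0<..1} \<inter> {..a} = {0<..a}" using assms by auto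
  then have "measure unit_unif {..a} = a" using assms by (simp add: measure_uniform_measure)
  then show ?thesis by simp
qed

text \<open>The first time at which \<open>a\<close> reaches the level \<open>u\<close>, or the last time if it never does.\<close>
definition threshold :: "('n::{finite,linorder} \<Rightarrow> real) \<Rightarrow> real \<Rightarrow> 'n" where
  "threshold a u = Min {s. u \<le> a s \<or> s = Max UNIV}"

lemma threshold_le_iff: "threshold a u \<le> t \<longleftrightarrow> (\<exists>s\<le>t. u \<le> a s) \<or> t = Max UNIV"
proof -
  have ne: "{s. u \<le> a s \<or> s = Max UNIV} \<noteq> {}" by blast
  have "threshold a u \<le> t \<longleftrightarrow> (\<exists>s\<in>{s. u \<le> a s \<or> s = Max UNIV}. s \<le> t)"
    unfolding threshold_def by (rule Min_le_iff) (use ne in auto)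
  also have "\<dots> \<longleftrightarrow> (\<exists>s\<le>t. u \<le> a s) \<or> t = Max UNIV"
  proof -
    have "Max UNIV \<le> t \<longleftrightarrow> t = Max UNIV" by (metis Max_ge UNIV_I antisym finite order_refl)
    then show ?thesis by auto
  qed
  finally show ?thesis .
qed

lemma threshold_le_mono:
  assumes "\<And>s s'. s \<le> s' \<Longrightarrow> a s \<le> a s'" "a (Max UNIV) = 1" "u \<le> 1"
  shows "threshold a u \<le> t \<longleftrightarrow> u \<le> a t"
proof
  assume "threshold a u \<le> t"
  then consider s where "s \<le> t" "u \<le> a s" | "t = Max UNIV" unfolding threshold_le_iff by blast
  then show "u \<le> a t"
  proof cases
    case 1
    then show ?thesis using assms(1)[of s t] by simp
  qed (use assms in simp)
qed (auto simp: threshold_le_iff)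

lemma measurable_threshold:
  assumes [measurable]: "\<And>s. (\<lambda>z. a z s) \<in> borel_measurable M" "u \<in> borel_measurable M"
  shows "(\<lambda>z. threshold (a z) (u z)) \<in> M \<rightarrow>\<^sub>M count_space UNIV"
proof (rule measurable_count_space_le)
  fix t
  show "{z \<in> space M. threshold (a z) (u z) \<le> t} \<in> sets M"
    unfolding threshold_le_iff by measurable
qed

text \<open>Randomisation does not improve on the optimal value. Let \<open>A\<^sub>s\<close> be the conditional probability of
  \<open>\<tau>(X) \<le> s\<close> given \<open>Y\<close>. By causality it depends on \<open>Y\<close> up to time \<open>s\<close> only, so for each level \<open>u\<close> the
  first time at which \<open>A\<close> reaches \<open>u\<close> is a stopping time of \<open>Y\<close>. For \<open>u\<close> uniform on the unit interval
  its conditional distribution given \<open>Y\<close> is that of \<open>\<tau>(X)\<close>.\<close>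
lemma (in stopping) randomized_stopping:
  assumes f_borel [measurable]: "\<And>t. (\<lambda>x. f x t) \<in> borel_measurable borel"
    and pr: "prob_space \<pi>" and s\<pi>: "sets \<pi> = sets borel"
    and dP: "distr \<pi> borel snd = P" and c: "causal \<pi> snd fst" and \<tau>: "\<tau> \<in> ST"
  shows "stop_value f P \<le> (LINT \<omega>|\<pi>. f (snd \<omega>) (\<tau> (fst \<omega>)))"
proof -
  interpret \<pi>: prob_space \<pi> by fact
  interpret U: prob_space unit_unif by (rule unit_unif_prob)
  interpret U\<pi>: pair_sigma_finite unit_unif \<pi> ..
  have [measurable_cong]: "sets \<pi> = sets (borel \<Otimes>\<^sub>M borel)" using s\<pi> by (simp only: borel_prod)
  have sp: "space \<pi> = UNIV" using sets_eq_imp_space_eq[OF s\<pi>] by simp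
  have fstm: "fst \<in> borel_measurable \<pi>" and sndm: "snd \<in> borel_measurable \<pi>" by measurable
  note [measurable] = ST_measurable[OF \<tau>]
  define E where "E s = {\<omega> :: 'n path \<times> 'n path. \<tau> (fst \<omega>) \<le> s}" for s
  have E: "E s \<in> sets (gen_by fst {..s})" for s
  proof -
    obtain B where "{x. \<tau> x \<le> s} = keep {..s} -` B" "B \<in> sets borel"
      using stopping_le_sets[OF \<tau>, of s] unfolding canon_filt_def sets_gen_by_eq by auto
    then show ?thesis unfolding sets_gen_by_eq E_def by (auto intro!: exI[of _ B])
  qed
  have Em [measurable]: "E s \<in> sets \<pi>" for s
    using E[of s] subalgebra_gen_by[OF fstm sp] by (auto simp: subalgebra_def)
  have iE: "integrable \<pi> (indicator (E s) :: _ \<Rightarrow> real)" for s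
    by (intro integrable_real_indicator) (auto simp: less_top[symmetric])
  interpret G: sigma_finite_subalgebra \<pi> "gen_by snd S" for S by (rule sigma_finite_gen_by; fact)
  define A where "A s = real_cond_exp \<pi> (gen_by snd {..s}) (indicator (E s))" for s
  define AU where "AU s = real_cond_exp \<pi> (gen_by snd UNIV) (indicator (E s))" for s
  have A_AU: "AE \<omega> in \<pi>. \<forall>s. A s \<omega> = AU s \<omega>"
  proof (intro AE_finite_allI[of UNIV, simplified])
    fix s
    have "AE \<omega> in \<pi>. AU s \<omega> = A s \<omega>"
      using c E[of s] unfolding causal_iff A_def AU_def by blast
    then show "AE \<omega> in \<pi>. A s \<omega> = AU s \<omega>" by eventually_elim simp
  qed auto
  have Ac: "AE \<omega> in \<pi>. AU (Max UNIV) \<omega> = 1"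
  proof -
    have "indicator (E (Max UNIV)) = (\<lambda>\<omega>. 1::real)" by (auto simp: E_def fun_eq_iff)
    then show ?thesis using G.real_cond_exp_F_meas[of "\<lambda>\<omega>. 1" UNIV] by (simp add: AU_def)
  qed
  have A0: "AE \<omega> in \<pi>. \<forall>s. 0 \<le> AU s \<omega>"
  proof (intro AE_finite_allI[of UNIV, simplified])
    fix s show "AE \<omega> in \<pi>. 0 \<le> AU s \<omega>" unfolding AU_def by (rule G.real_cond_exp_pos) auto
  qed auto
  have Am: "AE \<omega> in \<pi>. \<forall>s s'. s \<le> s' \<longrightarrow> AU s \<omega> \<le> AU s' \<omega>"
  proof (intro AE_finite_allI[of UNIV, simplified])
    fix s s' :: 'n
    have "AE \<omega> in \<pi>. AU s \<omega> \<le> AU s' \<omega>" if "s \<le> s'"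
      unfolding AU_def using that iE by (intro G.real_cond_exp_mono) (auto simp: E_def indicator_def)
    then show "AE \<omega> in \<pi>. s \<le> s' \<longrightarrow> AU s \<omega> \<le> AU s' \<omega>" by (cases "s \<le> s'") auto
  qed auto
  have good: "AE \<omega> in \<pi>. (\<forall>s. 0 \<le> A s \<omega>) \<and> (\<forall>s s'. s \<le> s' \<longrightarrow> A s \<omega> \<le> A s' \<omega>) \<and> A (Max UNIV) \<omega> = 1"
    using A_AU Ac A0 Am by eventually_elim simp
  have Ameas0: "A s \<in> borel_measurable (gen_by snd {..s})" for s unfolding A_def by simp
  have [measurable]: "A s \<in> borel_measurable \<pi>" for s unfolding A_def by simp
  \<comment> \<open>Since \<open>A s\<close> is determined by the second component of \<open>\<omega>\<close>, any value of the first one will do.\<close>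
  define a where "a y s = A s (0, y)" for y s
  have Aa: "A s \<omega> = a (snd \<omega>) s" for s \<omega>
    unfolding a_def by (rule gen_by_determined[OF Ameas0]) simp
  have am: "(\<lambda>y. a y s) \<in> borel_measurable (canon_filt s)" for s
    unfolding a_def canon_filt_def
    by (rule measurable_compose[OF measurable_into_gen_by Ameas0]) (simp add: measurable_gen_by_nth)
  have am' [measurable]: "(\<lambda>y. a y s) \<in> borel_measurable borel" for s
    using am[of s] canon_filt_borel by (auto simp: measurable_def)
  have \<sigma>: "(\<lambda>y. threshold (a y) u) \<in> ST" for u
  proof (rule STI)
    fix t
    have "{y. u \<le> a y s} \<in> sets (canon_filt t)" if "s \<le> t" for s
    proof -
      have "{y \<in> space (canon_filt s). u \<le> a y s} \<in> sets (canon_filt s)" using am[of s] by measurable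
      then show ?thesis using canon_filt_mono[OF that] by auto
    qed
    then have "(\<Union>s\<in>{..t}. {y. u \<le> a y s}) \<in> sets (canon_filt t)" by (intro sets.finite_UN) auto
    moreover have "{y. threshold (a y) u \<le> t} = (if t = Max UNIV then UNIV else (\<Union>s\<in>{..t}. {y. u \<le> a y s}))"
      unfolding threshold_le_iff by auto
    moreover have "UNIV \<in> sets (canon_filt t)" using sets.top[of "canon_filt t"] by simp
    ultimately show "{y. threshold (a y) u \<le> t} \<in> sets (canon_filt t)" by (cases "t = Max UNIV") simp_all
  qed
  have ft: "integrable \<pi> (\<lambda>\<omega>. f (snd \<omega>) t)" for t
    using integrable_f[of t] integrable_distr_eq[OF sndm f_borel[of t]] by (simp add: dP)
  let ?F = "\<lambda>\<omega>. \<Sum>t\<in>UNIV. \<bar>f (snd \<omega>) t\<bar>"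
  have iF: "integrable \<pi> ?F" using ft by auto
  let ?g = "\<lambda>(u, \<omega>). f (snd \<omega>) (threshold (a (snd \<omega>)) u)"
  have gm: "?g \<in> borel_measurable (unit_unif \<Otimes>\<^sub>M \<pi>)"
  proof -
    have 1: "(\<lambda>z. threshold (a (snd (snd z))) (fst z)) \<in> (unit_unif \<Otimes>\<^sub>M \<pi>) \<rightarrow>\<^sub>M count_space UNIV"
      by (rule measurable_threshold) auto
    have "(\<lambda>z. f (snd (snd z)) (threshold (a (snd (snd z))) (fst z))) \<in> borel_measurable (unit_unif \<Otimes>\<^sub>M \<pi>)"
      by (rule measurable_compose_countable'[OF _ 1]) (auto simp: countable_finite)
    then show ?thesis by (simp add: split_beta')
  qed
  have gi: "integrable (unit_unif \<Otimes>\<^sub>M \<pi>) ?g"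
  proof (rule Bochner_Integration.integrable_bound[OF _ gm])
    show "integrable (unit_unif \<Otimes>\<^sub>M \<pi>) (\<lambda>z. ?F (snd z))"
      by (rule U\<pi>.Fubini_integrable) (use iF in simp_all)
    show "AE z in unit_unif \<Otimes>\<^sub>M \<pi>. norm (?g z) \<le> norm (?F (snd z))"
    proof (rule AE_I2)
      fix z :: "real \<times> 'n path \<times> 'n path"
      have "\<bar>f (snd (snd z)) (threshold (a (snd (snd z))) (fst z))\<bar> \<le> ?F (snd z)"
        by (rule member_le_sum) auto
      then show "norm (?g z) \<le> norm (?F (snd z))" by (simp only: split_beta' real_norm_def)
    qed
  qed
  have "stop_value f P \<le> (LINT \<omega>|\<pi>. f (snd \<omega>) (threshold (a (snd \<omega>)) u))" for u
  proof -
    have "stop_value f P \<le> (LINT y|P. f y (threshold (a y) u))"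
      by (rule stop_value_le[OF \<sigma>[of u], unfolded J_def])
    also have "\<dots> = (LINT \<omega>|\<pi>. f (snd \<omega>) (threshold (a (snd \<omega>)) u))"
    proof -
      have "(\<lambda>y. f y (threshold (a y) u)) \<in> borel_measurable borel"
        using f_tau_meas[OF ST_P[OF \<sigma>[of u]]] measurable_cong_sets[OF sets_P refl] by blast
      from integral_distr[OF sndm this] show ?thesis by (simp add: dP)
    qed
    finally show ?thesis .
  qed
  then have "(LINT u|unit_unif. stop_value f P) \<le> (LINT u|unit_unif. LINT \<omega>|\<pi>. f (snd \<omega>) (threshold (a (snd \<omega>)) u))"
    using U\<pi>.integrable_fst[OF gi] by (intro integral_mono) auto
  also have "(LINT u|unit_unif. stop_value f P) = stop_value f P" by (simp add: U.prob_space)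
  also have "(LINT u|unit_unif. LINT \<omega>|\<pi>. f (snd \<omega>) (threshold (a (snd \<omega>)) u))
     = (LINT \<omega>|\<pi>. LINT u|unit_unif. f (snd \<omega>) (threshold (a (snd \<omega>)) u))"
    by (rule U\<pi>.Fubini_integral[symmetric]) (rule gi)
  also have "\<dots> = (LINT \<omega>|\<pi>. by_parts (f (snd \<omega>)) (\<lambda>s. A s \<omega>))"
  proof (rule integral_cong_AE)
    show "(\<lambda>\<omega>. LINT u|unit_unif. f (snd \<omega>) (threshold (a (snd \<omega>)) u)) \<in> borel_measurable \<pi>"
      using U\<pi>.integrable_snd[OF gi] by auto
    show "(\<lambda>\<omega>. by_parts (f (snd \<omega>)) (\<lambda>s. A s \<omega>)) \<in> borel_measurable \<pi>"
      unfolding by_parts_def by (intro borel_measurable_sum) (auto split: if_splits)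
    show "AE \<omega> in \<pi>. (LINT u|unit_unif. f (snd \<omega>) (threshold (a (snd \<omega>)) u)) = by_parts (f (snd \<omega>)) (\<lambda>s. A s \<omega>)"
      using good
    proof eventually_elim
      case (elim \<omega>)
      let ?a = "a (snd \<omega>)"
      have mono: "\<And>s s'. s \<le> s' \<Longrightarrow> ?a s \<le> ?a s'" and top: "?a (Max UNIV) = 1" and pos: "\<And>s. 0 \<le> ?a s"
        using elim unfolding Aa by auto
      have le1: "?a s \<le> 1" for s using mono[of s "Max UNIV"] top by auto
      have ind: "AE u in unit_unif. (\<forall>s. (if threshold ?a u \<le> s then 1 else 0) = (indicator {..?a s} u :: real))"
        by (rule AE_uniform_measureI) (use threshold_le_mono[of ?a, OF mono top] in \<open>auto simp: indicator_def\<close>)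
      have ii: "integrable unit_unif (\<lambda>u. indicator {..r} u :: real)" for r
        by (rule U.integrable_const_bound[of _ 1]) (auto simp: indicator_def)
      have [measurable]: "threshold ?a \<in> unit_unif \<rightarrow>\<^sub>M count_space UNIV"
        using measurable_threshold[of "\<lambda>_. ?a" unit_unif "\<lambda>u. u"] by simp
      have "(LINT u|unit_unif. f (snd \<omega>) (threshold ?a u)) = (LINT u|unit_unif. by_parts (f (snd \<omega>)) (\<lambda>s. indicator {..?a s} u))"
      proof (rule integral_cong_AE)
        show "AE u in unit_unif. f (snd \<omega>) (threshold ?a u) = by_parts (f (snd \<omega>)) (\<lambda>s. indicator {..?a s} u)"
          using ind
        proof eventually_elim
          case (elim u)
          then have "(\<lambda>s. if threshold ?a u \<le> s then 1 else 0) = (\<lambda>s. indicator {..?a s} u :: real)" by (intro ext) blast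
          then show ?case using by_parts_step[of "f (snd \<omega>)" "threshold ?a u"] by simp
        qed
        show "(\<lambda>u. by_parts (f (snd \<omega>)) (\<lambda>s. indicator {..?a s} u)) \<in> borel_measurable unit_unif"
          unfolding by_parts_def by (intro borel_measurable_sum) (auto split: if_splits)
      qed auto
      also have "\<dots> = by_parts (f (snd \<omega>)) ?a"
      proof -
        have 1: "integrable unit_unif (\<lambda>u. f (snd \<omega>) t * indicator {..?a s} u)" for t s using ii by simp
        have 2: "(LINT u|unit_unif. f (snd \<omega>) t * indicator {..?a s} u) = f (snd \<omega>) t * ?a s" for t s
          by (subst integral_mult_right_zero) (simp only: unit_unif_atMost[OF pos le1])
        have "(LINT u|unit_unif. by_parts (f (snd \<omega>)) (\<lambda>s. indicator {..?a s} u)) = (\<Sum>t\<in>UNIV.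
             (LINT u|unit_unif. f (snd \<omega>) t * indicator {..?a t} u) -
             (if {..<t} = {} then 0 else LINT u|unit_unif. f (snd \<omega>) t * indicator {..?a (Max {..<t})} u))"
          by (rule by_parts_integral(2)) (rule 1)
        also have "\<dots> = by_parts (f (snd \<omega>)) ?a"
          unfolding by_parts_def 2 by (intro sum.cong refl) (simp add: right_diff_distrib)
        finally show ?thesis .
      qed
      finally show ?case unfolding Aa .
    qed
  qed
  also have "\<dots> = (LINT \<omega>|\<pi>. by_parts (f (snd \<omega>)) (\<lambda>s. indicator (E s) \<omega>))"
  proof -
    have fE: "integrable \<pi> (\<lambda>\<omega>. f (snd \<omega>) t * indicator (E s) \<omega>)" for t s
      using integrable_mult_indicator[OF Em ft] by (simp add: mult.commute)
    have fU: "(\<lambda>\<omega>. f (snd \<omega>) t) \<in> borel_measurable (gen_by snd UNIV)" for t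
      by (rule measurable_compose[OF measurable_gen_by_UNIV]) simp
    have ae: "AE \<omega> in \<pi>. f (snd \<omega>) t * AU s \<omega> = f (snd \<omega>) t * A s \<omega>" for t s
      using A_AU by eventually_elim simp
    have i1: "integrable \<pi> (\<lambda>\<omega>. f (snd \<omega>) t * AU s \<omega>)"
      and i2: "(LINT \<omega>|\<pi>. f (snd \<omega>) t * AU s \<omega>) = (LINT \<omega>|\<pi>. f (snd \<omega>) t * indicator (E s) \<omega>)" for t s
      unfolding AU_def by (intro G.real_cond_exp_intg fE fU; simp)+
    have [measurable]: "AU s \<in> borel_measurable \<pi>" for s unfolding AU_def by simp
    have j1: "integrable \<pi> (\<lambda>\<omega>. f (snd \<omega>) t * A s \<omega>)" for t s
      by (rule integrable_cong_AE_imp[OF i1 _ ae]) simp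
    have j2: "(LINT \<omega>|\<pi>. f (snd \<omega>) t * A s \<omega>) = (LINT \<omega>|\<pi>. f (snd \<omega>) t * indicator (E s) \<omega>)" for t s
      unfolding i2[symmetric] by (rule integral_cong_AE) (use ae[of t s] in auto)
    show ?thesis using j1 fE by (simp add: by_parts_integral j2 cong: if_cong)
  qed
  also have "\<dots> = (LINT \<omega>|\<pi>. f (snd \<omega>) (\<tau> (fst \<omega>)))"
  proof (rule Bochner_Integration.integral_cong[OF refl])
    fix \<omega>
    have "(\<lambda>s. indicator (E s) \<omega>) = (\<lambda>s. if \<tau> (fst \<omega>) \<le> s then 1 else (0::real))"
      by (auto simp: E_def indicator_def)
    then show "by_parts (f (snd \<omega>)) (\<lambda>s. indicator (E s) \<omega>) = f (snd \<omega>) (\<tau> (fst \<omega>))"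
      using by_parts_step[of "f (snd \<omega>)" "\<tau> (fst \<omega>)"] by simp
  qed
  finally show ?thesis .
qed

section \<open>The independent coupling and the first-order coefficient\<close>

lemma powr_le_self: "0 \<le> v \<Longrightarrow> v \<le> 1 \<Longrightarrow> 1 \<le> p \<Longrightarrow> v powr p \<le> (v::real)"
  using powr_mono'[of 1 p v] by (cases "v = 0") auto

lemma convex_abs_powr:
  assumes p: "1 \<le> (p::real)"
  shows "convex_on UNIV (\<lambda>x::real. \<bar>x\<bar> powr p)"
proof (rule convex_onI)
  fix t x y :: real assume t: "0 < t" "t < 1"
  let ?a = "\<bar>x\<bar>" and ?b = "\<bar>y\<bar>"
  have "\<bar>(1 - t) *\<^sub>R x + t *\<^sub>R y\<bar> \<le> (1 - t) * ?a + t * ?b"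
    using t abs_triangle_ineq[of "(1 - t) * x" "t * y"] by (simp add: abs_mult)
  then have "\<bar>(1 - t) *\<^sub>R x + t *\<^sub>R y\<bar> powr p \<le> ((1 - t) * ?a + t * ?b) powr p"
    using p by (intro powr_mono2) auto
  also have "\<dots> \<le> (1 - t) * ?a powr p + t * ?b powr p"
  proof -
    consider "x = 0" | "y = 0" | "?a > 0" "?b > 0" by auto
    then show ?thesis
    proof cases
      case 1
      then show ?thesis using t p powr_le_self[of t p] by (simp add: powr_mult mult_right_mono)
    next
      case 2
      then show ?thesis using t p powr_le_self[of "1 - t" p] by (simp add: powr_mult mult_right_mono)
    next
      case 3
      then show ?thesis using convex_onD[OF powr_convex[OF p], of t ?a ?b] t by simp
    qed
  qed
  finally show "\<bar>(1 - t) *\<^sub>R x + t *\<^sub>R y\<bar> powr p \<le> (1 - t) * \<bar>x\<bar> powr p + t * \<bar>y\<bar> powr p" .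
qed simp

text \<open>The product measure is a coupling; its \<open>\<sigma>\<close>-algebra is the Borel algebra of the product space.\<close>
lemma pair_measure_paths:
  fixes P Q :: "'n::{finite, linorder} path measure"
  assumes P: "prob_space P" "sets P = sets borel" and Q: "prob_space Q" "sets Q = sets borel"
  shows "prob_space (P \<Otimes>\<^sub>M Q)" "sets (P \<Otimes>\<^sub>M Q) = sets borel" "space (P \<Otimes>\<^sub>M Q) = UNIV"
    and "distr (P \<Otimes>\<^sub>M Q) borel fst = P" "distr (P \<Otimes>\<^sub>M Q) borel snd = Q"
    and "\<And>A B. A \<in> sets borel \<Longrightarrow> B \<in> sets borel \<Longrightarrow> measure (P \<Otimes>\<^sub>M Q) (A \<times> B) = measure P A * measure Q B"
proof -
  interpret P: prob_space P by fact
  interpret Q: prob_space Q by fact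
  interpret PQ: pair_prob_space P Q ..
  show "prob_space (P \<Otimes>\<^sub>M Q)" by (rule PQ.prob_space_axioms)
  show s: "sets (P \<Otimes>\<^sub>M Q) = sets borel"
    using sets_pair_measure_cong[OF P(2) Q(2)] by (simp only: borel_prod)
  show "space (P \<Otimes>\<^sub>M Q) = UNIV" using sets_eq_imp_space_eq[OF s] by simp
  show m: "measure (P \<Otimes>\<^sub>M Q) (A \<times> B) = measure P A * measure Q B" if "A \<in> sets borel" "B \<in> sets borel" for A B
    using that P(2) Q(2) by (simp add: measure_def Q.emeasure_pair_measure_Times enn2real_mult)
  have mf: "fst \<in> P \<Otimes>\<^sub>M Q \<rightarrow>\<^sub>M borel" "snd \<in> P \<Otimes>\<^sub>M Q \<rightarrow>\<^sub>M borel"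
    using measurable_fst[of P Q] measurable_snd[of P Q] measurable_cong_sets[OF refl P(2)] measurable_cong_sets[OF refl Q(2)] by auto
  show "distr (P \<Otimes>\<^sub>M Q) borel fst = P"
    using Q.distr_pair_fst[of P] distr_cong[OF refl P(2), of "P \<Otimes>\<^sub>M Q" fst fst] by simp
  have sp: "space P = UNIV" using sets_eq_imp_space_eq[OF P(2)] by simp
  show "distr (P \<Otimes>\<^sub>M Q) borel snd = Q"
  proof (rule measure_eqI)
    fix A assume "A \<in> sets (distr (P \<Otimes>\<^sub>M Q) borel snd)"
    then have A: "A \<in> sets borel" by simp
    have "snd -` A \<inter> space (P \<Otimes>\<^sub>M Q) = UNIV \<times> A"
      using sets_eq_imp_space_eq[OF s] by auto
    moreover have "emeasure (P \<Otimes>\<^sub>M Q) (UNIV \<times> A) = emeasure P UNIV * emeasure Q A"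
      using A P(2) Q(2) by (intro Q.emeasure_pair_measure_Times) auto
    moreover have "emeasure P UNIV = 1" using P.emeasure_space_1 sp by simp
    ultimately show "emeasure (distr (P \<Otimes>\<^sub>M Q) borel snd) A = emeasure Q A"
      using A by (simp add: emeasure_distr[OF mf(2)])
  qed (simp add: Q)
qed

lemma independent_causal:
  assumes \<pi>: "prob_space \<pi>" "space \<pi> = UNIV" and X: "X \<in> borel_measurable \<pi>" and Y: "Y \<in> borel_measurable \<pi>"
    and ind: "\<And>A E. A \<in> sets (gen_by X UNIV) \<Longrightarrow> E \<in> sets (gen_by Y UNIV) \<Longrightarrow> measure \<pi> (A \<inter> E) = measure \<pi> A * measure \<pi> E"
  shows "causal \<pi> X Y"
proof (rule causalI[OF \<pi> X Y])
  interpret prob_space \<pi> by fact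
  fix t E assume E: "E \<in> sets (gen_by Y {..t})"
  show "\<exists>h \<in> borel_measurable (gen_by X {..t}). integrable \<pi> h \<and>
       (\<forall>B \<in> sets (gen_by X UNIV). (LINT \<omega>:B|\<pi>. indicator E \<omega>) = (LINT \<omega>:B|\<pi>. (h \<omega> :: real)))"
  proof (intro bexI[of _ "\<lambda>_. measure \<pi> E"] conjI ballI)
    fix A assume A: "A \<in> sets (gen_by X UNIV)"
    have "(LINT \<omega>:A|\<pi>. indicator E \<omega>) = (LINT \<omega>|\<pi>. indicator (A \<inter> E) \<omega> :: real)"
      unfolding set_lebesgue_integral_def by (intro Bochner_Integration.integral_cong refl) (auto simp: indicator_def)
    also have "\<dots> = measure \<pi> A * measure \<pi> E" using ind[OF A] E gen_by_mono[of "{..t}" UNIV Y] \<pi>(2) by auto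
    finally show "(LINT \<omega>:A|\<pi>. indicator E \<omega>) = (LINT \<omega>:A|\<pi>. measure \<pi> E)"
      using \<pi>(2) by (simp add: set_lebesgue_integral_def)
  qed auto
qed

text \<open>In particular the infimum in the adapted Wasserstein distance is over a nonempty set, so a
  distance below \<open>B\<close> is witnessed by a coupling.\<close>
lemma product_bicausal:
  fixes P Q :: "'n::{finite, linorder} path measure"
  assumes P: "prob_space P" "sets P = sets borel" and Q: "prob_space Q" "sets Q = sets borel"
  shows "P \<Otimes>\<^sub>M Q \<in> bicausal_couplings P Q"
proof -
  note aux = pair_measure_paths[OF P Q]
  note mf = measurable_fst_snd[OF aux(2)]
  have one: "measure P UNIV = 1" "measure Q UNIV = 1"
    using prob_space.prob_space[OF P(1)] prob_space.prob_space[OF Q(1)]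
      sets_eq_imp_space_eq[OF P(2)] sets_eq_imp_space_eq[OF Q(2)] by auto
  have ind: "measure (P \<Otimes>\<^sub>M Q) (A \<inter> E) = measure (P \<Otimes>\<^sub>M Q) A * measure (P \<Otimes>\<^sub>M Q) E"
    if "A \<in> sets (gen_by fst UNIV)" "E \<in> sets (gen_by snd UNIV)" for A E
  proof -
    have vim: "(\<lambda>\<omega>. keep UNIV (fst \<omega>)) -` B = B \<times> UNIV" "(\<lambda>\<omega>. keep UNIV (snd \<omega>)) -` B = UNIV \<times> B"
      for B :: "'n path set" by auto
    from that obtain B C where "A = B \<times> UNIV" "E = UNIV \<times> C" "B \<in> sets borel" "C \<in> sets borel"
      unfolding sets_gen_by_eq vim by auto
    then show ?thesis by (simp add: aux(6) one Times_Int_Times)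
  qed
  have "causal (P \<Otimes>\<^sub>M Q) fst snd" by (rule independent_causal[OF aux(1,3) mf ind])
  moreover have "causal (P \<Otimes>\<^sub>M Q) snd fst"
  proof (rule independent_causal[OF aux(1,3) mf(2,1)])
    fix A E :: "('n path \<times> 'n path) set"
    assume "A \<in> sets (gen_by snd UNIV)" "E \<in> sets (gen_by fst UNIV)"
    from ind[OF this(2,1)] show "measure (P \<Otimes>\<^sub>M Q) (A \<inter> E) = measure (P \<Otimes>\<^sub>M Q) A * measure (P \<Otimes>\<^sub>M Q) E"
      by (simp add: Int_commute mult.commute)
  qed
  ultimately show ?thesis using aux unfolding bicausal_couplings_def couplings_def by auto
qed

context integrand
begin

lemma f_wass_int: "Q \<in> wass_space p \<Longrightarrow> integrable Q (\<lambda>x. f x t)"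
proof -
  assume Q: "Q \<in> wass_space p"
  obtain K where "K > 0" "\<And>x t. \<bar>f x t\<bar> \<le> K * (1 + norm x powr p)" using f_growth by blast
  then show ?thesis by (intro wass_integrable[OF Q meas_f])
qed

lemma stopping_wass: "Q \<in> wass_space p \<Longrightarrow> stopping Q f"
  using f_wass_int[of Q] wass_spaceD(1,2)[of Q p] by (simp add: stopping_def stopping_axioms_def)

end

text \<open>The cost function together with a law \<open>P\<close> and an optimal stopping time \<open>\<tau>o\<close> for it, not necessarily unique.\<close>
locale sensitivity = integrand p c f + stopping P f
  for p q c :: real and f :: "'n::{finite, linorder} path \<Rightarrow> 'n \<Rightarrow> real" and P :: "'n path measure" +
  fixes \<tau>o :: "'n path \<Rightarrow> 'n"
  assumes q: "q = p / (p - 1)" and P_wass: "P \<in> wass_space p"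
    and \<tau>o: "\<tau>o \<in> ST" and opt: "stop_value f P = J \<tau>o"
begin

text \<open>The gradient of the cost at the optimal stopping time.\<close>
definition g :: "'n \<Rightarrow> 'n path \<Rightarrow> real" where "g s x = D s x (\<tau>o x)"

text \<open>The partial derivative in coordinate \<open>s\<close>, conditioned on the path up to time \<open>s\<close>.\<close>
definition G :: "'n \<Rightarrow> 'n path \<Rightarrow> real" where "G s = real_cond_exp P (canon_filt s) (g s)"

text \<open>The coefficient of \<open>r\<close> in the expansion.\<close>
definition slope :: real where "slope = (\<Sum>s\<in>UNIV. LINT x|P. \<bar>G s x\<bar> powr q) powr (1 / q)"

lemmas pq = conj_exponent[OF p q]

lemma space_P: "space P = UNIV" using sets_eq_imp_space_eq[OF sets_P] by simp

lemma f_tau_borel: "\<tau> \<in> ST \<Longrightarrow> (\<lambda>x. f x (\<tau> x)) \<in> borel_measurable borel"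
  by (rule measurable_compose_countable'[OF _ ST_measurable]) (auto simp: countable_finite)

lemma g_meas [measurable]: "g s \<in> borel_measurable borel"
  unfolding g_def[abs_def]
  by (rule measurable_compose_countable'[OF _ ST_measurable[OF \<tau>o]]) (auto simp: countable_finite)

lemma D_powr_bound: "\<bar>D s x t\<bar> powr q \<le> K0 powr q * (1 + norm x) powr p"
proof -
  have "\<bar>D s x t\<bar> powr q \<le> (K0 * (1 + norm x) powr (p - 1)) powr q"
    using D_growth1[of s x t] pq by (intro powr_mono2) auto
  also have "\<dots> = K0 powr q * (1 + norm x) powr p" using K0_pos pq by (simp add: powr_mult powr_powr)
  finally show ?thesis .
qed

lemma D_int: "integrable P (\<lambda>x. D s x t)"
proof (rule wass_integrable_plus[OF P_wass, where K = K0])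
  fix x :: "'n path"
  have "(1 + norm x) powr (p - 1) \<le> (1 + norm x) powr p" using p by (intro powr_mono) auto
  then show "\<bar>D s x t\<bar> \<le> K0 * (1 + norm x) powr p"
    using D_growth1[of s x t] K0_pos by (meson mult_left_mono less_imp_le order_trans)
qed (use p K0_pos in auto)

lemma g_int: "integrable P (g s)" 
  unfolding g_def[abs_def] by (rule integrable_select[OF D_int ST_P[OF \<tau>o]])

lemma g_powr_int: "integrable P (\<lambda>x. \<bar>g s x\<bar> powr q)"
proof (rule wass_integrable_plus[OF P_wass, where K = "K0 powr q"])
  show "\<bar>\<bar>g s x\<bar> powr q\<bar> \<le> K0 powr q * (1 + norm x) powr p" for x
    using D_powr_bound by (simp add: g_def)
qed (use p in auto)

lemma sub_canon: "sigma_finite_subalgebra P (canon_filt s)"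
  unfolding canon_filt_def
  by (rule sigma_finite_gen_by) (use prob_space_axioms space_P measurable_cong_sets[OF sets_P refl] in auto)

lemma G_filt: "G s \<in> borel_measurable (canon_filt s)" unfolding G_def by simp

lemma G_meas [measurable]: "G s \<in> borel_measurable borel"
  using measurable_from_subalg[OF sigma_finite_subalgebra.subalg[OF sub_canon] G_filt] measurable_cong_sets[OF sets_P refl] by blast

lemma G_int: "integrable P (G s)"
  unfolding G_def by (rule sigma_finite_subalgebra.real_cond_exp_int(1)[OF sub_canon g_int])

lemma G_powr_int: "integrable P (\<lambda>x. \<bar>G s x\<bar> powr q)"
  unfolding G_def
  by (rule sigma_finite_subalgebra.integrable_convex_cond_exp[OF sub_canon g_int, where I = UNIV and a = 0 and b = 0 and q = "\<lambda>x. \<bar>x\<bar> powr q"])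
    (use g_powr_int convex_abs_powr[of q] pq in auto)

lemma slope_nonneg: "slope \<ge> 0" by (simp add: slope_def)

lemma slope_powr: "(\<Sum>s\<in>UNIV. LINT x|P. \<bar>G s x\<bar> powr q) = slope powr q"
proof -
  have "0 \<le> (\<Sum>s\<in>UNIV. LINT x|P. \<bar>G s x\<bar> powr q)" by (intro sum_nonneg integral_nonneg_AE) auto
  then show ?thesis using pq by (simp add: slope_def powr_powr)
qed

end

section \<open>Upper bound\<close>

lemma adapted_wass_coupling:
  fixes P Q :: "'n::{finite,linorder} path measure"
  assumes P: "P \<in> wass_space p" and Q: "Q \<in> wass_space p" and p: "p > 0"
    and less: "adapted_wass p P Q < B" and B: "B > 0"
  shows "\<exists>\<pi>\<in>bicausal_couplings P Q. transport_cost p \<pi> \<le> B powr p"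
proof -
  let ?C = "transport_cost p"
  have "bicausal_couplings P Q \<noteq> {}"
    using product_bicausal[OF wass_spaceD(1,2)[OF P] wass_spaceD(1,2)[OF Q]] by auto
  then have "\<exists>x\<in>(\<lambda>\<pi>. ?C \<pi> powr (1 / p)) ` bicausal_couplings P Q. x < B"
    using less unfolding adapted_wass_def by (intro cInf_lessD) auto
  then obtain \<pi> where \<pi>: "\<pi> \<in> bicausal_couplings P Q" "?C \<pi> powr (1 / p) < B" by blast
  have C0: "0 \<le> ?C \<pi>" by (intro sum_nonneg integral_nonneg_AE) auto
  have "(?C \<pi> powr (1 / p)) powr p \<le> B powr p" using \<pi>(2) p by (intro powr_mono2) auto
  then have "?C \<pi> \<le> B powr p" using C0 p by (simp add: powr_powr)
  then show ?thesis using \<pi>(1) by blast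
qed

context sensitivity
begin

text \<open>
  The first-order upper bound along one bicausal coupling. Any \<open>\<delta> > 0\<close> makes the bound
  \<open>slope + \<delta>\<close> in Hoelder's inequality strictly positive.
\<close>
lemma upper_coupling:
  assumes \<pi>: "\<pi> \<in> bicausal_couplings P Q" and Q: "Q \<in> wass_space p"
    and B: "0 < B" "transport_cost p \<pi> \<le> B powr p"
    and V: "integrable \<pi> V" "\<And>x y t. \<bar>taylor_rem x y t\<bar> \<le> V (x, y)" and \<delta>: "\<delta> > 0"
  shows "stop_value f Q \<le> stop_value f P + (slope + \<delta>) * B + (LINT \<omega>|\<pi>. V \<omega>)"
proof -
  have pc: "\<pi> \<in> couplings P Q" and cau: "causal \<pi> fst snd" "causal \<pi> snd fst"
    using \<pi> by (auto simp: bicausal_couplings_def)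
  have pr: "prob_space \<pi>" and s\<pi>: "sets \<pi> = sets borel" and dP: "distr \<pi> borel fst = P" and dQ: "distr \<pi> borel snd = Q"
    using pc by (auto simp: couplings_def)
  have sp: "space \<pi> = UNIV" using sets_eq_imp_space_eq[OF s\<pi>] by simp
  interpret \<pi>: prob_space \<pi> by fact
  interpret Q: stopping Q f by (rule stopping_wass[OF Q])
  note mf = measurable_fst_snd[OF s\<pi>]
  note Lp = coupling_Lp[OF pc P_wass Q]
  have p0: "p > 0" using p by simp
  have fstI: "integrable \<pi> (\<lambda>\<omega>. h (fst \<omega>))" and fstE: "(LINT \<omega>|\<pi>. h (fst \<omega>)) = (LINT x|P. h x)"
    if "h \<in> borel_measurable borel" "integrable P h" for h :: "'n path \<Rightarrow> real"
    using that integrable_distr_eq[OF mf(1) that(1)] integral_distr[OF mf(1) that(1)] by (auto simp: dP)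
  have fstM: "(\<lambda>\<omega>. h (fst \<omega>)) \<in> borel_measurable \<pi>" if "h \<in> borel_measurable borel" for h :: "'n path \<Rightarrow> real"
    by (rule measurable_compose[OF mf(1) that])
  have dm: "(\<lambda>\<omega>. fst \<omega> $ s) \<in> borel_measurable \<pi>" "(\<lambda>\<omega>. snd \<omega> $ s) \<in> borel_measurable \<pi>"
     "(\<lambda>\<omega>. snd \<omega> $ s - fst \<omega> $ s) \<in> borel_measurable \<pi>" for s
    using mf by (auto intro!: borel_measurable_diff borel_measurable_nth')
  have prodI: "integrable \<pi> (\<lambda>\<omega>. h (fst \<omega>) * d \<omega>)"
    if h: "h \<in> borel_measurable borel" "integrable P (\<lambda>x. \<bar>h x\<bar> powr q)"
      and d: "d \<in> borel_measurable \<pi>" "integrable \<pi> (\<lambda>\<omega>. \<bar>d \<omega>\<bar> powr p)" for h d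
  proof -
    have 1: "integrable \<pi> (\<lambda>\<omega>. \<bar>h (fst \<omega>)\<bar> powr q)" by (rule fstI) (use h in auto)
    let ?A = "((\<Sum>s\<in>(UNIV::'n set). LINT \<omega>|\<pi>. \<bar>h (fst \<omega>)\<bar> powr q) + 1)"
    let ?B = "((\<Sum>s\<in>(UNIV::'n set). LINT \<omega>|\<pi>. \<bar>d \<omega>\<bar> powr p) + 1)"
    have pos: "?A \<ge> 1" "?B \<ge> 1" by (auto intro!: sum_nonneg integral_nonneg_AE)
    have "0 \<le> (LINT \<omega>|\<pi>. \<bar>h (fst \<omega>)\<bar> powr q)" "0 \<le> (LINT \<omega>|\<pi>. \<bar>d \<omega>\<bar> powr p)" by (auto intro!: integral_nonneg_AE)
    then have pos': "0 < real CARD('n) * (LINT \<omega>|\<pi>. \<bar>h (fst \<omega>)\<bar> powr q) + 1" "0 < real CARD('n) * (LINT \<omega>|\<pi>. \<bar>d \<omega>\<bar> powr p) + 1"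
      by (auto intro!: add_nonneg_pos)
    have "r - 1 \<le> r powr k" if "1 \<le> r" "1 < k" for r k :: real
      using powr_mono[of 1 k r] that by simp
    from this[OF pos(1) pq(1)] this[OF pos(2) p]
    show ?thesis
      by (intro Holder_sum(1)[where G = "\<lambda>s \<omega>. h (fst \<omega>)" and D = "\<lambda>s \<omega>. d \<omega>" and A = "?A" and B = "?B", OF p q])
        (use pos' 1 d fstM[OF h(1)] in auto)
  qed
  have gx: "integrable \<pi> (\<lambda>\<omega>. g s (fst \<omega>) * fst \<omega> $ s)" "integrable \<pi> (\<lambda>\<omega>. g s (fst \<omega>) * snd \<omega> $ s)"
    "integrable \<pi> (\<lambda>\<omega>. G s (fst \<omega>) * fst \<omega> $ s)" "integrable \<pi> (\<lambda>\<omega>. G s (fst \<omega>) * snd \<omega> $ s)"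
    "integrable \<pi> (\<lambda>\<omega>. G s (fst \<omega>) * (snd \<omega> $ s - fst \<omega> $ s))" for s
    by (intro prodI g_meas G_meas g_powr_int G_powr_int dm Lp p0;
        simp only: abs_minus_commute[of "snd _ $ _"] Lp(3)[OF p0])+
  \<comment> \<open>The part with \<open>X\<^sub>s\<close> is conditioning under \<open>P\<close>; the part with \<open>Y\<^sub>s\<close> uses causality from \<open>X\<close> to \<open>Y\<close>.\<close>
  have key: "(LINT \<omega>|\<pi>. g s (fst \<omega>) * (snd \<omega> $ s - fst \<omega> $ s)) = (LINT \<omega>|\<pi>. G s (fst \<omega>) * (snd \<omega> $ s - fst \<omega> $ s))" for s
  proof -
    have "(LINT \<omega>|\<pi>. fst \<omega> $ s * g s (fst \<omega>)) = (LINT x|P. x $ s * g s x)"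
      using integral_distr[OF mf(1), of "\<lambda>x. x $ s * g s x"] by (simp add: dP)
    also have "\<dots> = (LINT x|P. x $ s * G s x)"
      unfolding G_def
    proof (rule sigma_finite_subalgebra.real_cond_exp_intg(2)[OF sub_canon, symmetric])
      show "integrable P (\<lambda>x. x $ s * g s x)"
        using gx(1)[of s] integrable_distr_eq[OF mf(1), of "\<lambda>x. x $ s * g s x"] by (simp add: dP mult.commute)
      show "(\<lambda>x. x $ s) \<in> borel_measurable (canon_filt s)" unfolding canon_filt_def by (rule measurable_gen_by_nth) simp
      show "g s \<in> borel_measurable P" using g_int by auto
    qed
    also have "\<dots> = (LINT \<omega>|\<pi>. fst \<omega> $ s * G s (fst \<omega>))"
      using integral_distr[OF mf(1), of "\<lambda>x. x $ s * G s x"] by (simp add: dP)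
    finally have 1: "(LINT \<omega>|\<pi>. g s (fst \<omega>) * fst \<omega> $ s) = (LINT \<omega>|\<pi>. G s (fst \<omega>) * fst \<omega> $ s)" by (simp add: mult.commute)
    let ?e = "real_cond_exp \<pi> (gen_by fst {..s}) (\<lambda>\<omega>. g s (fst \<omega>))"
    have ae: "AE \<omega> in \<pi>. ?e \<omega> = G s (fst \<omega>)"
      using real_cond_exp_transfer[OF pr sp mf(1) dP[symmetric] g_int, of "{..s}"] by (simp add: G_def canon_filt_def)
    have Gm: "(\<lambda>\<omega>. G s (fst \<omega>)) \<in> borel_measurable \<pi>" by (rule fstM[OF G_meas])
    have em: "(\<lambda>\<omega>. snd \<omega> $ s * ?e \<omega>) \<in> borel_measurable \<pi>" using dm(2) by (intro borel_measurable_times) auto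
    have "(LINT \<omega>|\<pi>. snd \<omega> $ s * g s (fst \<omega>)) = (LINT \<omega>|\<pi>. snd \<omega> $ s * ?e \<omega>)"
    proof (rule causal_integral[OF pr sp mf cau(1)])
      show "(\<lambda>\<omega>. g s (fst \<omega>)) \<in> borel_measurable (gen_by fst UNIV)"
        by (rule measurable_compose[OF measurable_gen_by_UNIV g_meas])
      show "integrable \<pi> (\<lambda>\<omega>. g s (fst \<omega>))" by (rule fstI[OF g_meas g_int])
      show "(\<lambda>\<omega>. snd \<omega> $ s) \<in> borel_measurable (gen_by snd {..s})" by (rule measurable_gen_by_nth) simp
      show "integrable \<pi> (\<lambda>\<omega>. snd \<omega> $ s * g s (fst \<omega>))" using gx(2)[of s] by (simp add: mult.commute)
      show "integrable \<pi> (\<lambda>\<omega>. snd \<omega> $ s * ?e \<omega>)"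
        by (rule integrable_cong_AE_imp[OF gx(4)[of s] em]) (use ae in \<open>auto simp: mult.commute\<close>)
    qed
    also have "\<dots> = (LINT \<omega>|\<pi>. snd \<omega> $ s * G s (fst \<omega>))"
      by (rule integral_cong_AE[OF em]) (use ae Gm dm(2) in \<open>auto intro!: borel_measurable_times\<close>)
    finally have 2: "(LINT \<omega>|\<pi>. g s (fst \<omega>) * snd \<omega> $ s) = (LINT \<omega>|\<pi>. G s (fst \<omega>) * snd \<omega> $ s)" by (simp add: mult.commute)
    show ?thesis using 1 2 gx by (simp add: right_diff_distrib)
  qed
  have A: "(\<Sum>s\<in>UNIV. LINT \<omega>|\<pi>. \<bar>G s (fst \<omega>) * (snd \<omega> $ s - fst \<omega> $ s)\<bar>) \<le> (slope + \<delta>) * B"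
  proof (rule Holder_sum(2)[OF p q])
    show "integrable \<pi> (\<lambda>\<omega>. \<bar>G s (fst \<omega>)\<bar> powr q)" for s
      by (rule fstI[OF _ G_powr_int]) measurable
    have "(\<Sum>s\<in>UNIV. LINT \<omega>|\<pi>. \<bar>G s (fst \<omega>)\<bar> powr q) = (\<Sum>s\<in>UNIV. LINT x|P. \<bar>G s x\<bar> powr q)"
      by (intro sum.cong refl fstE G_powr_int) measurable
    also have "\<dots> = slope powr q" by (rule slope_powr)
    also have "\<dots> \<le> (slope + \<delta>) powr q" using slope_nonneg \<delta> pq by (intro powr_mono2) auto
    finally show "(\<Sum>s\<in>UNIV. LINT \<omega>|\<pi>. \<bar>G s (fst \<omega>)\<bar> powr q) \<le> (slope + \<delta>) powr q" .
    show "(\<Sum>s\<in>UNIV. LINT \<omega>|\<pi>. \<bar>snd \<omega> $ s - fst \<omega> $ s\<bar> powr p) \<le> B powr p"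
      using B(2) by (simp add: abs_minus_commute)
    show "integrable \<pi> (\<lambda>\<omega>. \<bar>snd \<omega> $ s - fst \<omega> $ s\<bar> powr p)" for s
      using Lp(3)[OF p0, of s] by (simp add: abs_minus_commute)
  qed (use slope_nonneg \<delta> B fstM[OF G_meas] dm in auto)
  have fY: "integrable \<pi> (\<lambda>\<omega>. f (fst \<omega>) (\<tau>o (fst \<omega>)))" "(LINT \<omega>|\<pi>. f (fst \<omega>) (\<tau>o (fst \<omega>))) = stop_value f P"
    using fstI[OF f_tau_borel[OF \<tau>o] f_tau_int[OF \<tau>o]] fstE[OF f_tau_borel[OF \<tau>o] f_tau_int[OF \<tau>o]] opt by (auto simp: J_def)
  have sI: "integrable \<pi> (\<lambda>\<omega>. \<Sum>s\<in>UNIV. g s (fst \<omega>) * (snd \<omega> $ s - fst \<omega> $ s))"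
    using gx by (simp add: right_diff_distrib)
  have "stop_value f Q \<le> (LINT \<omega>|\<pi>. f (snd \<omega>) (\<tau>o (fst \<omega>)))"
    by (rule Q.randomized_stopping[OF meas_f pr s\<pi> dQ cau(2) \<tau>o])
  also have "\<dots> \<le> (LINT \<omega>|\<pi>. f (fst \<omega>) (\<tau>o (fst \<omega>)) + (\<Sum>s\<in>UNIV. g s (fst \<omega>) * (snd \<omega> $ s - fst \<omega> $ s)) + V \<omega>)"
  proof (rule integral_mono_AE)
    have sndI: "integrable \<pi> (\<lambda>\<omega>. f (snd \<omega>) t)" for t
      using integrable_distr_eq[OF mf(2) meas_f] Q.integrable_f[of t] by (simp add: dQ)
    show "integrable \<pi> (\<lambda>\<omega>. f (snd \<omega>) (\<tau>o (fst \<omega>)))"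
      by (rule integrable_select[OF sndI measurable_compose[OF mf(1) ST_measurable[OF \<tau>o]]])
    show "integrable \<pi> (\<lambda>\<omega>. f (fst \<omega>) (\<tau>o (fst \<omega>)) + (\<Sum>s\<in>UNIV. g s (fst \<omega>) * (snd \<omega> $ s - fst \<omega> $ s)) + V \<omega>)"
      using fY sI V by auto
    show "AE \<omega> in \<pi>. f (snd \<omega>) (\<tau>o (fst \<omega>)) \<le> f (fst \<omega>) (\<tau>o (fst \<omega>)) + (\<Sum>s\<in>UNIV. g s (fst \<omega>) * (snd \<omega> $ s - fst \<omega> $ s)) + V \<omega>"
    proof (rule AE_I2)
      fix \<omega> :: "'n path \<times> 'n path"
      show "f (snd \<omega>) (\<tau>o (fst \<omega>)) \<le> f (fst \<omega>) (\<tau>o (fst \<omega>)) + (\<Sum>s\<in>UNIV. g s (fst \<omega>) * (snd \<omega> $ s - fst \<omega> $ s)) + V \<omega>"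
        using V(2)[of "fst \<omega>" "snd \<omega>" "\<tau>o (fst \<omega>)"] by (simp add: taylor_rem_def g_def)
    qed
  qed
  also have "\<dots> = stop_value f P + (\<Sum>s\<in>UNIV. LINT \<omega>|\<pi>. g s (fst \<omega>) * (snd \<omega> $ s - fst \<omega> $ s)) + (LINT \<omega>|\<pi>. V \<omega>)"
    using fY sI V gx by (simp add: right_diff_distrib)
  also have "(\<Sum>s\<in>UNIV. LINT \<omega>|\<pi>. g s (fst \<omega>) * (snd \<omega> $ s - fst \<omega> $ s)) \<le> (\<Sum>s\<in>UNIV. LINT \<omega>|\<pi>. \<bar>G s (fst \<omega>) * (snd \<omega> $ s - fst \<omega> $ s)\<bar>)"
    unfolding key using gx(5) by (intro sum_mono integral_mono) auto
  finally show ?thesis using A by linarith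
qed

lemma upper_bound:
  assumes \<epsilon>: "\<epsilon> > 0"
  shows "\<exists>r0>0. \<forall>r. 0 < r \<longrightarrow> r \<le> r0 \<longrightarrow> (\<forall>Q\<in>aw_ball p r P. stop_value f Q \<le> stop_value f P + r * slope + \<epsilon> * r)"
proof -
  \<comment> \<open>Chosen such that \<open>(slope + \<delta>) * (1 + \<delta>) \<le> slope + \<epsilon> / 2\<close>.\<close>
  define \<delta> where "\<delta> = min 1 (\<epsilon> / (2 * (slope + 2)))"
  have \<delta>: "\<delta> > 0" "\<delta> \<le> 1" "\<delta> * (slope + 2) \<le> \<epsilon> / 2"
  proof -
    show "\<delta> > 0" "\<delta> \<le> 1" using \<epsilon> slope_nonneg by (auto simp: \<delta>_def)
    have "\<delta> \<le> \<epsilon> / (2 * (slope + 2))" by (simp add: \<delta>_def)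
    then show "\<delta> * (slope + 2) \<le> \<epsilon> / 2" using slope_nonneg by (simp add: field_simps)
  qed
  have "\<epsilon> / 4 > 0" using \<epsilon> by simp
  from rem_integral[OF P_wass this] obtain r0 where r0: "r0 > 0"
    "\<And>Q \<pi> B. Q \<in> wass_space p \<Longrightarrow> \<pi> \<in> couplings P Q \<Longrightarrow> 0 < B \<Longrightarrow> B \<le> r0 \<Longrightarrow> transport_cost p \<pi> \<le> B powr p \<Longrightarrow>
     \<exists>V. integrable \<pi> V \<and> (LINT \<omega>|\<pi>. V \<omega>) \<le> \<epsilon> / 4 * B \<and> (\<forall>x y t. \<bar>taylor_rem x y t\<bar> \<le> V (x, y))" by blast
  show ?thesis
  proof (intro exI[of _ "r0 / 2"] conjI allI impI ballI)
    fix r Q assume r: "0 < r" "r \<le> r0 / 2" and "Q \<in> aw_ball p r P"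
    then have Q: "Q \<in> wass_space p" "adapted_wass p P Q \<le> r" by (auto simp: aw_ball_def)
    define B where "B = r * (1 + \<delta>)"
    have B: "0 < B" "r < B" "B \<le> 2 * r"       using r \<delta> mult_left_mono[of "1 + \<delta>" 2 r] mult_strict_left_mono[of 1 "1 + \<delta>" r] by (simp_all add: B_def mult.commute)
    have p0: "p > 0" using p by simp
    obtain \<pi> where \<pi>: "\<pi> \<in> bicausal_couplings P Q" "transport_cost p \<pi> \<le> B powr p"
      using adapted_wass_coupling[OF P_wass Q(1) p0 _ B(1)] Q(2) B(2) by auto
    have pc: "\<pi> \<in> couplings P Q" using \<pi> by (auto simp: bicausal_couplings_def)
    obtain V where V: "integrable \<pi> V" "(LINT \<omega>|\<pi>. V \<omega>) \<le> \<epsilon> / 4 * B" "\<And>x y t. \<bar>taylor_rem x y t\<bar> \<le> V (x, y)"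
      using r0(2)[OF Q(1) pc, of B] B r \<pi>(2) by auto
    have "stop_value f Q \<le> stop_value f P + (slope + \<delta>) * B + (LINT \<omega>|\<pi>. V \<omega>)"
      by (rule upper_coupling[OF \<pi>(1) Q(1) B(1) \<pi>(2) V(1,3) \<delta>(1)])
    also have "\<dots> \<le> stop_value f P + (slope + \<delta>) * B + \<epsilon> / 4 * (2 * r)"
      using V(2) mult_left_mono[OF B(3), of "\<epsilon> / 4"] \<epsilon> by linarith
    also have "(slope + \<delta>) * B \<le> r * (slope + \<epsilon> / 2)"
    proof -
      have "(slope + \<delta>) * (1 + \<delta>) = slope + \<delta> * (slope + 1 + \<delta>)" by (simp add: algebra_simps)
      also have "\<dots> \<le> slope + \<delta> * (slope + 2)" using \<delta> by (intro add_left_mono mult_left_mono) auto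
      finally have "(slope + \<delta>) * (1 + \<delta>) \<le> slope + \<epsilon> / 2" using \<delta>(3) by simp
      from mult_left_mono[OF this, of r] show ?thesis using r by (simp add: B_def algebra_simps)
    qed
    finally show "stop_value f Q \<le> stop_value f P + r * slope + \<epsilon> * r" by (simp add: algebra_simps)
  qed (use r0 in auto)
qed

end

section \<open>Density of adapted Lipschitz functions\<close>

text \<open>Approximate the set by a compact subset \<open>C\<close> from inside, and the indicator of \<open>C\<close> by steep
  functions of the distance to \<open>C\<close>.\<close>
lemma lipschitz_indicator_approx:
  fixes M :: "'a::{second_countable_topology, complete_space} measure"
  assumes M: "finite_measure M" "sets M = sets borel" and A: "A \<in> sets borel" and e: "e > 0"
  shows "\<exists>g K. K-lipschitz_on UNIV g \<and> (\<forall>x. \<bar>g x\<bar> \<le> 1) \<and> (LINT x|M. \<bar>indicator A x - g x\<bar>) < (e::real)"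
proof -
  interpret finite_measure M by fact
  have sp: "space M = UNIV" using sets_eq_imp_space_eq[OF M(2)] by simp
  have Am: "A \<in> sets M" using A M by simp
  have "\<exists>C. C \<subseteq> A \<and> compact C \<and> measure M A - e / 2 < measure M C"
  proof (rule ccontr)
    assume "\<not> ?thesis"
    then have le: "measure M C \<le> measure M A - e / 2" if "C \<subseteq> A" "compact C" for C using that by force
    have "measure M {} \<le> measure M A - e / 2" by (rule le) auto
    then have nn: "0 \<le> measure M A - e / 2" by simp
    have "emeasure M A = (SUP C\<in>{C. C \<subseteq> A \<and> compact C}. emeasure M C)"
      by (rule inner_regular[OF M(2) _ A]) simp
    also have "\<dots> \<le> ennreal (measure M A - e / 2)"
      by (rule SUP_least) (use le in \<open>auto simp: emeasure_eq_measure intro!: ennreal_leI\<close>)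
    finally show False using nn e by (simp add: emeasure_eq_measure)
  qed
  then obtain C where C: "C \<subseteq> A" "compact C" "measure M A - e / 2 < measure M C" by blast
  have Cc: "closed C" using C(2) by (rule compact_imp_closed)
  have Cm[measurable]: "C \<in> sets M" using Cc M by auto
  have AC: "(LINT x|M. \<bar>indicator A x - indicator C x\<bar>) < e / 2"
  proof -
    have "(LINT x|M. \<bar>indicator A x - indicator C x\<bar>) = (LINT x|M. indicator (A - C) x :: real)"
      using C(1) by (intro Bochner_Integration.integral_cong refl) (auto simp: indicator_def)
    also have "\<dots> = measure M (A - C)" using sp by simp
    also have "\<dots> = measure M A - measure M C" using C(1) Am by (intro finite_measure_Diff) auto
    finally show ?thesis using C(3) by simp
  qed
  have iI: "integrable M (indicator X :: 'a \<Rightarrow> real)" if "X \<in> sets M" for X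
    using that by (intro integrable_real_indicator) (auto simp: less_top[symmetric])
  show ?thesis
  proof (cases "C = {}")
    case True
    then show ?thesis using AC e
      by (intro exI[of _ "\<lambda>_. 0"] exI[of _ 0]) (auto simp: lipschitz_on_def)
  next
    case False
    define g where "g n x = max 0 (1 - real n * infdist x C)" for n :: nat and x
    have g01: "0 \<le> g n x" "g n x \<le> 1" for n x using infdist_nonneg[of x C] by (auto simp: g_def)
    have lip: "(real n)-lipschitz_on UNIV (g n)" for n
    proof (rule lipschitz_onI)
      fix x y :: 'a
      have "\<bar>infdist x C - infdist y C\<bar> \<le> dist x y"
        using infdist_triangle[of x C y] infdist_triangle[of y C x] by (auto simp: dist_commute)
      then have "real n * \<bar>infdist x C - infdist y C\<bar> \<le> real n * dist x y" by (intro mult_left_mono) auto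
      moreover have "\<bar>g n x - g n y\<bar> \<le> \<bar>real n * infdist x C - real n * infdist y C\<bar>" by (auto simp: g_def max_def abs_if)
      moreover have "\<bar>real n * infdist x C - real n * infdist y C\<bar> = real n * \<bar>infdist x C - infdist y C\<bar>"
        by (simp add: right_diff_distrib[symmetric] abs_mult)
      ultimately show "dist (g n x) (g n y) \<le> real n * dist x y" by (simp add: dist_real_def)
    qed simp
    have gm: "g n \<in> borel_measurable M" for n
      using lipschitz_on_continuous_on[OF lip[of n]] measurable_cong_sets[OF M(2) refl] borel_measurable_continuous_onI by blast
    have "(\<lambda>n. LINT x|M. \<bar>indicator C x - g n x\<bar>) \<longlonglongrightarrow> (LINT x|M. 0)"
    proof (rule integral_dominated_convergence[where w = "\<lambda>_. 1"])
      show "AE x in M. (\<lambda>n. \<bar>indicator C x - g n x\<bar>) \<longlonglongrightarrow> 0"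
      proof (rule AE_I2, rule tendsto_eventually)
        fix x
        show "\<forall>\<^sub>F n in sequentially. \<bar>indicator C x - g n x\<bar> = 0"
        proof (cases "x \<in> C")
          case True
          then show ?thesis by (simp add: g_def)
        next
          case nC: False
          then have d: "infdist x C > 0" using in_closed_iff_infdist_zero[OF Cc False] infdist_nonneg[of x C] by auto
          obtain m :: nat where "1 / infdist x C \<le> real m" using real_arch_simple by blast
          then have m: "1 \<le> real m * infdist x C" using d by (simp add: field_simps)
          have "1 \<le> real n * infdist x C" if "n \<ge> m" for n
            by (rule order_trans[OF m mult_right_mono]) (use that d in auto)
          then show ?thesis using nC by (intro eventually_sequentiallyI[of m]) (auto simp: g_def)
        qed
      qed
      show "AE x in M. norm \<bar>indicator C x - g n x\<bar> \<le> 1" for n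
      proof (rule AE_I2)
        fix x
        show "norm \<bar>indicator C x - g n x\<bar> \<le> 1" using g01[of n x] by (auto simp: indicator_def abs_if)
      qed
    qed (use gm in auto)
    then have "(\<lambda>n. LINT x|M. \<bar>indicator C x - g n x\<bar>) \<longlonglongrightarrow> 0" by simp
    from order_tendstoD(2)[OF this, of "e / 2"] e obtain n where n: "(LINT x|M. \<bar>indicator C x - g n x\<bar>) < e / 2"
      by (auto simp: eventually_sequentially)
    have gi: "integrable M (g n)" by (rule integrable_const_bound[of _ 1]) (use g01[of n] gm in auto)
    have "(LINT x|M. \<bar>indicator A x - g n x\<bar>) \<le> (LINT x|M. \<bar>indicator A x - indicator C x\<bar> + \<bar>indicator C x - g n x\<bar>)"
      using iI[OF Am] iI[OF Cm] gi by (intro integral_mono) auto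
    also have "\<dots> = (LINT x|M. \<bar>indicator A x - indicator C x\<bar>) + (LINT x|M. \<bar>indicator C x - g n x\<bar>)"
      using iI[OF Am] iI[OF Cm] gi by simp
    also have "\<dots> < e" using AC n by simp
    finally show ?thesis using lip[of n] g01 by (intro exI[of _ "g n"] exI[of _ "real n"]) auto
  qed
qed

text \<open>Lipschitz functions are dense in \<open>L\<^sup>1\<close> of a finite Borel measure.\<close>
lemma lipschitz_L1_dense:
  fixes M :: "'a::{second_countable_topology, complete_space} measure" and h :: "'a \<Rightarrow> real"
  assumes M: "finite_measure M" "sets M = sets borel" and h: "integrable M h" and e: "e > 0"
  shows "\<exists>g K. K-lipschitz_on UNIV g \<and> integrable M g \<and> (LINT x|M. \<bar>h x - g x\<bar>) < e"
  using h e
proof (induction h arbitrary: e rule: integrable_induct)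
  case (base A c)
  interpret finite_measure M by fact
  have A: "A \<in> sets borel" using base M by simp
  have "e / (\<bar>c\<bar> + 1) > 0" using base by simp
  from lipschitz_indicator_approx[OF M A this] obtain g K
    where g: "K-lipschitz_on UNIV g" "\<And>x. \<bar>g x\<bar> \<le> 1" "(LINT x|M. \<bar>indicator A x - g x\<bar>) < e / (\<bar>c\<bar> + 1)" by blast
  have gm: "g \<in> borel_measurable M"
    using lipschitz_on_continuous_on[OF g(1)] measurable_cong_sets[OF M(2) refl] borel_measurable_continuous_onI by blast
  have gi: "integrable M g" by (rule integrable_const_bound[of _ 1]) (use g(2) gm in auto)
  have "(LINT x|M. \<bar>indicator A x *\<^sub>R c - c * g x\<bar>) = (LINT x|M. \<bar>c\<bar> * \<bar>indicator A x - g x\<bar>)"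
    by (intro Bochner_Integration.integral_cong refl) (simp add: abs_mult[symmetric] algebra_simps)
  also have "\<dots> = \<bar>c\<bar> * (LINT x|M. \<bar>indicator A x - g x\<bar>)" by simp
  also have "\<dots> \<le> \<bar>c\<bar> * (e / (\<bar>c\<bar> + 1))" using g(3) by (intro mult_left_mono) auto
  also have "\<dots> < e" using base by (simp add: field_simps)
  finally have "(LINT x|M. \<bar>indicator A x *\<^sub>R c - c * g x\<bar>) < e" .
  moreover have "(\<bar>c\<bar> * K)-lipschitz_on UNIV (\<lambda>x. c * g x)" using g(1) by (rule lipschitz_on_cmult_real)
  ultimately show ?case using gi by (intro exI[of _ "\<lambda>x. c * g x"] exI[of _ "\<bar>c\<bar> * K"]) auto
next
  case (add f1 f2)
  have "e / 2 > 0" using add by simp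
  from add.IH(1)[OF this] add.IH(2)[OF this] obtain g1 K1 g2 K2
    where g: "K1-lipschitz_on UNIV g1" "integrable M g1" "(LINT x|M. \<bar>f1 x - g1 x\<bar>) < e / 2"
      "K2-lipschitz_on UNIV g2" "integrable M g2" "(LINT x|M. \<bar>f2 x - g2 x\<bar>) < e / 2" by blast
  have "(LINT x|M. \<bar>(f1 x + f2 x) - (g1 x + g2 x)\<bar>) \<le> (LINT x|M. \<bar>f1 x - g1 x\<bar> + \<bar>f2 x - g2 x\<bar>)"
    using add g by (intro integral_mono) auto
  also have "\<dots> = (LINT x|M. \<bar>f1 x - g1 x\<bar>) + (LINT x|M. \<bar>f2 x - g2 x\<bar>)" using add g by simp
  also have "\<dots> < e" using g by simp
  finally show ?case using g lipschitz_on_add[OF g(1,4)]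
    by (intro exI[of _ "\<lambda>x. g1 x + g2 x"] exI[of _ "K1 + K2"]) auto
next
  case (lim f s)
  have "(\<lambda>i. LINT x|M. \<bar>f x - s i x\<bar>) \<longlonglongrightarrow> (LINT x|M. 0)"
  proof (rule integral_dominated_convergence[where w = "\<lambda>x. 3 * \<bar>f x\<bar>"])
    show "AE x in M. (\<lambda>i. \<bar>f x - s i x\<bar>) \<longlonglongrightarrow> 0"
    proof (rule AE_I2)
      fix x assume "x \<in> space M"
      then have "(\<lambda>i. \<bar>f x - s i x\<bar>) \<longlonglongrightarrow> \<bar>f x - f x\<bar>" by (intro tendsto_intros lim.hyps(2))
      then show "(\<lambda>i. \<bar>f x - s i x\<bar>) \<longlonglongrightarrow> 0" by simp
    qed
    show "AE x in M. norm \<bar>f x - s i x\<bar> \<le> 3 * \<bar>f x\<bar>" for i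
    proof (rule AE_I2)
      fix x assume "x \<in> space M"
      from lim.hyps(3)[OF this, of i] show "norm \<bar>f x - s i x\<bar> \<le> 3 * \<bar>f x\<bar>" by auto
    qed
  qed (use lim in auto)
  then have l: "(\<lambda>i. LINT x|M. \<bar>f x - s i x\<bar>) \<longlonglongrightarrow> 0" by simp
  have e2: "e / 2 > 0" using lim by simp
  from order_tendstoD(2)[OF l e2] obtain i where i: "(LINT x|M. \<bar>f x - s i x\<bar>) < e / 2"
    by (auto simp: eventually_sequentially)
  from lim.IH[OF e2, of i] obtain g K where g: "K-lipschitz_on UNIV g" "integrable M g" "(LINT x|M. \<bar>s i x - g x\<bar>) < e / 2" by blast
  have "(LINT x|M. \<bar>f x - g x\<bar>) \<le> (LINT x|M. \<bar>f x - s i x\<bar> + \<bar>s i x - g x\<bar>)"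
    using lim g by (intro integral_mono) auto
  also have "\<dots> = (LINT x|M. \<bar>f x - s i x\<bar>) + (LINT x|M. \<bar>s i x - g x\<bar>)" using lim g by simp
  also have "\<dots> < e" using i g by simp
  finally show ?case using g by blast
qed

lemma lipschitz_clamp:
  fixes g :: "'a::metric_space \<Rightarrow> real"
  assumes "K-lipschitz_on UNIV g"
  shows "K-lipschitz_on UNIV (\<lambda>x. max (- m) (min m (g x)))"
proof (rule lipschitz_onI)
  fix x y
  have "\<bar>max (- m) (min m (g x)) - max (- m) (min m (g y))\<bar> \<le> \<bar>g x - g y\<bar>" by (simp add: max_def min_def)
  also have "\<dots> \<le> K * dist x y" using lipschitz_onD[OF assms, of x y] by (simp add: dist_real_def)
  finally show "dist (max (- m) (min m (g x))) (max (- m) (min m (g y))) \<le> K * dist x y" by (simp add: dist_real_def)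
qed (rule lipschitz_on_nonneg[OF assms])

text \<open>A bounded function of the coordinates up to \<open>t\<close> is approximated in \<open>L\<^sup>1\<close> under the law of these
  coordinates; clamping then enforces the bound and preserves the Lipschitz constant.\<close>
lemma adapted_lipschitz_L1:
  fixes P :: "'n::{finite,linorder} path measure" and h :: "'n path \<Rightarrow> real"
  assumes P: "prob_space P" "sets P = sets borel" and h: "h \<in> borel_measurable (canon_filt t)"
    and m: "\<And>x. \<bar>h x\<bar> \<le> m" and e: "e > 0"
  shows "\<exists>g K. K-lipschitz_on UNIV g \<and> (\<forall>x. \<bar>g x\<bar> \<le> m) \<and> (LINT x|P. \<bar>h x - g (keep {..t} x)\<bar>) < e"
proof -
  interpret prob_space P by fact
  let ?k = "keep {..t} :: 'n path \<Rightarrow> _"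
  have km: "?k \<in> borel_measurable P" using borel_measurable_keep measurable_cong_sets[OF P(2) refl] by blast
  have hm[measurable]: "h \<in> borel_measurable borel" using h canon_filt_borel by (auto simp: measurable_def)
  have hk: "h (?k x) = h x" for x
    by (rule gen_by_determined[OF h[unfolded canon_filt_def]]) auto
  let ?\<mu> = "distr P borel ?k"
  interpret \<mu>: prob_space ?\<mu> by (rule prob_space_distr[OF km])
  have hi: "integrable ?\<mu> h" by (rule \<mu>.integrable_const_bound[of _ m]) (use m in auto)
  have "finite_measure ?\<mu>" by unfold_locales
  from lipschitz_L1_dense[OF this _ hi e] obtain g K where g: "K-lipschitz_on UNIV g" "integrable ?\<mu> g" "(LINT x|?\<mu>. \<bar>h x - g x\<bar>) < e"
    by auto
  let ?g = "\<lambda>x. max (- m) (min m (g x))"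
  have gm: "?g \<in> borel_measurable borel"
    using g(2) by auto
  have m0: "0 \<le> m" using m[of undefined] by linarith
  have "(LINT x|?\<mu>. \<bar>h x - ?g x\<bar>) \<le> (LINT x|?\<mu>. \<bar>h x - g x\<bar>)"
  proof (rule integral_mono)
    show "integrable ?\<mu> (\<lambda>x. \<bar>h x - ?g x\<bar>)"
    proof (rule \<mu>.integrable_const_bound[of _ "2 * m"])
      have "norm \<bar>h x - ?g x\<bar> \<le> 2 * m" for x using m[of x] m0 by (auto simp: max_def min_def abs_if split: if_splits)
      then show "AE x in ?\<mu>. norm \<bar>h x - ?g x\<bar> \<le> 2 * m" by simp
    qed (use gm in auto)
    show "\<bar>h x - ?g x\<bar> \<le> \<bar>h x - g x\<bar>" for x using m[of x] by (auto simp: max_def min_def abs_if split: if_splits)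
  qed (use hi g in auto)
  moreover have "(LINT x|?\<mu>. \<bar>h x - ?g x\<bar>) = (LINT x|P. \<bar>h x - ?g (?k x)\<bar>)"
    using gm by (subst integral_distr[OF km]) (auto simp: hk)
  ultimately have "(LINT x|P. \<bar>h x - ?g (?k x)\<bar>) < e" using g(3) by simp
  then show ?thesis using lipschitz_clamp[OF g(1), of m] m0
    by (intro exI[of _ ?g] exI[of _ K]) auto
qed

section \<open>Adapted flows\<close>

text \<open>A coupling carried by the graph of an adapted map is causal in the direction of the map.\<close>
lemma causal_of_map:
  assumes \<pi>: "prob_space \<pi>" "space \<pi> = UNIV" and X: "X \<in> borel_measurable \<pi>" and Y: "Y \<in> borel_measurable \<pi>"
    and R: "\<And>t. (\<lambda>x. keep {..t} (R x)) \<in> canon_filt t \<rightarrow>\<^sub>M borel"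
    and ae: "AE \<omega> in \<pi>. Y \<omega> = R (X \<omega>)"
  shows "causal \<pi> X Y"
proof (rule causalI[OF \<pi> X Y])
  interpret prob_space \<pi> by fact
  fix t E assume E: "E \<in> sets (gen_by Y {..t})"
  then obtain B where B: "B \<in> sets borel" "E = (\<lambda>\<omega>. keep {..t} (Y \<omega>)) -` B" unfolding sets_gen_by_eq by auto
  have m: "(\<lambda>\<omega>. keep {..t} (R (X \<omega>))) \<in> gen_by X {..t} \<rightarrow>\<^sub>M borel"
    using measurable_gen_by_compose[OF R[of t, unfolded canon_filt_def], of X] .
  let ?E = "(\<lambda>\<omega>. keep {..t} (R (X \<omega>))) -` B"
  have E': "?E \<in> sets (gen_by X {..t})" using measurable_sets[OF m B(1)] by simp
  have E'm: "?E \<in> sets \<pi>" using E' subalgebra_gen_by[OF X \<pi>(2)] by (auto simp: subalgebra_def)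
  have Em: "E \<in> sets \<pi>" using E subalgebra_gen_by[OF Y \<pi>(2)] by (auto simp: subalgebra_def)
  show "\<exists>h \<in> borel_measurable (gen_by X {..t}). integrable \<pi> h \<and>
       (\<forall>B \<in> sets (gen_by X UNIV). (LINT \<omega>:B|\<pi>. indicator E \<omega>) = (LINT \<omega>:B|\<pi>. (h \<omega> :: real)))"
  proof (intro bexI[of _ "indicator ?E"] conjI ballI)
    show "integrable \<pi> (indicator ?E :: _ \<Rightarrow> real)"
      using E'm by (intro integrable_real_indicator) (auto simp: less_top[symmetric])
    show "indicator ?E \<in> borel_measurable (gen_by X {..t})" using E' by simp
    fix A assume "A \<in> sets (gen_by X UNIV)"
    then have Am: "A \<in> sets \<pi>" using subalgebra_gen_by[OF X \<pi>(2)] by (auto simp: subalgebra_def)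
    show "(LINT \<omega>:A|\<pi>. indicator E \<omega>) = (LINT \<omega>:A|\<pi>. (indicator ?E \<omega> :: real))"
      unfolding set_lebesgue_integral_def
    proof (rule integral_cong_AE)
      show "AE \<omega> in \<pi>. indicator A \<omega> *\<^sub>R indicator E \<omega> = indicator A \<omega> *\<^sub>R (indicator ?E \<omega> :: real)"
        using ae by eventually_elim (simp add: B(2) indicator_def)
    qed (use Am Em E'm in auto)
  qed
qed

lemma adapted_map:
  fixes R :: "'n::{finite,linorder} path \<Rightarrow> 'n path"
  assumes "R \<in> borel_measurable borel" and "\<And>x y. keep {..t} x = keep {..t} y \<Longrightarrow> keep {..t} (R x) = keep {..t} (R y)"
  shows "(\<lambda>x. keep {..t} (R x)) \<in> canon_filt t \<rightarrow>\<^sub>M borel"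
proof -
  have 1: "(\<lambda>x. keep {..t} (R x)) = (\<lambda>x. keep {..t} (R (keep {..t} x)))"
    by (intro ext assms(2)) (simp add: vec_eq_iff)
  show ?thesis unfolding 1 canon_filt_def
    by (intro measurable_compose[OF measurable_compose[OF measurable_gen_by_keep assms(1)]] borel_measurable_keep)
qed

lemma ST_compose:
  assumes "\<tau> \<in> ST" and R: "\<And>t. (\<lambda>x. keep {..t} (R x)) \<in> canon_filt t \<rightarrow>\<^sub>M borel"
  shows "(\<lambda>x. \<tau> (R x)) \<in> ST"
proof (rule STI)
  fix t
  obtain B where B: "{x. \<tau> x \<le> t} = keep {..t} -` B" "B \<in> sets borel"
    using stopping_le_sets[OF assms(1), of t] unfolding canon_filt_def sets_gen_by_eq by auto
  have "{x. \<tau> (R x) \<le> t} = (\<lambda>x. keep {..t} (R x)) -` B" using B(1) by auto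
  then show "{x. \<tau> (R x) \<le> t} \<in> sets (canon_filt t)" using measurable_sets[OF R B(2), of t] by simp
qed

text \<open>
  An adapted Lipschitz vector field \<open>Z\<close>: its component at time \<open>s\<close> is a Lipschitz function of the
  coordinates up to \<open>s\<close>.
\<close>
locale adapted_flow =
  fixes Z :: "'n::{finite,linorder} \<Rightarrow> 'n path \<Rightarrow> real" and K :: real
  assumes K: "K \<ge> 0" and Z_lip: "\<And>s x y. \<bar>Z s x - Z s y\<bar> \<le> K * norm (keep {..s} x - keep {..s} y)"
begin

text \<open>The perturbation of the identity by \<open>r\<close> times \<open>Z\<close>.\<close>
definition \<Phi> :: "real \<Rightarrow> 'n path \<Rightarrow> 'n path" where "\<Phi> r x = (\<chi> s. x $ s + r * Z s x)"

lemma \<Phi>_nth [simp]: "\<Phi> r x $ s = x $ s + r * Z s x" by (simp add: \<Phi>_def)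

lemma diff_estimate:
  assumes "\<And>s. s \<in> S \<Longrightarrow> {..s} \<subseteq> S"
  shows "norm ((\<chi> s. if s \<in> S then Z s x - Z s y else 0) :: 'n path) \<le> real CARD('n) * K * norm (keep S x - keep S y)"
proof -
  let ?v = "(\<chi> s. if s \<in> S then Z s x - Z s y else 0) :: 'n path"
  have "norm ?v \<le> (\<Sum>s\<in>UNIV. \<bar>?v $ s\<bar>)" by (rule norm_le_l1_cart)
  also have "\<dots> \<le> (\<Sum>s\<in>(UNIV::'n set). K * norm (keep S x - keep S y))"
  proof (rule sum_mono)
    fix s
    show "\<bar>?v $ s\<bar> \<le> K * norm (keep S x - keep S y)"
    proof (cases "s \<in> S")
      case True
      have "K * norm (keep {..s} x - keep {..s} y) \<le> K * norm (keep S x - keep S y)"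
        using K keep_norm_mono[OF assms[OF True]] by (intro mult_left_mono)
      then show ?thesis using True Z_lip[of s x y] by simp
    qed (use K in simp)
  qed
  finally show ?thesis by simp
qed

text \<open>For sets \<open>S\<close> of times that contain the past of each element, \<open>\<Phi>\<close> contracts distances on the
  coordinates in \<open>S\<close> at most by the factor \<open>1 - r * (CARD('n) * K)\<close>. With \<open>S = {..t}\<close> this makes the
  inverse adapted, and with \<open>S = UNIV\<close> Lipschitz.\<close>
lemma \<Phi>_expand:
  assumes "\<And>s. s \<in> S \<Longrightarrow> {..s} \<subseteq> S" and "r \<ge> 0"
  shows "(1 - r * (real CARD('n) * K)) * norm (keep S x - keep S y) \<le> norm (keep S (\<Phi> r x) - keep S (\<Phi> r y))"
proof -
  let ?v = "(\<chi> s. if s \<in> S then Z s x - Z s y else 0) :: 'n path"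
  have "keep S x - keep S y = (keep S (\<Phi> r x) - keep S (\<Phi> r y)) - r *\<^sub>R ?v"
    by (auto simp: vec_eq_iff algebra_simps)
  then have "norm (keep S x - keep S y) \<le> norm (keep S (\<Phi> r x) - keep S (\<Phi> r y)) + norm (r *\<^sub>R ?v)"
    by (simp only: norm_triangle_ineq4)
  also have "norm (r *\<^sub>R ?v) \<le> r * (real CARD('n) * K * norm (keep S x - keep S y))"
  proof -
    have "norm (r *\<^sub>R ?v) = r * norm ?v" using assms(2) by simp
    also have "\<dots> \<le> r * (real CARD('n) * K * norm (keep S x - keep S y))"
      by (rule mult_left_mono[OF diff_estimate[OF assms(1)] assms(2)])
    finally show ?thesis .
  qed
  finally show ?thesis by (simp add: algebra_simps)
qed

lemma Z_cont: "continuous_on UNIV (Z s)"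
proof (rule lipschitz_on_continuous_on)
  show "K-lipschitz_on UNIV (Z s)"
  proof (rule lipschitz_onI[OF _ K])
    fix x y :: "'n path"
    have "K * norm (keep {..s} x - keep {..s} y) \<le> K * norm (keep UNIV x - keep UNIV y)"
      by (intro mult_left_mono keep_norm_mono K) auto
    then show "dist (Z s x) (Z s y) \<le> K * dist x y" using Z_lip[of s x y] by (simp add: dist_norm)
  qed
qed

lemma Z_meas [measurable]: "Z s \<in> borel_measurable borel"
  by (rule borel_measurable_continuous_onI[OF Z_cont])

lemma \<Phi>_meas [measurable]: "\<Phi> r \<in> borel_measurable borel"
  by (subst borel_measurable_vec_iff) auto

context
  fixes r :: real
  assumes r: "0 \<le> r" "r * (real CARD('n) * K) < 1"
begin

lemma \<Phi>_keep_iff: "keep {..t} (\<Phi> r x) = keep {..t} (\<Phi> r y) \<longleftrightarrow> keep {..t} x = keep {..t} y"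
proof
  assume "keep {..t} (\<Phi> r x) = keep {..t} (\<Phi> r y)"
  then have "(1 - r * (real CARD('n) * K)) * norm (keep {..t} x - keep {..t} y) \<le> 0"
    using \<Phi>_expand[of "{..t}" r x y] r by auto
  then have "norm (keep {..t} x - keep {..t} y) \<le> 0" using r by (simp add: mult_le_0_iff)
  then show "keep {..t} x = keep {..t} y" by simp
next
  assume eq: "keep {..t} x = keep {..t} y"
  have "Z s x = Z s y" if "s \<le> t" for s
  proof -
    have "norm (keep {..s} x - keep {..s} y) \<le> norm (keep {..t} x - keep {..t} y)"
      using that by (intro keep_norm_mono) auto
    then show ?thesis using Z_lip[of s x y] eq by simp
  qed
  moreover have "x $ s = y $ s" if "s \<le> t" for s using arg_cong[OF eq, of "\<lambda>v. v $ s"] that by simp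
  ultimately show "keep {..t} (\<Phi> r x) = keep {..t} (\<Phi> r y)" by (auto simp: vec_eq_iff)
qed

text \<open>A preimage of \<open>y\<close> is a fixed point of the contraction \<open>x \<mapsto> y - r * Z x\<close>.\<close>
lemma \<Phi>_surj: "\<exists>x. \<Phi> r x = y"
proof -
  let ?F = "\<lambda>x. (\<chi> s. y $ s - r * Z s x) :: 'n path"
  have "\<forall>x x'. dist (?F x) (?F x') \<le> (r * (real CARD('n) * K)) * dist x x'"
  proof (intro allI)
    fix x x' :: "'n path"
    have "?F x - ?F x' = - (r *\<^sub>R (\<chi> s. if s \<in> UNIV then Z s x - Z s x' else 0))"
      by (auto simp: vec_eq_iff algebra_simps)
    then have "dist (?F x) (?F x') = r * norm ((\<chi> s. if s \<in> UNIV then Z s x - Z s x' else 0) :: 'n path)"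
      using r by (simp only: dist_norm norm_minus_cancel norm_scaleR abs_of_nonneg)
    also have "\<dots> \<le> r * (real CARD('n) * K * norm (keep UNIV x - keep UNIV x'))"
      using r by (intro mult_left_mono diff_estimate) auto
    finally show "dist (?F x) (?F x') \<le> (r * (real CARD('n) * K)) * dist x x'" by (simp add: dist_norm mult.assoc)
  qed
  moreover have "0 \<le> r * (real CARD('n) * K)" using r K by simp
  ultimately have "\<exists>!x. ?F x = x" using r(2) by (intro banach_fix_type)
  then obtain x where "?F x = x" by blast
  then have "x $ s = y $ s - r * Z s x" for s by (metis vec_lambda_beta)
  then show ?thesis by (intro exI[of _ x]) (simp add: vec_eq_iff algebra_simps)
qed

text \<open>The inverse of \<open>\<Phi>\<close>. A choice suffices, as \<open>\<Phi>\<close> is injective.\<close>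
definition \<Psi> :: "'n path \<Rightarrow> 'n path" where "\<Psi> y = (SOME x. \<Phi> r x = y)"

lemma \<Phi>_\<Psi> [simp]: "\<Phi> r (\<Psi> y) = y" unfolding \<Psi>_def by (rule someI_ex[OF \<Phi>_surj])

lemma \<Psi>_\<Phi> [simp]: "\<Psi> (\<Phi> r x) = x"
proof -
  have "keep {..t} (\<Psi> (\<Phi> r x)) = keep {..t} x" for t by (subst \<Phi>_keep_iff[symmetric]) simp
  then have "\<Psi> (\<Phi> r x) $ t = x $ t" for t by (metis atMost_iff keep_nth order_refl)
  then show ?thesis by (simp add: vec_eq_iff)
qed

lemma \<Psi>_meas: "\<Psi> \<in> borel_measurable borel"
proof (rule borel_measurable_continuous_onI, rule lipschitz_on_continuous_on)
  let ?k = "1 - r * (real CARD('n) * K)"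
  show "(1 / ?k)-lipschitz_on UNIV \<Psi>"
  proof (rule lipschitz_onI)
    fix x y
    have "?k * norm (keep UNIV (\<Psi> x) - keep UNIV (\<Psi> y)) \<le> norm (keep UNIV (\<Phi> r (\<Psi> x)) - keep UNIV (\<Phi> r (\<Psi> y)))"
      by (rule \<Phi>_expand) (use r in auto)
    then show "dist (\<Psi> x) (\<Psi> y) \<le> (1 / ?k) * dist x y" using r by (simp add: dist_norm field_simps)
  qed (use r in auto)
qed

lemma \<Phi>_adapted: "(\<lambda>x. keep {..t} (\<Phi> r x)) \<in> canon_filt t \<rightarrow>\<^sub>M borel"
  by (rule adapted_map[OF \<Phi>_meas]) (simp add: \<Phi>_keep_iff)

lemma \<Psi>_adapted: "(\<lambda>x. keep {..t} (\<Psi> x)) \<in> canon_filt t \<rightarrow>\<^sub>M borel"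
  by (rule adapted_map[OF \<Psi>_meas], subst \<Phi>_keep_iff[symmetric], simp)

lemma flow_bicausal:
  assumes P: "prob_space P" "sets P = sets borel"
  shows "distr P borel (\<lambda>x. (x, \<Phi> r x)) \<in> bicausal_couplings P (distr P borel (\<Phi> r))"
proof -
  interpret prob_space P by fact
  let ?\<pi> = "distr P borel (\<lambda>x. (x, \<Phi> r x))"
  have [measurable]: "\<Phi> r \<in> borel_measurable P" "(\<lambda>x. x) \<in> borel_measurable P"
    using \<Phi>_meas measurable_cong_sets[OF P(2) refl] by (blast, simp add: measurable_cong_sets[OF P(2) refl])
  have pm: "(\<lambda>x. (x, \<Phi> r x)) \<in> borel_measurable P" by measurable
  have mf: "fst \<in> borel_measurable (borel :: ('n path \<times> 'n path) measure)" "snd \<in> borel_measurable (borel :: ('n path \<times> 'n path) measure)"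
    by (simp_all add: measurable_fst_snd)
  have pr: "prob_space ?\<pi>" by (rule prob_space_distr[OF pm])
  have d1: "distr ?\<pi> borel fst = P"
  proof -
    have "distr ?\<pi> borel fst = distr P borel (\<lambda>x. x)" using mf by (subst distr_distr[OF _ pm]) (auto simp: comp_def)
    also have "\<dots> = distr P P (\<lambda>x. x)" by (rule distr_cong) (simp_all add: P)
    also have "\<dots> = P" by (rule distr_id)
    finally show ?thesis .
  qed
  have d2: "distr ?\<pi> borel snd = distr P borel (\<Phi> r)"
    using mf by (subst distr_distr[OF _ pm]) (auto simp: comp_def)
  have closed: "closed {\<omega> :: 'n path \<times> 'n path. snd \<omega> = h (fst \<omega>)}" if "continuous_on UNIV h" for h
    by (intro closed_Collect_eq continuous_intros continuous_on_compose2[OF that]) auto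
  have \<Phi>c: "continuous_on UNIV (\<Phi> r)"
    unfolding \<Phi>_def by (intro continuous_intros continuous_on_vec_lambda Z_cont)
  have ae: "AE \<omega> in ?\<pi>. snd \<omega> = \<Phi> r (fst \<omega>)"
    using closed[OF \<Phi>c] by (subst AE_distr_iff[OF pm]) auto
  then have ae2: "AE \<omega> in ?\<pi>. fst \<omega> = \<Psi> (snd \<omega>)" by eventually_elim simp
  have "causal ?\<pi> fst snd" by (rule causal_of_map[OF pr _ _ _ \<Phi>_adapted ae]) (use mf in auto)
  moreover have "causal ?\<pi> snd fst" by (rule causal_of_map[OF pr _ _ _ \<Psi>_adapted ae2]) (use mf in auto)
  ultimately show ?thesis using pr d1 d2 by (simp add: bicausal_couplings_def couplings_def)
qed

end
end

section \<open>Almost extremal directions\<close>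

text \<open>\<open>L\<^sup>1\<close> approximation with a common bound \<open>m\<close> also gives convergence of \<open>p\<close>-th moments and of
  integrals against an integrable weight, by dominated convergence along a subsequence that converges
  almost surely.\<close>
lemma adapted_lipschitz_approx:
  fixes P :: "'n::{finite,linorder} path measure" and h :: "'n path \<Rightarrow> real"
  assumes P: "prob_space P" "sets P = sets borel" and h: "h \<in> borel_measurable (canon_filt t)"
    and m: "\<And>x. \<bar>h x\<bar> \<le> m" and p: "p > 0" and w: "integrable P w" and e: "e > 0"
  shows "\<exists>g K. K-lipschitz_on UNIV g \<and> (\<forall>x. \<bar>g x\<bar> \<le> m) \<and>
    (LINT x|P. \<bar>g (keep {..t} x)\<bar> powr p) \<le> (LINT x|P. \<bar>h x\<bar> powr p) + e \<and>
    (LINT x|P. w x * g (keep {..t} x)) \<ge> (LINT x|P. w x * h x) - e"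
proof -
  interpret prob_space P by fact
  have bm: "borel_measurable P = borel_measurable borel" by (rule measurable_cong_sets[OF P(2) refl])
  have hm: "h \<in> borel_measurable P" using h canon_filt_borel unfolding bm by (auto simp: measurable_def)
  have wm: "w \<in> borel_measurable P" using w by auto
  have m0: "0 \<le> m" using m[of undefined] by linarith
  have "\<forall>n. \<exists>g. (\<exists>K. K-lipschitz_on UNIV g) \<and> (\<forall>x. \<bar>g x\<bar> \<le> m) \<and> (LINT x|P. \<bar>h x - g (keep {..t} x)\<bar>) < inverse (real (Suc n))"
  proof
    fix n :: nat
    have "inverse (real (Suc n)) > 0" by simp
    from adapted_lipschitz_L1[OF P h m this]
    show "\<exists>g. (\<exists>K. K-lipschitz_on UNIV g) \<and> (\<forall>x. \<bar>g x\<bar> \<le> m) \<and> (LINT x|P. \<bar>h x - g (keep {..t} x)\<bar>) < inverse (real (Suc n))"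
      by blast
  qed
  from choice[OF this] obtain g where g: "\<And>n. \<exists>K. K-lipschitz_on UNIV (g n)" "\<And>n x. \<bar>g n x\<bar> \<le> m"
    "\<And>n. (LINT x|P. \<bar>h x - g n (keep {..t} x)\<bar>) < inverse (real (Suc n))" by blast
  have gm: "(\<lambda>x. g n (keep {..t} x)) \<in> borel_measurable P" for n
  proof -
    have "g n \<in> borel_measurable borel"
      using g(1)[of n] lipschitz_on_continuous_on borel_measurable_continuous_onI by blast
    then show ?thesis unfolding bm by (rule measurable_compose[OF borel_measurable_keep])
  qed
  let ?u = "\<lambda>n x. h x - g n (keep {..t} x)"
  have ui: "integrable P (?u n)" for n
  proof (rule integrable_const_bound[of _ "2 * m"])
    have "norm (?u n x) \<le> 2 * m" for x using m[of x] g(2)[of n "keep {..t} x"] by (auto simp: abs_if split: if_splits)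
    then show "AE x in P. norm (?u n x) \<le> 2 * m" by simp
  qed (use hm gm in auto)
  have "(\<lambda>n. LINT x|P. norm (?u n x)) \<longlonglongrightarrow> 0"
  proof (rule tendsto_sandwich[OF _ _ tendsto_const LIMSEQ_inverse_real_of_nat])
    show "\<forall>\<^sub>F n in sequentially. 0 \<le> (LINT x|P. norm (?u n x))" by simp
    show "\<forall>\<^sub>F n in sequentially. (LINT x|P. norm (?u n x)) \<le> inverse (real (Suc n))"
      using g(3) by (intro always_eventually allI less_imp_le) simp
  qed
  from tendsto_L1_AE_subseq[OF ui this] obtain k where k: "AE x in P. (\<lambda>n. ?u (k n) x) \<longlonglongrightarrow> 0" by blast
  then have lim: "AE x in P. (\<lambda>n. g (k n) (keep {..t} x)) \<longlonglongrightarrow> h x"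
  proof eventually_elim
    case (elim x)
    have "(\<lambda>n. h x - ?u (k n) x) \<longlonglongrightarrow> h x - 0" by (intro tendsto_intros elim)
    then show ?case by simp
  qed
  have 1: "(\<lambda>n. LINT x|P. \<bar>g (k n) (keep {..t} x)\<bar> powr p) \<longlonglongrightarrow> (LINT x|P. \<bar>h x\<bar> powr p)"
  proof (rule integral_dominated_convergence[where w = "\<lambda>_. m powr p"])
    show "AE x in P. (\<lambda>n. \<bar>g (k n) (keep {..t} x)\<bar> powr p) \<longlonglongrightarrow> \<bar>h x\<bar> powr p"
      using lim
    proof eventually_elim
      case (elim x)
      then have "(\<lambda>n. \<bar>g (k n) (keep {..t} x)\<bar>) \<longlonglongrightarrow> \<bar>h x\<bar>" by (rule tendsto_rabs)
      then show ?case using p by (intro tendsto_powr2 tendsto_const) auto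
    qed
    show "AE x in P. norm (\<bar>g (k n) (keep {..t} x)\<bar> powr p) \<le> m powr p" for n
      using g(2) p by (auto intro!: powr_mono2)
  qed (use hm gm in auto)
  have 2: "(\<lambda>n. LINT x|P. w x * g (k n) (keep {..t} x)) \<longlonglongrightarrow> (LINT x|P. w x * h x)"
  proof (rule integral_dominated_convergence[where w = "\<lambda>x. \<bar>w x\<bar> * m"])
    show "AE x in P. (\<lambda>n. w x * g (k n) (keep {..t} x)) \<longlonglongrightarrow> w x * h x"
      using lim by eventually_elim (intro tendsto_intros)
    show "AE x in P. norm (w x * g (k n) (keep {..t} x)) \<le> \<bar>w x\<bar> * m" for n
      using g(2) by (auto simp: abs_mult intro!: mult_left_mono)
  qed (use hm gm wm w in auto)
  have "\<forall>\<^sub>F n in sequentially. (LINT x|P. \<bar>g (k n) (keep {..t} x)\<bar> powr p) < (LINT x|P. \<bar>h x\<bar> powr p) + e"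
    using e by (intro order_tendstoD(2)[OF 1]) simp
  moreover have "\<forall>\<^sub>F n in sequentially. (LINT x|P. w x * h x) - e < (LINT x|P. w x * g (k n) (keep {..t} x))"
    using e by (intro order_tendstoD(1)[OF 2]) simp
  ultimately have "\<forall>\<^sub>F n in sequentially. (LINT x|P. \<bar>g (k n) (keep {..t} x)\<bar> powr p) < (LINT x|P. \<bar>h x\<bar> powr p) + e \<and>
     (LINT x|P. w x * h x) - e < (LINT x|P. w x * g (k n) (keep {..t} x))" by (rule eventually_conj)
  then obtain n where n: "(LINT x|P. \<bar>g (k n) (keep {..t} x)\<bar> powr p) < (LINT x|P. \<bar>h x\<bar> powr p) + e"
     "(LINT x|P. w x * h x) - e < (LINT x|P. w x * g (k n) (keep {..t} x))"
    by (auto simp: eventually_sequentially)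
  obtain K where "K-lipschitz_on UNIV (g (k n))" using g(1) by blast
  then show ?thesis using g(2)[of "k n"] n by (intro exI[of _ "g (k n)"] exI[of _ K]) auto
qed

context sensitivity
begin

text \<open>
  Equality in Hoelder's inequality holds for \<open>sgn G * |G|\<^sup>q\<^sup>-\<^sup>1 / slope\<^sup>q\<^sup>-\<^sup>1\<close>. Truncation where \<open>|G| > N\<close>
  makes it bounded, and a factor \<open>\<theta> < 1\<close> makes the constraint on the \<open>p\<close>-th moments strict, which leaves
  room for a subsequent approximation.
\<close>
lemma direction_bounded:
  assumes a: "a < slope" and L: "slope > 0"
  shows "\<exists>h m. (\<forall>s. h s \<in> borel_measurable (canon_filt s)) \<and> (\<forall>s x. \<bar>h s x\<bar> \<le> m) \<and>
     (\<Sum>s\<in>UNIV. LINT x|P. \<bar>h s x\<bar> powr p) < 1 \<and> (\<Sum>s\<in>UNIV. LINT x|P. G s x * h s x) > a"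
proof -
  define b where "b = max 0 a"
  define \<theta> where "\<theta> = (b / slope + 1) / 2"
  have b: "0 \<le> b" "a \<le> b" "b < slope" using a L by (auto simp: b_def)
  have \<theta>: "0 < \<theta>" "\<theta> < 1" "a < \<theta> * slope"
  proof -
    have "0 \<le> b / slope" "b / slope < 1" using b L by (auto simp: field_simps)
    then show "0 < \<theta>" "\<theta> < 1" by (auto simp: \<theta>_def)
    have "\<theta> * slope = (b + slope) / 2" using L by (simp add: \<theta>_def field_simps)
    then show "a < \<theta> * slope" using b by simp
  qed
  define h where "h N s x = (if \<bar>G s x\<bar> \<le> N then \<theta> * (sgn (G s x) * (\<bar>G s x\<bar> powr (q - 1) / slope powr (q - 1))) else 0)" for N :: real and s x
  have hp: "\<bar>h N s x\<bar> powr p \<le> \<theta> powr p / slope powr q * \<bar>G s x\<bar> powr q" for N s x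
  proof (cases "\<bar>G s x\<bar> \<le> N \<and> G s x \<noteq> 0")
    case True
    then have "\<bar>h N s x\<bar> = \<theta> * (\<bar>G s x\<bar> powr (q - 1) / slope powr (q - 1))"
      using \<theta> by (simp add: h_def abs_mult abs_sgn_eq)
    then have "\<bar>h N s x\<bar> powr p = \<theta> powr p * (\<bar>G s x\<bar> powr q / slope powr q)"
      using \<theta> pq by (simp add: powr_mult powr_divide powr_powr)
    then show ?thesis by simp
  qed (use \<theta> in \<open>auto simp: h_def\<close>)
  have Gh: "G s x * h N s x = \<theta> / slope powr (q - 1) * (if \<bar>G s x\<bar> \<le> N then \<bar>G s x\<bar> powr q else 0)" for N s x
  proof -
    have "G s x * sgn (G s x) * \<bar>G s x\<bar> powr (q - 1) = \<bar>G s x\<bar> powr q"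
      using powr_add[of "\<bar>G s x\<bar>" 1 "q - 1"] by (cases "G s x = 0") (auto simp: abs_sgn[symmetric] mult.commute)
    then show ?thesis by (simp add: h_def)
  qed
  have bm: "borel_measurable P = borel_measurable borel" by (rule measurable_cong_sets[OF sets_P refl])
  have hm: "h N s \<in> borel_measurable (canon_filt s)" for N s
    unfolding h_def[abs_def] using G_filt[of s] by measurable
  have hmP[measurable]: "h N s \<in> borel_measurable P" for N s
    using measurable_from_subalg[OF sigma_finite_subalgebra.subalg[OF sub_canon] hm] .
  have Gm: "G s \<in> borel_measurable P" for s using G_int by auto
  have hb: "\<bar>h N s x\<bar> \<le> \<theta> * (N powr (q - 1) / slope powr (q - 1))" if "N \<ge> 0" for N s x
  proof (cases "\<bar>G s x\<bar> \<le> N")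
    case True
    have "\<bar>h N s x\<bar> \<le> \<theta> * (\<bar>G s x\<bar> powr (q - 1) / slope powr (q - 1))"
      using \<theta> by (auto simp: h_def abs_mult abs_sgn_eq)
    also have "\<dots> \<le> \<theta> * (N powr (q - 1) / slope powr (q - 1))"
      using True \<theta> pq by (intro mult_left_mono divide_right_mono powr_mono2) auto
    finally show ?thesis .
  qed (use \<theta> in \<open>auto simp: h_def\<close>)
  have sum_p: "(\<Sum>s\<in>UNIV. LINT x|P. \<bar>h N s x\<bar> powr p) < 1" for N
  proof -
    have "(\<Sum>s\<in>UNIV. LINT x|P. \<bar>h N s x\<bar> powr p) \<le> (\<Sum>s\<in>UNIV. LINT x|P. \<theta> powr p / slope powr q * \<bar>G s x\<bar> powr q)"
    proof (rule sum_mono, rule integral_mono)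
      fix s
      show i: "integrable P (\<lambda>x. \<theta> powr p / slope powr q * \<bar>G s x\<bar> powr q)" using G_powr_int by simp
      show "integrable P (\<lambda>x. \<bar>h N s x\<bar> powr p)"
        by (rule Bochner_Integration.integrable_bound[OF i]) (use hp \<theta> in auto)
    qed (rule hp)
    also have "\<dots> = \<theta> powr p / slope powr q * (\<Sum>s\<in>UNIV. LINT x|P. \<bar>G s x\<bar> powr q)" by (simp add: sum_distrib_left)
    also have "\<dots> = \<theta> powr p" unfolding slope_powr using L by simp
    also have "\<dots> < 1" using \<theta> p powr_less_mono2[of p \<theta> 1] by simp
    finally show ?thesis .
  qed
  have "(\<lambda>n. \<Sum>s\<in>UNIV. LINT x|P. G s x * h (real n) s x) \<longlonglongrightarrow> (\<Sum>s\<in>UNIV. LINT x|P. \<theta> / slope powr (q - 1) * \<bar>G s x\<bar> powr q)"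
  proof (rule tendsto_sum, rule integral_dominated_convergence)
    fix s :: 'n
    show "integrable P (\<lambda>x. \<theta> / slope powr (q - 1) * \<bar>G s x\<bar> powr q)" using G_powr_int by simp
    show "AE x in P. norm (G s x * h (real n) s x) \<le> \<theta> / slope powr (q - 1) * \<bar>G s x\<bar> powr q" for n
      unfolding Gh using \<theta> by auto
    show "AE x in P. (\<lambda>n. G s x * h (real n) s x) \<longlonglongrightarrow> \<theta> / slope powr (q - 1) * \<bar>G s x\<bar> powr q"
    proof (rule AE_I2, rule tendsto_eventually)
      fix x
      obtain n where "\<bar>G s x\<bar> \<le> real n" using real_arch_simple by blast
      then show "\<forall>\<^sub>F n in sequentially. G s x * h (real n) s x = \<theta> / slope powr (q - 1) * \<bar>G s x\<bar> powr q"
        unfolding Gh by (intro eventually_sequentiallyI[of n]) auto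
    qed
  qed (use Gm in auto)
  moreover have "(\<Sum>s\<in>UNIV. LINT x|P. \<theta> / slope powr (q - 1) * \<bar>G s x\<bar> powr q) = \<theta> * slope"
  proof -
    have "(\<Sum>s\<in>UNIV. LINT x|P. \<theta> / slope powr (q - 1) * \<bar>G s x\<bar> powr q) = \<theta> / slope powr (q - 1) * slope powr q"
      unfolding slope_powr[symmetric] by (simp add: sum_distrib_left)
    also have "slope powr q = slope powr (q - 1) * slope" using powr_add[of slope "q - 1" 1] L by simp
    finally show ?thesis using L by simp
  qed
  ultimately have "(\<lambda>n. \<Sum>s\<in>UNIV. LINT x|P. G s x * h (real n) s x) \<longlonglongrightarrow> \<theta> * slope" by simp
  from order_tendstoD(1)[OF this \<theta>(3)] obtain n where n: "a < (\<Sum>s\<in>UNIV. LINT x|P. G s x * h (real n) s x)"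
    by (auto simp: eventually_sequentially)
  show ?thesis
    by (rule exI[of _ "h (real n)"], rule exI[of _ "\<theta> * (real n powr (q - 1) / slope powr (q - 1))"])
      (use hm hb[of "real n"] sum_p n in auto)
qed

text \<open>The family \<open>\<gamma>\<close> is evaluated at the path up to time \<open>s\<close>, so it yields an adapted vector field.\<close>
lemma direction_lipschitz:
  assumes a: "a < slope"
  shows "\<exists>\<gamma> K m. 0 \<le> K \<and> (\<forall>s. K-lipschitz_on UNIV (\<gamma> s)) \<and> (\<forall>s x. \<bar>\<gamma> s x\<bar> \<le> m) \<and>
     (\<Sum>s\<in>UNIV. LINT x|P. \<bar>\<gamma> s (keep {..s} x)\<bar> powr p) \<le> 1 \<and> (\<Sum>s\<in>UNIV. LINT x|P. G s x * \<gamma> s (keep {..s} x)) > a"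
proof (cases "slope = 0")
  case True
  then show ?thesis using a p
    by (intro exI[of _ "\<lambda>_ _. 0"] exI[of _ 0]) (auto simp: lipschitz_on_def)
next
  case False
  then have L: "slope > 0" using slope_nonneg by simp
  obtain h m where h: "\<And>s. h s \<in> borel_measurable (canon_filt s)" "\<And>s x. \<bar>h s x\<bar> \<le> m"
     "(\<Sum>s\<in>UNIV. LINT x|P. \<bar>h s x\<bar> powr p) < 1" "(\<Sum>s\<in>UNIV. LINT x|P. G s x * h s x) > a"
    using direction_bounded[OF a L] by blast
  let ?T = "real CARD('n)"
  let ?A = "\<Sum>s\<in>UNIV. LINT x|P. \<bar>h s x\<bar> powr p" and ?B = "\<Sum>s\<in>UNIV. LINT x|P. G s x * h s x"
  define e where "e = min ((1 - ?A) / ?T) ((?B - a) / (2 * ?T))"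
  have e: "e > 0" "?T * e \<le> 1 - ?A" "?T * e < ?B - a"
  proof -
    have T: "?T > 0" by simp
    show "e > 0" using h T by (simp add: e_def)
    have "e \<le> (1 - ?A) / ?T" "e \<le> (?B - a) / (2 * ?T)" by (auto simp: e_def)
    then show "?T * e \<le> 1 - ?A" "?T * e < ?B - a" using T h(4) by (auto simp: field_simps)
  qed
  have p0: "p > 0" using p by simp
  have "\<forall>s. \<exists>gK. (snd gK)-lipschitz_on UNIV (fst gK) \<and> (\<forall>x. \<bar>fst gK x\<bar> \<le> m) \<and>
    (LINT x|P. \<bar>fst gK (keep {..s} x)\<bar> powr p) \<le> (LINT x|P. \<bar>h s x\<bar> powr p) + e \<and>
    (LINT x|P. G s x * fst gK (keep {..s} x)) \<ge> (LINT x|P. G s x * h s x) - e" (is "\<forall>s. ?X s")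
  proof
    fix s
    from adapted_lipschitz_approx[OF prob_space_axioms sets_P h(1)[of s] h(2) p0 G_int e(1)]
    obtain g K where "K-lipschitz_on UNIV g" "(\<forall>x. \<bar>g x\<bar> \<le> m)"
      "(LINT x|P. \<bar>g (keep {..s} x)\<bar> powr p) \<le> (LINT x|P. \<bar>h s x\<bar> powr p) + e"
      "(LINT x|P. G s x * g (keep {..s} x)) \<ge> (LINT x|P. G s x * h s x) - e" by blast
    then show "?X s" by (intro exI[of _ "(g, K)"]) simp
  qed
  from choice[OF this] obtain gK where gK: "\<And>s. (snd (gK s))-lipschitz_on UNIV (fst (gK s))" "\<And>s x. \<bar>fst (gK s) x\<bar> \<le> m"
    "\<And>s. (LINT x|P. \<bar>fst (gK s) (keep {..s} x)\<bar> powr p) \<le> (LINT x|P. \<bar>h s x\<bar> powr p) + e"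
    "\<And>s. (LINT x|P. G s x * fst (gK s) (keep {..s} x)) \<ge> (LINT x|P. G s x * h s x) - e" by blast
  define \<gamma> where "\<gamma> s = fst (gK s)" for s
  define K where "K = (\<Sum>s\<in>UNIV. snd (gK s))"
  have K0: "0 \<le> snd (gK s)" for s using lipschitz_on_nonneg[OF gK(1)] .
  have "K-lipschitz_on UNIV (\<gamma> s)" for s
    unfolding \<gamma>_def K_def by (rule lipschitz_on_mono[OF gK(1)]) (auto intro!: member_le_sum K0)
  moreover have "0 \<le> K" unfolding K_def by (intro sum_nonneg K0)
  moreover have "(\<Sum>s\<in>UNIV. LINT x|P. \<bar>\<gamma> s (keep {..s} x)\<bar> powr p) \<le> 1"
  proof -
    have "(\<Sum>s\<in>UNIV. LINT x|P. \<bar>\<gamma> s (keep {..s} x)\<bar> powr p) \<le> (\<Sum>s\<in>UNIV. (LINT x|P. \<bar>h s x\<bar> powr p) + e)"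
      unfolding \<gamma>_def by (intro sum_mono gK)
    also have "\<dots> = ?A + ?T * e" by (simp add: sum.distrib)
    finally show ?thesis using e by simp
  qed
  moreover have "(\<Sum>s\<in>UNIV. LINT x|P. G s x * \<gamma> s (keep {..s} x)) > a"
  proof -
    have "?B - ?T * e = (\<Sum>s\<in>UNIV. (LINT x|P. G s x * h s x) - e)" by (simp add: sum_subtractf)
    also have "\<dots> \<le> (\<Sum>s\<in>UNIV. LINT x|P. G s x * \<gamma> s (keep {..s} x))"
      unfolding \<gamma>_def by (intro sum_mono gK)
    finally show ?thesis using e by simp
  qed
  moreover have "\<bar>\<gamma> s x\<bar> \<le> m" for s x unfolding \<gamma>_def by (rule gK)
  ultimately show ?thesis by blast
qed

end

section \<open>Lower bound and conclusion\<close>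

lemma adapted_wass_le:
  fixes P Q :: "'n::{finite,linorder} path measure"
  assumes \<pi>: "\<pi> \<in> bicausal_couplings P Q" and p: "p > 0" and B: "0 \<le> B"
    and c: "transport_cost p \<pi> \<le> B powr p"
  shows "adapted_wass p P Q \<le> B"
proof -
  let ?C = "\<lambda>\<pi>. transport_cost p \<pi> powr (1 / p)"
  have "adapted_wass p P Q \<le> ?C \<pi>"
    unfolding adapted_wass_def by (rule cINF_lower[OF _ \<pi>]) (auto intro!: bdd_belowI2[of _ 0])
  also have "\<dots> \<le> (B powr p) powr (1 / p)"
    using c p by (intro powr_mono2) (auto intro!: sum_nonneg integral_nonneg_AE)
  also have "\<dots> = B" using p B by (simp add: powr_powr)
  finally show ?thesis .
qed

context sensitivity
begin

text \<open>The law of the perturbed path is the witness. The constraint on \<open>r\<close> consists of one condition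
  each for the remainder, for invertibility of the perturbation, and for excluding stopping times whose
  excess under \<open>P\<close> is larger than \<open>\<epsilon>1\<close>.\<close>
lemma lower_bound:
  assumes unique: "\<And>\<tau>. \<tau> \<in> ST \<Longrightarrow> stop_value f P = J \<tau> \<Longrightarrow> AE x in P. \<tau> x = \<tau>o x"
    and a: "a < slope" and \<epsilon>: "\<epsilon> > 0"
  shows "\<exists>r0>0. \<forall>r. 0 < r \<longrightarrow> r \<le> r0 \<longrightarrow> (\<exists>Q\<in>aw_ball p r P. stop_value f P + r * a - \<epsilon> * r \<le> stop_value f Q)"
proof -
  have p0: "p > 0" using p by simp
  have bm: "borel_measurable P = borel_measurable borel" by (rule measurable_cong_sets[OF sets_P refl])
  obtain \<gamma> K m where \<gamma>: "0 \<le> K" "\<And>s. K-lipschitz_on UNIV (\<gamma> s)" "\<And>s x. \<bar>\<gamma> s x\<bar> \<le> m"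
     "(\<Sum>s\<in>UNIV. LINT x|P. \<bar>\<gamma> s (keep {..s} x)\<bar> powr p) \<le> 1" "(\<Sum>s\<in>UNIV. LINT x|P. G s x * \<gamma> s (keep {..s} x)) > a"
    using direction_lipschitz[OF a] by blast
  define Z where "Z s x = \<gamma> s (keep {..s} x)" for s x
  interpret adapted_flow Z K
  proof
    show "\<bar>Z s x - Z s y\<bar> \<le> K * norm (keep {..s} x - keep {..s} y)" for s x y
      using lipschitz_onD[OF \<gamma>(2)[of s], of "keep {..s} x" "keep {..s} y"] by (simp add: Z_def dist_norm)
  qed (rule \<gamma>(1))
  have Zb: "\<bar>Z s x\<bar> \<le> m" for s x unfolding Z_def by (rule \<gamma>(3))
  have m0: "0 \<le> m" using Zb[of undefined undefined] by linarith
  have Zp: "(\<Sum>s\<in>UNIV. LINT x|P. \<bar>Z s x\<bar> powr p) \<le> 1" using \<gamma>(4) by (simp add: Z_def)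
  have ZG: "(\<Sum>s\<in>UNIV. LINT x|P. G s x * Z s x) > a" using \<gamma>(5) by (simp add: Z_def)
  have ZP: "Z s \<in> borel_measurable P" for s unfolding bm by (rule Z_meas)
  have Zfilt: "Z s \<in> borel_measurable (canon_filt s)" for s
  proof -
    have "\<gamma> s \<in> borel_measurable borel"
      by (rule borel_measurable_continuous_onI[OF lipschitz_on_continuous_on[OF \<gamma>(2)]])
    from measurable_compose[OF measurable_gen_by_keep[of "{..s}" "\<lambda>x. x"] this]
    show ?thesis unfolding canon_filt_def Z_def[abs_def] .
  qed
  have DZ: "integrable P (\<lambda>x. D s x t * Z s x)" for s t
  proof (rule Bochner_Integration.integrable_bound[of P "\<lambda>x. \<bar>D s x t\<bar> * m"])
    show "AE x in P. norm (D s x t * Z s x) \<le> norm (\<bar>D s x t\<bar> * m)"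
      using Zb m0 by (auto simp: abs_mult intro!: mult_left_mono)
  qed (use D_int[of s t] ZP[of s] in auto)
  \<comment> \<open>The derivative of \<open>f\<close> in direction \<open>Z\<close>, and a bound for it that is uniform in the stopping index.\<close>
  define H where "H x t = (\<Sum>s\<in>UNIV. D s x t * Z s x)" for x t
  define HS where "HS x = (\<Sum>t\<in>UNIV. \<bar>H x t\<bar>)" for x
  have HI: "integrable P (\<lambda>x. H x t)" for t unfolding H_def using DZ by simp
  have HSI: "integrable P HS" unfolding HS_def[abs_def] using HI by simp
  have H_le: "\<bar>H x t\<bar> \<le> HS x" for x t unfolding HS_def by (rule member_le_sum) auto
  have HS0: "0 \<le> HS x" for x by (simp add: HS_def sum_nonneg)
  have H\<tau>: "integrable P (\<lambda>x. H x (\<sigma> x))" if "\<sigma> \<in> ST" for \<sigma>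
    by (rule integrable_select[OF HI ST_P[OF that]])
  have Ho: "(LINT x|P. H x (\<tau>o x)) > a"
  proof -
    have gZ: "integrable P (\<lambda>x. Z s x * g s x)" for s
    proof (rule Bochner_Integration.integrable_bound[of P "\<lambda>x. m * \<bar>g s x\<bar>"])
      show "AE x in P. norm (Z s x * g s x) \<le> norm (m * \<bar>g s x\<bar>)"
        using Zb m0 by (auto simp: abs_mult intro!: mult_right_mono)
    qed (use g_int[of s] ZP[of s] in auto)
    have "(LINT x|P. H x (\<tau>o x)) = (\<Sum>s\<in>UNIV. LINT x|P. Z s x * g s x)"
      unfolding H_def g_def[symmetric] using gZ by (simp add: mult.commute Bochner_Integration.integral_sum)
    also have "\<dots> = (\<Sum>s\<in>UNIV. LINT x|P. Z s x * G s x)"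
      unfolding G_def
      by (intro sum.cong refl sigma_finite_subalgebra.real_cond_exp_intg(2)[OF sub_canon, symmetric] gZ Zfilt)
        (use g_int in auto)
    finally show ?thesis using ZG by (simp add: mult.commute)
  qed
  have e4: "\<epsilon> / 4 > 0" using \<epsilon> by simp
  obtain \<epsilon>1 where \<epsilon>1: "\<epsilon>1 > 0"
    "\<And>\<sigma>. \<sigma> \<in> ST \<Longrightarrow> J \<sigma> \<le> stop_value f P + \<epsilon>1 \<Longrightarrow> (LINT x|P. \<bar>HS x\<bar> * indicator {x. \<sigma> x \<noteq> \<tau>o x} x) < \<epsilon> / 4"
    using near_optimal[OF \<tau>o unique HSI e4] by blast
  from rem_integral[OF P_wass e4] obtain rr where rr: "rr > 0"
    "\<And>Q \<pi> B. Q \<in> wass_space p \<Longrightarrow> \<pi> \<in> couplings P Q \<Longrightarrow> 0 < B \<Longrightarrow> B \<le> rr \<Longrightarrow> transport_cost p \<pi> \<le> B powr p \<Longrightarrow>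
     \<exists>V. integrable \<pi> V \<and> (LINT \<omega>|\<pi>. V \<omega>) \<le> \<epsilon> / 4 * B \<and> (\<forall>x y t. \<bar>taylor_rem x y t\<bar> \<le> V (x, y))" by blast
  define C1 where "C1 = (LINT x|P. HS x)"
  have C1: "C1 \<ge> 0" unfolding C1_def using HS0 by (intro integral_nonneg_AE) auto
  define r0 where "r0 = min rr (min (1 / (2 * (real CARD('n) * K + 1))) (\<epsilon>1 / (\<bar>a\<bar> + C1 + 1)))"
  have TK: "0 \<le> real CARD('n) * K" using \<gamma>(1) by simp
  have r0: "r0 > 0" using rr(1) \<epsilon>1(1) C1 TK by (simp add: r0_def add_nonneg_pos)
  show ?thesis
  proof (intro exI[of _ r0] conjI r0 allI impI)
    fix r assume r: "0 < r" "r \<le> r0"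
    have r1: "r \<le> rr" "r * (real CARD('n) * K) < 1" "r * (\<bar>a\<bar> + C1) \<le> \<epsilon>1"
    proof -
      show "r \<le> rr" using r by (simp add: r0_def)
      have "r \<le> 1 / (2 * (real CARD('n) * K + 1))" using r by (simp add: r0_def)
      then have "r * (2 * (real CARD('n) * K + 1)) \<le> 1" using TK by (simp add: le_divide_eq)
      moreover have "0 \<le> r * (real CARD('n) * K)" using r TK by simp
      ultimately show "r * (real CARD('n) * K) < 1" using r by (simp add: algebra_simps)
      have "r \<le> \<epsilon>1 / (\<bar>a\<bar> + C1 + 1)" using r by (simp add: r0_def)
      then have "r * (\<bar>a\<bar> + C1 + 1) \<le> \<epsilon>1" using C1 by (simp add: le_divide_eq)
      then show "r * (\<bar>a\<bar> + C1) \<le> \<epsilon>1" using r by (simp add: algebra_simps)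
    qed
    have r': "0 \<le> r" using r by simp
    let ?\<Phi> = "\<Phi> r"
    let ?Q = "distr P borel ?\<Phi>"
    let ?\<pi> = "distr P borel (\<lambda>x. (x, ?\<Phi> x))"
    have \<Phi>P: "?\<Phi> \<in> borel_measurable P" unfolding bm by (rule \<Phi>_meas)
    have pm: "(\<lambda>x. (x, ?\<Phi> x)) \<in> borel_measurable P" unfolding bm by (intro borel_measurable_Pair \<Phi>_meas) simp
    have \<pi>: "?\<pi> \<in> bicausal_couplings P ?Q" by (rule flow_bicausal[OF r' r1(2) prob_space_axioms sets_P])
    have pc: "?\<pi> \<in> couplings P ?Q" using \<pi> by (simp add: bicausal_couplings_def)
    have Q: "?Q \<in> wass_space p"
    proof -
      have "integrable P (\<lambda>x. norm (?\<Phi> x) powr p)"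
      proof (rule wass_integrable_plus[OF P_wass p0])
        let ?c = "1 + real CARD('n) * (r * m)"
        fix x
        have "norm (?\<Phi> x) \<le> norm x + norm ((\<chi> s. r * Z s x) :: 'n path)"
          using norm_triangle_ineq[of x "(\<chi> s. r * Z s x) :: 'n path"] by (simp add: \<Phi>_def plus_vec_def)
        also have "norm ((\<chi> s. r * Z s x) :: 'n path) \<le> (\<Sum>s\<in>UNIV. \<bar>((\<chi> s. r * Z s x) :: 'n path) $ s\<bar>)"
          by (rule norm_le_l1_cart)
        also have "\<dots> \<le> (\<Sum>s\<in>(UNIV::'n set). r * m)"
          using Zb r by (intro sum_mono) (auto simp: abs_mult intro!: mult_left_mono)
        also have "\<dots> = real CARD('n) * (r * m)" by simp
        also have "norm x + real CARD('n) * (r * m) \<le> ?c * (1 + norm x)"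
          using r m0 by (simp add: algebra_simps)
        finally have "norm (?\<Phi> x) \<le> ?c * (1 + norm x)" by simp
        then have "norm (?\<Phi> x) powr p \<le> (?c * (1 + norm x)) powr p" using p by (intro powr_mono2) auto
        also have "\<dots> = ?c powr p * (1 + norm x) powr p" by (rule powr_mult)
        finally show "\<bar>norm (?\<Phi> x) powr p\<bar> \<le> ?c powr p * (1 + norm x) powr p" by simp
      qed (auto)
      then have "integrable ?Q (\<lambda>x. norm x powr p)" by (subst integrable_distr_eq[OF \<Phi>P]) auto
      then show ?thesis using prob_space_distr[OF \<Phi>P] by (simp add: wass_space_def)
    qed
    interpret Q: stopping ?Q f by (rule stopping_wass[OF Q])
    have cost: "transport_cost p ?\<pi> \<le> r powr p"
    proof -
      have "(LINT \<omega>|?\<pi>. \<bar>fst \<omega> $ s - snd \<omega> $ s\<bar> powr p) = r powr p * (LINT x|P. \<bar>Z s x\<bar> powr p)" for s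
      proof -
        note [measurable] = measurable_fst_snd[OF refl]
        have "(\<lambda>\<omega> :: 'n path \<times> 'n path. \<bar>fst \<omega> $ s - snd \<omega> $ s\<bar> powr p) \<in> borel_measurable borel" by measurable
        then have "(LINT \<omega>|?\<pi>. \<bar>fst \<omega> $ s - snd \<omega> $ s\<bar> powr p) = (LINT x|P. \<bar>x $ s - ?\<Phi> x $ s\<bar> powr p)"
          by (subst integral_distr[OF pm]) auto
        also have "\<dots> = (LINT x|P. r powr p * \<bar>Z s x\<bar> powr p)"
          using r by (intro Bochner_Integration.integral_cong refl) (simp add: abs_mult powr_mult)
        finally show ?thesis by simp
      qed
      then have "transport_cost p ?\<pi> = r powr p * (\<Sum>s\<in>UNIV. LINT x|P. \<bar>Z s x\<bar> powr p)"
        by (simp add: sum_distrib_left)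
      also have "\<dots> \<le> r powr p * 1" using Zp by (intro mult_left_mono) auto
      finally show ?thesis by simp
    qed
    have ball: "?Q \<in> aw_ball p r P" unfolding aw_ball_def using Q adapted_wass_le[OF \<pi> p0 r' cost] by simp
    obtain V where V: "integrable ?\<pi> V" "(LINT \<omega>|?\<pi>. V \<omega>) \<le> \<epsilon> / 4 * r" "\<And>x y t. \<bar>taylor_rem x y t\<bar> \<le> V (x, y)"
      using rr(2)[OF Q pc r(1) r1(1) cost] by auto
    have v: "integrable P (\<lambda>x. V (x, ?\<Phi> x))" "(LINT x|P. V (x, ?\<Phi> x)) \<le> \<epsilon> / 4 * r"
    proof -
      show "integrable P (\<lambda>x. V (x, ?\<Phi> x))" by (rule integrable_distr[OF pm V(1)])
      have "V \<in> borel_measurable borel" using V(1) by auto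
      from integral_distr[OF pm this] show "(LINT x|P. V (x, ?\<Phi> x)) \<le> \<epsilon> / 4 * r" using V(2) by simp
    qed
    \<comment> \<open>Each stopping time \<open>\<tau>\<close> for \<open>?Q\<close> is pulled back to the stopping time \<open>\<sigma>\<close> for \<open>P\<close>.\<close>
    have "stop_value f P + r * a - \<epsilon> * r \<le> stop_value f ?Q"
      unfolding stop_value_def[of f ?Q]
    proof (rule cINF_greatest)
      show "(ST :: ('n path \<Rightarrow> 'n) set) \<noteq> {}" using \<tau>o by auto
      fix \<tau> :: "'n path \<Rightarrow> 'n" assume \<tau>: "\<tau> \<in> ST"
      define \<sigma> where "\<sigma> x = \<tau> (?\<Phi> x)" for x
      have \<sigma>: "\<sigma> \<in> ST" unfolding \<sigma>_def[abs_def] by (rule ST_compose[OF \<tau> \<Phi>_adapted[OF r' r1(2)]])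
      have I: "integrable P (\<lambda>x. f (?\<Phi> x) (\<sigma> x))" "(LINT x|?Q. f x (\<tau> x)) = (LINT x|P. f (?\<Phi> x) (\<sigma> x))"
        unfolding \<sigma>_def using Q.f_tau_int[OF \<tau>] integrable_distr_eq[OF \<Phi>P f_tau_borel[OF \<tau>]]
          integral_distr[OF \<Phi>P f_tau_borel[OF \<tau>]] by auto
      have "J \<sigma> + r * (LINT x|P. H x (\<sigma> x)) - (LINT x|P. V (x, ?\<Phi> x)) = (LINT x|P. f x (\<sigma> x) + r * H x (\<sigma> x) - V (x, ?\<Phi> x))"
        unfolding J_def using f_tau_int[OF \<sigma>] H\<tau>[OF \<sigma>] v by simp
      also have "\<dots> \<le> (LINT x|P. f (?\<Phi> x) (\<sigma> x))"
      proof (rule integral_mono)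
        show "integrable P (\<lambda>x. f x (\<sigma> x) + r * H x (\<sigma> x) - V (x, ?\<Phi> x))"
          using f_tau_int[OF \<sigma>] H\<tau>[OF \<sigma>] v by simp
        fix x
        have "(\<Sum>s\<in>UNIV. D s x (\<sigma> x) * (?\<Phi> x $ s - x $ s)) = r * H x (\<sigma> x)"
          by (simp add: H_def sum_distrib_left mult_ac)
        then show "f x (\<sigma> x) + r * H x (\<sigma> x) - V (x, ?\<Phi> x) \<le> f (?\<Phi> x) (\<sigma> x)"
          using V(3)[of x "?\<Phi> x" "\<sigma> x"] by (simp add: taylor_rem_def)
      qed (rule I)
      finally have main: "J \<sigma> + r * (LINT x|P. H x (\<sigma> x)) - \<epsilon> / 4 * r \<le> (LINT x|?Q. f x (\<tau> x))"
        using v(2) I(2) by linarith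
      show "stop_value f P + r * a - \<epsilon> * r \<le> (LINT x|?Q. f x (\<tau> x))"
      proof (cases "J \<sigma> \<le> stop_value f P + \<epsilon>1")
        case True
        let ?I = "\<lambda>x. \<bar>HS x\<bar> * indicator {x. \<sigma> x \<noteq> \<tau>o x} x"
        have ms: "{x. \<sigma> x \<noteq> \<tau>o x} \<in> sets P"
        proof -
          note [measurable] = ST_P[OF \<sigma>] ST_P[OF \<tau>o]
          have "{x \<in> space P. \<sigma> x \<noteq> \<tau>o x} \<in> sets P" by measurable
          then show ?thesis by (simp add: space_P)
        qed
        have II: "integrable P ?I"
          using integrable_mult_indicator[OF ms integrable_abs[OF HSI]] by (simp add: mult.commute)
        have "a - \<epsilon> / 2 \<le> (LINT x|P. H x (\<tau>o x)) - 2 * (LINT x|P. ?I x)"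
          using Ho \<epsilon>1(2)[OF \<sigma> True] by linarith
        also have "\<dots> = (LINT x|P. H x (\<tau>o x) - 2 * ?I x)" using H\<tau>[OF \<tau>o] II by simp
        also have "\<dots> \<le> (LINT x|P. H x (\<sigma> x))"
        proof (rule integral_mono)
          fix x show "H x (\<tau>o x) - 2 * ?I x \<le> H x (\<sigma> x)"
            using H_le[of x "\<tau>o x"] H_le[of x "\<sigma> x"] by (auto simp: indicator_def)
        qed (use H\<tau>[OF \<tau>o] H\<tau>[OF \<sigma>] II in auto)
        finally have "r * (a - \<epsilon> / 2) \<le> r * (LINT x|P. H x (\<sigma> x))" using r by (intro mult_left_mono) auto
        then have "stop_value f P + r * (a - \<epsilon> / 2) - \<epsilon> / 4 * r \<le> (LINT x|?Q. f x (\<tau> x))"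
          using main stop_value_le[OF \<sigma>] by linarith
        moreover have "r * (a - \<epsilon> / 2) - \<epsilon> / 4 * r = r * a - 3 / 4 * (\<epsilon> * r)" by (simp add: algebra_simps)
        moreover have "0 \<le> \<epsilon> * r" using \<epsilon> r by simp
        ultimately show ?thesis by linarith
      next
        case False
        have "- C1 \<le> (LINT x|P. H x (\<sigma> x))"
        proof -
          have "(LINT x|P. - HS x) \<le> (LINT x|P. H x (\<sigma> x))"
          proof (rule integral_mono)
            fix x show "- HS x \<le> H x (\<sigma> x)" using H_le[of x "\<sigma> x"] by linarith
          qed (use HSI H\<tau>[OF \<sigma>] in auto)
          then show ?thesis by (simp add: C1_def)
        qed
        from mult_left_mono[OF this r'] have "- (r * C1) \<le> r * (LINT x|P. H x (\<sigma> x))" by simp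
        moreover have "r * a \<le> r * \<bar>a\<bar>" using r by (intro mult_left_mono) auto
        moreover have "r * \<bar>a\<bar> + r * C1 \<le> \<epsilon>1" using r1(3) by (simp add: algebra_simps)
        moreover have "\<epsilon> / 4 * r \<le> \<epsilon> * r" using \<epsilon> r by simp
        ultimately show ?thesis using main False by linarith
      qed
    qed
    with ball show "\<exists>Q\<in>aw_ball p r P. stop_value f P + r * a - \<epsilon> * r \<le> stop_value f Q" by blast
  qed
qed

end

theorem theorem2p8:
  fixes p q c :: real
    and P :: "'n::{finite, linorder} path measure"
    and f :: "'n path \<Rightarrow> 'n \<Rightarrow> real"
    and \<tau>opt :: "'n path \<Rightarrow> 'n"
  assumes "1 < p" and "q = p / (p - 1)"
    and "P \<in> wass_space p"
    and adapted: "\<And>t. (\<lambda>x. f x t) \<in> borel_measurable (canon_filt t)"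
    and C1: "\<And>t. C1_fun (\<lambda>x. f x t)"
    and "c > 0"
    and growth: "\<And>x t. (\<Sum>s\<in>UNIV. \<bar>partial_deriv s (\<lambda>y. f y t) x\<bar>)
                        \<le> c * (1 + (\<Sum>s\<in>UNIV. \<bar>x $ s\<bar> powr (p - 1)))"
    and "\<tau>opt \<in> ST"
    and optimal: "stop_value f P = (LINT x|P. f x (\<tau>opt x))"
    and unique: "\<And>\<tau>. \<tau> \<in> ST \<Longrightarrow> stop_value f P = (LINT x|P. f x (\<tau> x))
                    \<Longrightarrow> AE x in P. \<tau> x = \<tau>opt x"
  shows "(\<lambda>r. (SUP Q\<in>aw_ball p r P. stop_value f Q)
              - (stop_value f P
                 + r * (\<Sum>t\<in>UNIV. LINT x|P.
                          \<bar>real_cond_exp P (canon_filt t)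
                              (\<lambda>y. partial_deriv t (\<lambda>z. f z (\<tau>opt y)) y) x\<bar> powr q)
                       powr (1 / q)))
         \<in> o[at_right 0](\<lambda>r. r)"
proof -
  interpret integrand p c f by unfold_locales (use assms in auto)
  interpret sensitivity p q c f P \<tau>opt
  proof -
    interpret stopping P f by (rule stopping_wass[OF \<open>P \<in> wass_space p\<close>])
    show "sensitivity p q c f P \<tau>opt"
      by unfold_locales (use assms in \<open>auto simp: J_def\<close>)
  qed
  have uni: "AE x in P. \<tau> x = \<tau>opt x" if "\<tau> \<in> ST" "stop_value f P = J \<tau>" for \<tau>
    using unique that by (simp add: J_def)
  have sl: "(\<Sum>t\<in>UNIV. LINT x|P. \<bar>real_cond_exp P (canon_filt t)
                (\<lambda>y. partial_deriv t (\<lambda>z. f z (\<tau>opt y)) y) x\<bar> powr q) powr (1 / q) = slope"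
    by (simp add: slope_def G_def g_def[abs_def] D_def)
  show ?thesis
    unfolding sl
  proof (rule landau_o.smallI)
    fix k :: real assume k: "k > 0"
    have k2: "k / 2 > 0" "slope - k / 2 < slope" using k by auto
    obtain r1 where r1: "r1 > 0" "\<And>r Q. 0 < r \<Longrightarrow> r \<le> r1 \<Longrightarrow> Q \<in> aw_ball p r P \<Longrightarrow> stop_value f Q \<le> stop_value f P + r * slope + k * r"
      using upper_bound[OF k] by blast
    obtain r2 where r2: "r2 > 0" "\<And>r. 0 < r \<Longrightarrow> r \<le> r2 \<Longrightarrow>
        \<exists>Q\<in>aw_ball p r P. stop_value f P + r * (slope - k / 2) - k / 2 * r \<le> stop_value f Q"
      using lower_bound[OF uni k2(2,1)] by blast
    have "\<forall>\<^sub>F r in at_right 0. 0 < r \<and> r < min r1 r2"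
      using r1(1) r2(1) by (auto simp: eventually_at_right_field intro!: exI[of _ "min r1 r2"])
    then show "\<forall>\<^sub>F r in at_right 0. norm ((SUP Q\<in>aw_ball p r P. stop_value f Q) - (stop_value f P + r * slope)) \<le> k * norm r"
    proof eventually_elim
      case (elim r)
      let ?S = "SUP Q\<in>aw_ball p r P. stop_value f Q"
      have up: "stop_value f Q \<le> stop_value f P + r * slope + k * r" if "Q \<in> aw_ball p r P" for Q
        using r1(2)[of r Q] elim that by auto
      obtain Q where Q: "Q \<in> aw_ball p r P" "stop_value f P + r * (slope - k / 2) - k / 2 * r \<le> stop_value f Q"
        using r2(2)[of r] elim by auto
      have "?S \<le> stop_value f P + r * slope + k * r" by (rule cSUP_least) (use Q(1) up in auto)
      moreover have "stop_value f Q \<le> ?S" by (rule cSUP_upper[OF Q(1)]) (use up in \<open>auto intro!: bdd_aboveI2\<close>)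
      moreover have "stop_value f P + r * (slope - k / 2) - k / 2 * r = stop_value f P + r * slope - k * r"
        by (simp add: field_simps)
      ultimately show ?case using Q(2) elim by (simp add: abs_le_iff)
    qed
  qed
qed

end
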